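(* Assume that there exist constants $0<\nu_1<\nu_2$ and $0<\mu_1<\mu_2$ such that $$\nu_1|\xi|^2\le a^{ij}(x)\xi_i\xi_j\le\nu_2|\xi|^2,\qquad \mu_1|\xi|^2\le \hat a^{ij}(x)\xi_i\xi_j\le\mu_2|\xi|^2\qquad\text{for all }x,\xi\in\mathbb{R}^N.$$ Assume that $V_0$ is smooth and that $W_0$ is a smooth function on $\mathbb{R}^N$ such that $$U_0(x)=-\big(\tfrac12D_i(a^{ij}D_jW_0)+b\cdot\nabla W_0+\tfrac12\hat a^{ij}D_iW_0D_jW_0+V_0\big)\to\infty\quad\text{as }|x|\to\infty .$$ Let $V:\mathbb{R}^N\to\mathbb{R}$ be smooth with $V$ and $DV$ bounded. Let $\Lambda^*(V)$ be the smallest $\Lambda\in\mathbb{R}$ for which $$\tfrac12D_i(a^{ij}D_jW)+\tfrac12\hat a^{ij}D_iWD_jW+b\cdot\nabla W+V_0+V=\Lambda\quad\text{in }\mathbb{R}^N$$ has a smooth solution $W$, let $W^*$ be the solution (with $W^*(0)=0$) for $\Lambda=\Lambda^*(V)$, and let $\mu^*$ be the invariant probability measure of the diffusion $dX_t=(\tilde b(X_t)+\hat a\nabla W^*(X_t))\,dt+\sigma(X_t)\,dB_t$. Then $$\int U_0(x)\,d\mu^*(x)\le-\Lambda^*(V)+\|V\|_\infty .$$ In particular, $\int U_0(x)\,d\mu^*(x)<\infty$.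
   Context: $D_i=\partial/\partial x_i$, and repeated indices are summed over $1,\dots,N$. $a=[a^{ij}]$ and $\hat a=[\hat a^{ij}]$ are symmetric $N\times N$ matrix-valued functions on $\mathbb{R}^N$, $b:\mathbb{R}^N\to\mathbb{R}^N$, $V_0:\mathbb{R}^N\to\mathbb{R}$; $a^{ij},\hat a^{ij},b$ are sufficiently smooth (may be read as $C^\infty$). $\tilde b^i=b^i+\tfrac12D_ja^{ij}$, $\sigma=a^{1/2}$, $\{B_t\}$ is an $N$-dimensional Brownian motion. $\|V\|_\infty$ is the supremum norm. Under the stated hypotheses $\Lambda^*(V)$ exists and is finite, $W^*$ is unique, and the diffusion is ergodic with a unique invariant probability measure. *)

theory Defs
  imports "HOL-Probability.Probability"
begin

definition part_deriv :: "'n \<Rightarrow> (real^'n::finite \<Rightarrow> real) \<Rightarrow> real^'n \<Rightarrow> real" where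
  "part_deriv i f x = frechet_derivative f (at x) (axis i 1)"

definition grad :: "(real^'n::finite \<Rightarrow> real) \<Rightarrow> real^'n \<Rightarrow> real^'n" where
  "grad f x = (\<chi> i. part_deriv i f x)"

fun times_cont_diff :: "nat \<Rightarrow> (real^'n::finite \<Rightarrow> real) \<Rightarrow> bool" where
  "times_cont_diff 0 f \<longleftrightarrow> continuous_on UNIV f"
| "times_cont_diff (Suc k) f \<longleftrightarrow>
     (\<forall>x. f differentiable (at x)) \<and> (\<forall>i. times_cont_diff k (part_deriv i f))"

definition smooth :: "(real^'n::finite \<Rightarrow> real) \<Rightarrow> bool" where
  "smooth f \<longleftrightarrow> (\<forall>k. times_cont_diff k f)"

definition smooth_vector :: "(real^'n::finite \<Rightarrow> real^'n) \<Rightarrow> bool" where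
  "smooth_vector f \<longleftrightarrow> (\<forall>i. smooth (\<lambda>x. f x $ i))"

definition smooth_matrix :: "(real^'n::finite \<Rightarrow> real^'n^'n) \<Rightarrow> bool" where
  "smooth_matrix f \<longleftrightarrow> (\<forall>i j. smooth (\<lambda>x. f x $ i $ j))"

definition hjb_operator ::
  "(real^'n::finite \<Rightarrow> real^'n^'n) \<Rightarrow> (real^'n \<Rightarrow> real^'n^'n) \<Rightarrow> (real^'n \<Rightarrow> real^'n) \<Rightarrow>
   (real^'n \<Rightarrow> real) \<Rightarrow> real^'n \<Rightarrow> real" where
  "hjb_operator a ahat b W x =
     1/2 * (\<Sum>i\<in>UNIV. part_deriv i (\<lambda>y. \<Sum>j\<in>UNIV. a y $ i $ j * part_deriv j W y) x)
     + b x \<bullet> grad W x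
     + 1/2 * (\<Sum>i\<in>UNIV. \<Sum>j\<in>UNIV. ahat x $ i $ j * part_deriv i W x * part_deriv j W x)"

definition ergodic_solution ::
  "(real^'n::finite \<Rightarrow> real^'n^'n) \<Rightarrow> (real^'n \<Rightarrow> real^'n^'n) \<Rightarrow> (real^'n \<Rightarrow> real^'n) \<Rightarrow>
   (real^'n \<Rightarrow> real) \<Rightarrow> real \<Rightarrow> (real^'n \<Rightarrow> real) \<Rightarrow> bool" where
  "ergodic_solution a ahat b f \<Lambda> W \<longleftrightarrow>
     smooth W \<and> (\<forall>x. hjb_operator a ahat b W x + f x = \<Lambda>)"

definition smallest_constant ::
  "(real^'n::finite \<Rightarrow> real^'n^'n) \<Rightarrow> (real^'n \<Rightarrow> real^'n^'n) \<Rightarrow> (real^'n \<Rightarrow> real^'n) \<Rightarrow>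
   (real^'n \<Rightarrow> real) \<Rightarrow> real \<Rightarrow> bool" where
  "smallest_constant a ahat b f \<Lambda> \<longleftrightarrow>
     (\<exists>W. ergodic_solution a ahat b f \<Lambda> W) \<and>
     (\<forall>\<Lambda>' W. ergodic_solution a ahat b f \<Lambda>' W \<longrightarrow> \<Lambda> \<le> \<Lambda>')"

definition ito_drift ::
  "(real^'n::finite \<Rightarrow> real^'n^'n) \<Rightarrow> (real^'n \<Rightarrow> real^'n) \<Rightarrow> real^'n \<Rightarrow> real^'n" where
  "ito_drift a b x = (\<chi> i. b x $ i + 1/2 * (\<Sum>j\<in>UNIV. part_deriv j (\<lambda>y. a y $ i $ j) x))"

definition psd_sqrt :: "real^'n^'n::finite \<Rightarrow> real^'n^'n \<Rightarrow> bool" where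
  "psd_sqrt S A \<longleftrightarrow> transpose S = S \<and> (\<forall>\<xi>. 0 \<le> \<xi> \<bullet> (S *v \<xi>)) \<and> S ** S = A"

text \<open>Time is indexed by \<^typ>\<open>real\<close>, but only times in \<open>{0..}\<close> matter; a filtration given
  on \<open>{0..}\<close> is extended by its value at 0.\<close>

definition filtered_prob_space :: "'w measure \<Rightarrow> (real \<Rightarrow> 'w measure) \<Rightarrow> bool" where
  "filtered_prob_space M F \<longleftrightarrow>
     prob_space M \<and> filtration (space M) F \<and> (\<forall>t. subalgebra M (F t))"

definition brownian_motion ::
  "'w measure \<Rightarrow> (real \<Rightarrow> 'w measure) \<Rightarrow> (real \<Rightarrow> 'w \<Rightarrow> real^'n::finite) \<Rightarrow> bool" where
  "brownian_motion M F B \<longleftrightarrow>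
     filtered_prob_space M F \<and>
     (\<forall>t\<ge>0. B t \<in> borel_measurable (F t)) \<and>
     (AE \<omega> in M. B 0 \<omega> = 0) \<and>
     (\<forall>\<omega>\<in>space M. continuous_on {0..} (\<lambda>t. B t \<omega>)) \<and>
     (\<forall>s t. 0 \<le> s \<and> s < t \<longrightarrow>
        prob_space.indep_set M (sets (F s))
          {(\<lambda>\<omega>. B t \<omega> - B s \<omega>) -` A \<inter> space M | A. A \<in> sets borel} \<and>
        prob_space.indep_vars M (\<lambda>_. borel) (\<lambda>i \<omega>. (B t \<omega> - B s \<omega>) $ i) UNIV \<and>
        (\<forall>i. distributed M lborel (\<lambda>\<omega>. (B t \<omega> - B s \<omega>) $ i)
               (normal_density 0 (sqrt (t - s)))))"

definition null_in_prob :: "'w measure \<Rightarrow> (nat \<Rightarrow> 'w \<Rightarrow> ennreal) \<Rightarrow> bool" where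
  "null_in_prob M Z \<longleftrightarrow>
     (\<forall>\<epsilon>>0. (\<lambda>n. measure M {\<omega>\<in>space M. ennreal \<epsilon> < Z n \<omega>}) \<longlonglongrightarrow> 0)"

text \<open>A triple \<open>(k, \<tau>, Y)\<close> represents the simple process on \<open>[0,t]\<close> that equals \<open>Y i\<close> on
  \<open>(\<tau> i, \<tau> (i+1)]\<close> for \<open>i < k\<close>. The Ito integral of a progressively measurable integrand is the
  limit in probability of integrals of simple processes that approximate it in \<open>L\<^sup>2([0,t])\<close>, in
  probability (\<open>norm\<close> on matrices is the Frobenius norm). The time integral is taken in
  \<^typ>\<open>ennreal\<close>, so no spurious value arises when the distance is infinite.\<close>

definition simple_process ::
  "'w measure \<Rightarrow> (real \<Rightarrow> 'w measure) \<Rightarrow> real \<Rightarrow> nat \<Rightarrow> (nat \<Rightarrow> real) \<Rightarrow>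
   (nat \<Rightarrow> 'w \<Rightarrow> real^'n^'n::finite) \<Rightarrow> bool" where
  "simple_process M F t k \<tau> Y \<longleftrightarrow>
     \<tau> 0 = 0 \<and> \<tau> k = t \<and>
     (\<forall>i<k. \<tau> i \<le> \<tau> (Suc i) \<and> Y i \<in> borel_measurable (F (\<tau> i)) \<and> bounded (Y i ` space M))"

definition simple_value ::
  "nat \<Rightarrow> (nat \<Rightarrow> real) \<Rightarrow> (nat \<Rightarrow> 'w \<Rightarrow> real^'n^'n::finite) \<Rightarrow> real \<Rightarrow> 'w \<Rightarrow> real^'n^'n" where
  "simple_value k \<tau> Y s \<omega> = (\<Sum>i<k. indicator {\<tau> i<..\<tau> (Suc i)} s *\<^sub>R Y i \<omega>)"

definition simple_integral ::
  "(real \<Rightarrow> 'w \<Rightarrow> real^'n::finite) \<Rightarrow> nat \<Rightarrow> (nat \<Rightarrow> real) \<Rightarrow> (nat \<Rightarrow> 'w \<Rightarrow> real^'n^'n) \<Rightarrow>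
   'w \<Rightarrow> real^'n" where
  "simple_integral B k \<tau> Y \<omega> = (\<Sum>i<k. Y i \<omega> *v (B (\<tau> (Suc i)) \<omega> - B (\<tau> i) \<omega>))"

definition has_ito_integral ::
  "'w measure \<Rightarrow> (real \<Rightarrow> 'w measure) \<Rightarrow> (real \<Rightarrow> 'w \<Rightarrow> real^'n::finite) \<Rightarrow>
   (real \<Rightarrow> 'w \<Rightarrow> real^'n^'n) \<Rightarrow> real \<Rightarrow> ('w \<Rightarrow> real^'n) \<Rightarrow> bool" where
  "has_ito_integral M F B H t J \<longleftrightarrow>
     J \<in> borel_measurable M \<and>
     (\<forall>u\<in>{0..t}. (\<lambda>(s, \<omega>). H s \<omega>) \<in> borel_measurable (restrict_space borel {0..u} \<Otimes>\<^sub>M F u)) \<and>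
     (\<exists>k \<tau> Y.
        (\<forall>n. simple_process M F t (k n) (\<tau> n) (Y n)) \<and>
        null_in_prob M (\<lambda>n \<omega>. \<integral>\<^sup>+ s\<in>{0..t}.
          ennreal ((norm (simple_value (k n) (\<tau> n) (Y n) s \<omega> - H s \<omega>))\<^sup>2) \<partial>lborel) \<and>
        null_in_prob M (\<lambda>n \<omega>.
          ennreal (norm (simple_integral B (k n) (\<tau> n) (Y n) \<omega> - J \<omega>))))"

definition sde_solution ::
  "'w measure \<Rightarrow> (real \<Rightarrow> 'w measure) \<Rightarrow> (real \<Rightarrow> 'w \<Rightarrow> real^'n::finite) \<Rightarrow>
   (real^'n \<Rightarrow> real^'n) \<Rightarrow> (real^'n \<Rightarrow> real^'n^'n) \<Rightarrow> real^'n \<Rightarrow>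
   (real \<Rightarrow> 'w \<Rightarrow> real^'n) \<Rightarrow> bool" where
  "sde_solution M F B \<beta> \<sigma> x X \<longleftrightarrow>
     (\<forall>t\<ge>0. X t \<in> borel_measurable (F t)) \<and>
     (\<forall>\<omega>\<in>space M. continuous_on {0..} (\<lambda>t. X t \<omega>)) \<and>
     (AE \<omega> in M. X 0 \<omega> = x) \<and>
     (\<forall>t\<ge>0. (AE \<omega> in M. set_integrable lborel {0..t} (\<lambda>s. \<beta> (X s \<omega>))) \<and>
        has_ito_integral M F B (\<lambda>s \<omega>. \<sigma> (X s \<omega>)) t
          (\<lambda>\<omega>. X t \<omega> - X 0 \<omega> - (LINT s:{0..t}|lborel. \<beta> (X s \<omega>))))"

definition transition_function ::
  "'w measure \<Rightarrow> (real^'n::finite \<Rightarrow> real \<Rightarrow> 'w \<Rightarrow> real^'n) \<Rightarrow> real \<Rightarrow> real^'n \<Rightarrow> (real^'n) measure" where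
  "transition_function M X t x = distr M borel (X x t)"

text \<open>The first condition on \<open>P t\<close> says that it is a Markov kernel; without it \<open>bind\<close> is
  meaningless. The second one reads \<open>\<integral> P t x A \<mu>(dx) = \<mu> A\<close> for all Borel sets \<open>A\<close>.\<close>

definition invariant_prob ::
  "(real \<Rightarrow> real^'n::finite \<Rightarrow> (real^'n) measure) \<Rightarrow> (real^'n) measure \<Rightarrow> bool" where
  "invariant_prob P \<mu> \<longleftrightarrow>
     prob_space \<mu> \<and> sets \<mu> = sets borel \<and>
     (\<forall>t\<ge>0. P t \<in> borel \<rightarrow>\<^sub>M prob_algebra borel \<and> \<mu> \<bind> P t = \<mu>)"

end

theory Submission
  imports Defs
begin

text \<open>
  Put \<open>\<Phi> = W - W\<^sub>0\<close> and \<open>q = U\<^sub>0 + \<Lambda> - V\<close>. Subtracting the two equations gives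
  \<open>L \<Phi> = q + \<onehalf> ahat \<nabla>\<Phi> \<cdot> \<nabla>\<Phi>\<close> for the generator \<open>L\<close> of the diffusion. Although \<open>\<Phi>\<close> need not be
  bounded, \<open>f = tanh (\<epsilon> \<Phi>)\<close> is, and for small \<open>\<epsilon>\<close> the negative part of the second-order term of
  \<open>L f\<close> is absorbed by the quadratic term, so that \<open>L f \<ge> \<epsilon> (1 - f\<^sup>2) q\<close>. Since \<open>q\<close> is bounded below, a
  localised Ito formula for \<open>f\<close> and the invariance of \<open>\<mu>\<close> give \<open>\<integral> (1 - f\<^sup>2) q \<partial>\<mu> \<le> 0\<close>, and
  \<open>\<epsilon> \<rightarrow> 0\<close> gives \<open>\<integral> q \<partial>\<mu> \<le> 0\<close>.

  The Ito formula is obtained in expectation from an Euler scheme on the grid \<open>i / n\<close>, stopped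
  when the path leaves a large ball: Taylor's formula to second order is applied to every step, and
  the error of replacing the increment of the stochastic integral by \<open>\<sigma> (X\<^sub>i) (B\<^sub>i\<^sub>+\<^sub>1 - B\<^sub>i)\<close> is
  orthogonal to the past and small in \<open>L\<^sup>2\<close>.
\<close>

section \<open>Brownian increments\<close>

text \<open>\<open>tanh\<close> is chosen for the ratio of its derivatives: for f = tanh (e \<Phi>)
  the second derivative in \<Phi> is -2 e f times the first, so at most 2 e times it in size. With
  \<open>a\<close> bounded by \<nu>2 and \<open>ahat\<close> bounded below by \<mu>1, the absorption
  works at every point once 2 e \<nu>2 \<le> \<mu>1, however fast \<Phi> grows. On the stochastic
  side the obstacle is that an Ito integral is given only as the limit in probability of the
  integrals of some unknown simple processes. Lenglart's inequality shows that every other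
  approximation has the same limit, so grids may be used, and bounded second moments carry mean zero
  and orthogonality to the limit. Drift and derivatives of f are bounded only on balls, while
  Gaussian steps are unbounded; this is why Taylor's remainder takes the form K min(|v|^2, |v|^3):
  the Gaussian part of a step has a third moment of order n^(-3/2), the rest is controlled in second
  moment only. The outcome is one-sided: up to a small error, Riemann sums of the means of h(X_t)
  over [0,1] are at most E f(X_1) - f(x). By invariance the right side has \<mu>-mean 0 and the left
  side the \<mu>-mean of h.\<close>

locale brownian = prob_space M for M :: "'w measure" +
  fixes F :: "real \<Rightarrow> 'w measure" and B :: "real \<Rightarrow> 'w \<Rightarrow> real^'n::finite"
  assumes bm: "brownian_motion M F B"
begin

lemma space_F [simp]: "space (F t) = space M"
  and sets_F: "A \<in> sets (F t) \<Longrightarrow> A \<in> sets M"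
proof -
  have "subalgebra M (F t)"
    using bm unfolding brownian_motion_def filtered_prob_space_def by blast
  then show "space (F t) = space M" "A \<in> sets (F t) \<Longrightarrow> A \<in> sets M"
    unfolding subalgebra_def by (simp_all add: subset_iff)
qed

lemma sets_F_mono: "s \<le> t \<Longrightarrow> A \<in> sets (F s) \<Longrightarrow> A \<in> sets (F t)"
proof -
  have "filtration (space M) F"
    using bm unfolding brownian_motion_def filtered_prob_space_def by blast
  from filtration.sets_F_mono[OF this] show "s \<le> t \<Longrightarrow> A \<in> sets (F s) \<Longrightarrow> A \<in> sets (F t)"
    by (rule subsetD)
qed

lemma measurable_F_M: "f \<in> measurable (F t) N \<Longrightarrow> f \<in> measurable M N"
  using measurable_mono[of N N "F t" M] sets_F by (auto simp: subset_iff)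

lemma measurable_F_mono: "s \<le> t \<Longrightarrow> f \<in> measurable (F s) N \<Longrightarrow> f \<in> measurable (F t) N"
  using measurable_mono[of N N "F s" "F t"] sets_F_mono by (auto simp: subset_iff)

lemma B_measurable_F: "0 \<le> t \<Longrightarrow> B t \<in> borel_measurable (F t)"
  using bm unfolding brownian_motion_def by blast

lemma B_measurable [measurable]: "0 \<le> t \<Longrightarrow> B t \<in> borel_measurable M"
  using B_measurable_F measurable_F_M by blast

text \<open>The hypothesis on Brownian motion speaks of the sets of \<open>F s\<close> and of
  preimages under the increment. The preimages under \<open>\<xi>\<close> and \<open>\<phi>\<close>
  form subfamilies of these that are stable under intersection, so independence extends to the
  sigma-algebras they generate, which is the form that \<open>indep_var\<close> requires.\<close>

lemma indep_increment:
  fixes \<xi> :: "'w \<Rightarrow> real" and \<phi> :: "real^'n \<Rightarrow> real"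
  assumes st: "0 \<le> s" "s < t" and \<xi>: "\<xi> \<in> borel_measurable (F s)" and \<phi>: "\<phi> \<in> borel_measurable borel"
  shows "indep_var borel \<xi> borel (\<lambda>\<omega>. \<phi> (B t \<omega> - B s \<omega>))"
proof -
  have 1: "indep_set (sets (F s)) {(\<lambda>\<omega>. B t \<omega> - B s \<omega>) -` A \<inter> space M | A. A \<in> sets borel}"
    using bm st unfolding brownian_motion_def by blast
  have m: "(\<lambda>\<omega>. B t \<omega> - B s \<omega>) \<in> borel_measurable M"
    using B_measurable[of t] B_measurable[of s] st by simp
  have a: "{\<xi> -` A \<inter> space M | A. A \<in> sets borel} \<subseteq> sets (F s)"
    using measurable_sets[OF \<xi>] by auto
  have b: "{(\<lambda>\<omega>. \<phi> (B t \<omega> - B s \<omega>)) -` A \<inter> space M | A. A \<in> sets borel}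
    \<subseteq> {(\<lambda>\<omega>. B t \<omega> - B s \<omega>) -` A \<inter> space M | A. A \<in> sets borel}"
  proof safe
    fix A :: "real set" assume A: "A \<in> sets borel"
    have "\<phi> -` A \<in> sets borel" using measurable_sets[OF \<phi> A] by simp
    moreover have "(\<lambda>\<omega>. \<phi> (B t \<omega> - B s \<omega>)) -` A \<inter> space M =
       (\<lambda>\<omega>. B t \<omega> - B s \<omega>) -` (\<phi> -` A) \<inter> space M" by auto
    ultimately show "\<exists>Aa. (\<lambda>\<omega>. \<phi> (B t \<omega> - B s \<omega>)) -` A \<inter> space M =
       (\<lambda>\<omega>. B t \<omega> - B s \<omega>) -` Aa \<inter> space M \<and> Aa \<in> sets borel" by blast
  qed
  have stable: "Int_stable {g -` A \<inter> space M | A. A \<in> sets (borel :: real measure)}" for g :: "'w \<Rightarrow> real"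
  proof (rule Int_stableI)
    fix a b assume "a \<in> {g -` A \<inter> space M | A. A \<in> sets borel}" "b \<in> {g -` A \<inter> space M | A. A \<in> sets borel}"
    then obtain A A' where "A \<in> sets borel" "A' \<in> sets borel" "a = g -` A \<inter> space M" "b = g -` A' \<inter> space M"
      by blast
    then have "a \<inter> b = g -` (A \<inter> A') \<inter> space M" "A \<inter> A' \<in> sets borel" by auto
    then show "a \<inter> b \<in> {g -` A \<inter> space M | A. A \<in> sets borel}" by blast
  qed
  have "indep_set {\<xi> -` A \<inter> space M | A. A \<in> sets borel}
    {(\<lambda>\<omega>. \<phi> (B t \<omega> - B s \<omega>)) -` A \<inter> space M | A. A \<in> sets borel}"
    unfolding indep_sets2_eq
  proof (intro conjI ballI)
    note 2 = 1[unfolded indep_sets2_eq]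
    show "{\<xi> -` A \<inter> space M | A. A \<in> sets borel} \<subseteq> events" using a 2 by (meson subset_trans)
    show "{(\<lambda>\<omega>. \<phi> (B t \<omega> - B s \<omega>)) -` A \<inter> space M | A. A \<in> sets borel} \<subseteq> events"
      using b 2 by (meson subset_trans)
    fix c d assume "c \<in> {\<xi> -` A \<inter> space M | A. A \<in> sets borel}"
      "d \<in> {(\<lambda>\<omega>. \<phi> (B t \<omega> - B s \<omega>)) -` A \<inter> space M | A. A \<in> sets borel}"
    with a b have "c \<in> sets (F s)" "d \<in> {(\<lambda>\<omega>. B t \<omega> - B s \<omega>) -` A \<inter> space M | A. A \<in> sets borel}"
      by (meson subsetD)+
    with 2 show "prob (c \<inter> d) = prob c * prob d" by (meson bspec)
  qed
  then have "indep_set (sigma_sets (space M) {\<xi> -` A \<inter> space M | A. A \<in> sets borel})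
    (sigma_sets (space M) {(\<lambda>\<omega>. \<phi> (B t \<omega> - B s \<omega>)) -` A \<inter> space M | A. A \<in> sets borel})"
    by (rule indep_set_sigma_sets[OF _ stable stable])
  then show ?thesis
    unfolding indep_var_eq using measurable_F_M[OF \<xi>] measurable_compose[OF m \<phi>] by simp
qed

lemma increment_mult:
  fixes \<xi> :: "'w \<Rightarrow> real" and \<phi> :: "real^'n \<Rightarrow> real"
  assumes st: "0 \<le> s" "s < t" and \<xi>: "\<xi> \<in> borel_measurable (F s)" "integrable M \<xi>"
    and \<phi>: "\<phi> \<in> borel_measurable borel" "integrable M (\<lambda>\<omega>. \<phi> (B t \<omega> - B s \<omega>))"
  shows "integrable M (\<lambda>\<omega>. \<xi> \<omega> * \<phi> (B t \<omega> - B s \<omega>))"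
    and "(\<integral>\<omega>. \<xi> \<omega> * \<phi> (B t \<omega> - B s \<omega>) \<partial>M) = (\<integral>\<omega>. \<xi> \<omega> \<partial>M) * (\<integral>\<omega>. \<phi> (B t \<omega> - B s \<omega>) \<partial>M)"
  using indep_var_integrable[OF indep_increment[OF st \<xi>(1) \<phi>(1)] \<xi>(2) \<phi>(2)]
    indep_var_lebesgue_integral[OF indep_increment[OF st \<xi>(1) \<phi>(1)] \<xi>(2) \<phi>(2)] by auto

lemma increment_distributed:
  assumes "0 \<le> s" "s < t"
  shows "distributed M lborel (\<lambda>\<omega>. (B t \<omega> - B s \<omega>) $ i) (normal_density 0 (sqrt (t - s)))"
  using bm assms unfolding brownian_motion_def by blast

text \<open>Equal times are split off because the normal density needs a positive standard
  deviation. The exact absolute third moment is 2 sqrt(2/pi) (t - s)^(3/2); the factor sqrt(2/pi) is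
  rounded up to 1.\<close>

lemma increment_moments:
  assumes st: "0 \<le> s" "s \<le> t"
  shows increment_integrable: "integrable M (\<lambda>\<omega>. (B t \<omega> - B s \<omega>) $ i)"
    and increment_mean: "(\<integral>\<omega>. (B t \<omega> - B s \<omega>) $ i \<partial>M) = 0"
    and increment_integrable_sq: "integrable M (\<lambda>\<omega>. ((B t \<omega> - B s \<omega>) $ i)\<^sup>2)"
    and increment_var: "(\<integral>\<omega>. ((B t \<omega> - B s \<omega>) $ i)\<^sup>2 \<partial>M) = t - s"
    and increment_integrable_cube: "integrable M (\<lambda>\<omega>. \<bar>(B t \<omega> - B s \<omega>) $ i\<bar>^3)"
    and increment_cube: "(\<integral>\<omega>. \<bar>(B t \<omega> - B s \<omega>) $ i\<bar>^3 \<partial>M) \<le> 2 * sqrt (t - s) ^ 3"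
proof -
  consider "s = t" | "s < t" using st by linarith
  note c = this
  let ?P = "integrable M (\<lambda>\<omega>. (B t \<omega> - B s \<omega>) $ i) \<and> (\<integral>\<omega>. (B t \<omega> - B s \<omega>) $ i \<partial>M) = 0
    \<and> integrable M (\<lambda>\<omega>. ((B t \<omega> - B s \<omega>) $ i)\<^sup>2) \<and> (\<integral>\<omega>. ((B t \<omega> - B s \<omega>) $ i)\<^sup>2 \<partial>M) = t - s
    \<and> integrable M (\<lambda>\<omega>. \<bar>(B t \<omega> - B s \<omega>) $ i\<bar>^3)
    \<and> (\<integral>\<omega>. \<bar>(B t \<omega> - B s \<omega>) $ i\<bar>^3 \<partial>M) \<le> 2 * sqrt (t - s) ^ 3"
  have ?P using c
  proof cases
    case 1 then show ?thesis by simp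
  next
    case 2
    let ?d = "normal_density 0 (sqrt (t - s))"
    have pos: "0 < sqrt (t - s)" using 2 by simp
    have D: "distributed M lborel (\<lambda>\<omega>. (B t \<omega> - B s \<omega>) $ i) ?d"
      by (rule increment_distributed[OF st(1) 2])
    have I: "integrable M (\<lambda>\<omega>. g ((B t \<omega> - B s \<omega>) $ i)) \<longleftrightarrow> integrable lborel (\<lambda>x. ?d x * g x)"
      "(\<integral>\<omega>. g ((B t \<omega> - B s \<omega>) $ i) \<partial>M) = (\<integral>x. ?d x * g x \<partial>lborel)"
      if "g \<in> borel_measurable borel" for g :: "real \<Rightarrow> real"
      using distributed_integrable[OF D, of g] distributed_integral[OF D, of g] that by auto
    have "integrable lborel (\<lambda>x. ?d x * x)" "(\<integral>x. ?d x * x \<partial>lborel) = 0"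
      using integrable_normal_moment_nz_1[OF pos, of 0] integral_normal_moment_nz_1[OF pos, of 0] by auto
    moreover have "integrable lborel (\<lambda>x. ?d x * x^2)" "(\<integral>x. ?d x * x^2 \<partial>lborel) = t - s"
      using integrable_normal_moment[OF pos, of 0 2] integral_normal_moment_even[OF pos, of 0 1] 2 by auto
    moreover have "integrable lborel (\<lambda>x. ?d x * \<bar>x\<bar>^3)"
      using integrable_normal_moment_abs[OF pos, of 0 3] by auto
    moreover have "(\<integral>x. ?d x * \<bar>x\<bar>^3 \<partial>lborel) \<le> 2 * sqrt (t - s) ^ 3"
    proof -
      have "(\<integral>x. ?d x * \<bar>x\<bar>^3 \<partial>lborel) = 2 * sqrt (t - s) ^ 3 * sqrt (2 / pi)"
        using integral_normal_moment_abs_odd[OF pos, of 0 1] by (simp add: numeral_3_eq_3)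
      moreover have "sqrt (2 / pi) \<le> 1" using pi_ge_two by simp
      ultimately show ?thesis
        using 2 by (simp add: mult_left_le)
    qed
    ultimately show ?thesis
      using I[of "\<lambda>x. x"] I[of "\<lambda>x. x^2"] I[of "\<lambda>x. \<bar>x\<bar>^3"] by simp
  qed
  then show "integrable M (\<lambda>\<omega>. (B t \<omega> - B s \<omega>) $ i)"
    "(\<integral>\<omega>. (B t \<omega> - B s \<omega>) $ i \<partial>M) = 0"
    "integrable M (\<lambda>\<omega>. ((B t \<omega> - B s \<omega>) $ i)\<^sup>2)"
    "(\<integral>\<omega>. ((B t \<omega> - B s \<omega>) $ i)\<^sup>2 \<partial>M) = t - s"
    "integrable M (\<lambda>\<omega>. \<bar>(B t \<omega> - B s \<omega>) $ i\<bar>^3)"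
    "(\<integral>\<omega>. \<bar>(B t \<omega> - B s \<omega>) $ i\<bar>^3 \<partial>M) \<le> 2 * sqrt (t - s) ^ 3" by auto
qed

lemma increment_covar:
  assumes st: "0 \<le> s" "s \<le> t"
  shows "integrable M (\<lambda>\<omega>. (B t \<omega> - B s \<omega>) $ i * (B t \<omega> - B s \<omega>) $ j)"
    and "(\<integral>\<omega>. (B t \<omega> - B s \<omega>) $ i * (B t \<omega> - B s \<omega>) $ j \<partial>M) = (if i = j then t - s else 0)"
proof -
  have "integrable M (\<lambda>\<omega>. (B t \<omega> - B s \<omega>) $ i * (B t \<omega> - B s \<omega>) $ j) \<and>
    (\<integral>\<omega>. (B t \<omega> - B s \<omega>) $ i * (B t \<omega> - B s \<omega>) $ j \<partial>M) = (if i = j then t - s else 0)"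
  proof (cases "i = j \<or> s = t")
    case True
    then show ?thesis
      using increment_var[OF st] increment_integrable_sq[OF st] by (auto simp: power2_eq_square)
  next
    case False
    with st have "s < t" "i \<noteq> j" by auto
    have "indep_vars (\<lambda>_. borel) (\<lambda>i \<omega>. (B t \<omega> - B s \<omega>) $ i) UNIV"
      using bm st \<open>s < t\<close> unfolding brownian_motion_def by blast
    then have "indep_vars (\<lambda>_. borel) (\<lambda>i \<omega>. (B t \<omega> - B s \<omega>) $ i) {i, j}"
      by (rule indep_vars_subset) simp
    from indep_vars_integrable[OF _ this] indep_vars_lebesgue_integral[OF _ this] show ?thesis
      using increment_integrable[OF st] increment_mean[OF st] \<open>i \<noteq> j\<close> by simp
  qed
  then show "integrable M (\<lambda>\<omega>. (B t \<omega> - B s \<omega>) $ i * (B t \<omega> - B s \<omega>) $ j)"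
    "(\<integral>\<omega>. (B t \<omega> - B s \<omega>) $ i * (B t \<omega> - B s \<omega>) $ j \<partial>M) = (if i = j then t - s else 0)" by auto
qed

end

section \<open>Integrals of simple processes\<close>

lemma borel_measurable_vec_nth [measurable (raw)]:
  "f \<in> borel_measurable M \<Longrightarrow> (\<lambda>x. f x $ i) \<in> borel_measurable M" for f :: "'a \<Rightarrow> 'b::real_normed_vector ^ 'n::finite"
  by (rule measurable_compose[where g = "\<lambda>v. v $ i" and N = borel])
    (auto intro!: borel_measurable_continuous_onI continuous_intros)

lemma borel_measurable_matrix_vector_mult [measurable (raw)]:
  fixes f :: "'a \<Rightarrow> real^'n::finite^'m::finite" and g :: "'a \<Rightarrow> real^'n"
  assumes [measurable]: "f \<in> borel_measurable M" "g \<in> borel_measurable M"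
  shows "(\<lambda>x. f x *v g x) \<in> borel_measurable M"
proof -
  have "(\<lambda>p::(real^'n^'m) \<times> (real^'n). fst p *v snd p) \<in> borel_measurable borel"
    unfolding matrix_vector_mult_def
    by (intro borel_measurable_continuous_onI continuous_intros)
  from measurable_compose[OF _ this, of "\<lambda>x. (f x, g x)" M] show ?thesis
    by (simp add: borel_prod[symmetric])
qed

lemma norm_sq_vec: "(norm (v :: real^'n::finite))\<^sup>2 = (\<Sum>i\<in>UNIV. (v $ i)\<^sup>2)"
  by (simp add: norm_vec_def L2_set_def sum_nonneg)

lemma norm_sq_mat: "(norm (v :: real^'n::finite^'m::finite))\<^sup>2 = (\<Sum>i\<in>UNIV. \<Sum>j\<in>UNIV. (v $ i $ j)\<^sup>2)"
proof -
  have "(norm v)\<^sup>2 = (\<Sum>i\<in>UNIV. (norm (v $ i))\<^sup>2)"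
    by (simp add: norm_vec_def L2_set_def sum_nonneg)
  then show ?thesis by (simp add: norm_sq_vec)
qed

lemma abs_matrix_nth_le: "\<bar>(A :: real^'n::finite^'m::finite) $ i $ j\<bar> \<le> norm A"
proof -
  have "norm (A $ i $ j) \<le> norm A"
    by (rule order_trans[OF Finite_Cartesian_Product.norm_nth_le Finite_Cartesian_Product.norm_nth_le])
  then show ?thesis by simp
qed

lemma norm_matrix_vector_mult_le:
  "norm ((A :: real^'n::finite^'m::finite) *v x) \<le> norm A * norm x"
proof -
  have "(norm (A *v x))\<^sup>2 = (\<Sum>i\<in>UNIV. ((A $ i) \<bullet> x)\<^sup>2)"
    by (simp add: norm_sq_vec matrix_vector_mul_component)
  also have "\<dots> \<le> (\<Sum>i\<in>UNIV. (norm (A $ i))\<^sup>2 * (norm x)\<^sup>2)"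
    by (intro sum_mono) (metis Cauchy_Schwarz_ineq power2_norm_eq_inner)
  also have "\<dots> = (norm A * norm x)\<^sup>2"
    by (simp add: norm_sq_vec norm_sq_mat sum_distrib_right power_mult_distrib)
  finally show ?thesis by (rule power2_le_imp_le) simp
qed

context brownian
begin

text \<open>All later mean computations reduce to this case: an integrable factor from the past
  times a monomial of degree one or two in the increment, where independence factorises the
  mean.\<close>

lemma increment_mult_nth:
  fixes \<xi> :: "'w \<Rightarrow> real"
  assumes st: "0 \<le> s" "s \<le> t" and \<xi>: "\<xi> \<in> borel_measurable (F s)" "integrable M \<xi>"
  shows "integrable M (\<lambda>\<omega>. \<xi> \<omega> * (B t \<omega> - B s \<omega>) $ i)"
    and "(\<integral>\<omega>. \<xi> \<omega> * (B t \<omega> - B s \<omega>) $ i \<partial>M) = 0"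
    and "integrable M (\<lambda>\<omega>. \<xi> \<omega> * ((B t \<omega> - B s \<omega>) $ i * (B t \<omega> - B s \<omega>) $ j))"
    and "(\<integral>\<omega>. \<xi> \<omega> * ((B t \<omega> - B s \<omega>) $ i * (B t \<omega> - B s \<omega>) $ j) \<partial>M) =
           (if i = j then (t - s) * (\<integral>\<omega>. \<xi> \<omega> \<partial>M) else 0)"
proof -
  consider "s = t" | "s < t" using st by linarith
  then have "integrable M (\<lambda>\<omega>. \<xi> \<omega> * (B t \<omega> - B s \<omega>) $ i) \<and> (\<integral>\<omega>. \<xi> \<omega> * (B t \<omega> - B s \<omega>) $ i \<partial>M) = 0
    \<and> integrable M (\<lambda>\<omega>. \<xi> \<omega> * ((B t \<omega> - B s \<omega>) $ i * (B t \<omega> - B s \<omega>) $ j))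
    \<and> (\<integral>\<omega>. \<xi> \<omega> * ((B t \<omega> - B s \<omega>) $ i * (B t \<omega> - B s \<omega>) $ j) \<partial>M) =
        (if i = j then (t - s) * (\<integral>\<omega>. \<xi> \<omega> \<partial>M) else 0)"
  proof cases
    case 2
    show ?thesis
      using increment_mult[OF st(1) 2 \<xi>, of "\<lambda>v. v $ i"]
        increment_mult[OF st(1) 2 \<xi>, of "\<lambda>v. v $ i * v $ j"]
        increment_integrable[OF st, of i] increment_mean[OF st, of i]
        increment_covar[OF st, of i j] by simp
  qed simp
  then show "integrable M (\<lambda>\<omega>. \<xi> \<omega> * (B t \<omega> - B s \<omega>) $ i)"
    "(\<integral>\<omega>. \<xi> \<omega> * (B t \<omega> - B s \<omega>) $ i \<partial>M) = 0"
    "integrable M (\<lambda>\<omega>. \<xi> \<omega> * ((B t \<omega> - B s \<omega>) $ i * (B t \<omega> - B s \<omega>) $ j))"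
    "(\<integral>\<omega>. \<xi> \<omega> * ((B t \<omega> - B s \<omega>) $ i * (B t \<omega> - B s \<omega>) $ j) \<partial>M) =
        (if i = j then (t - s) * (\<integral>\<omega>. \<xi> \<omega> \<partial>M) else 0)" by auto
qed

lemma integrable_sq_mult:
  fixes f g :: "'w \<Rightarrow> real"
  assumes [measurable]: "f \<in> borel_measurable M" "g \<in> borel_measurable M"
    and "integrable M (\<lambda>x. (f x)\<^sup>2)" "integrable M (\<lambda>x. (g x)\<^sup>2)"
  shows "integrable M (\<lambda>x. f x * g x)"
proof (rule Bochner_Integration.integrable_bound)
  show "integrable M (\<lambda>x. (f x)\<^sup>2 + (g x)\<^sup>2)" using assms by auto
  have "\<bar>x * y\<bar> \<le> x\<^sup>2 + y\<^sup>2" for x y :: real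
  proof -
    have "0 \<le> \<bar>x\<bar> * \<bar>y\<bar>" by simp
    then show ?thesis
      using sum_squares_bound[of "\<bar>x\<bar>" "\<bar>y\<bar>"] unfolding abs_mult power2_abs by linarith
  qed
  then show "AE x in M. norm (f x * g x) \<le> norm ((f x)\<^sup>2 + (g x)\<^sup>2)" by auto
qed simp

text \<open>The squared norm is a quadratic form in the coordinates of the increment with
  coefficients known at time \<open>s\<close>; only its diagonal survives in the mean, since
  distinct coordinates are uncorrelated.\<close>

lemma step_isometry:
  fixes Y :: "'w \<Rightarrow> real^'n^'n"
  assumes st: "0 \<le> s" "s \<le> t" and Y: "Y \<in> borel_measurable (F s)" "bounded (Y ` space M)"
  shows "integrable M (\<lambda>\<omega>. (norm (Y \<omega> *v (B t \<omega> - B s \<omega>)))\<^sup>2)"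
    and "(\<integral>\<omega>. (norm (Y \<omega> *v (B t \<omega> - B s \<omega>)))\<^sup>2 \<partial>M) = (t - s) * (\<integral>\<omega>. (norm (Y \<omega>))\<^sup>2 \<partial>M)"
proof -
  obtain C where C: "norm (Y \<omega>) \<le> C" if "\<omega> \<in> space M" for \<omega>
    using Y(2) by (auto simp: bounded_iff)
  have C2: "\<bar>Y \<omega> $ i $ j\<bar> \<le> C" if "\<omega> \<in> space M" for \<omega> i j
    using order_trans[OF abs_matrix_nth_le C[OF that]] .
  have m: "(\<lambda>\<omega>. Y \<omega> $ i $ j * Y \<omega> $ i $ k) \<in> borel_measurable (F s)" for i j k
    using Y(1) by simp
  have int: "integrable M (\<lambda>\<omega>. Y \<omega> $ i $ j * Y \<omega> $ i $ k)" for i j k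
  proof (rule integrable_const_bound[where B="C*C"])
    show "AE \<omega> in M. norm (Y \<omega> $ i $ j * Y \<omega> $ i $ k) \<le> C * C"
      using C2 by (auto simp: abs_mult intro!: AE_I2 mult_mono order_trans[OF _ C2])
  qed (rule measurable_F_M[OF m])
  have eq: "(norm (Y \<omega> *v (B t \<omega> - B s \<omega>)))\<^sup>2 = (\<Sum>i\<in>UNIV. \<Sum>j\<in>UNIV. \<Sum>k\<in>UNIV.
    (Y \<omega> $ i $ j * Y \<omega> $ i $ k) * ((B t \<omega> - B s \<omega>) $ j * (B t \<omega> - B s \<omega>) $ k))" for \<omega>
    unfolding norm_sq_vec by (simp add: matrix_vector_mult_def power2_eq_square sum_product ac_simps)
  note im = increment_mult_nth[OF st m int]
  show "integrable M (\<lambda>\<omega>. (norm (Y \<omega> *v (B t \<omega> - B s \<omega>)))\<^sup>2)"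
    unfolding eq by (intro Bochner_Integration.integrable_sum im)
  have "(\<integral>\<omega>. (norm (Y \<omega> *v (B t \<omega> - B s \<omega>)))\<^sup>2 \<partial>M) = (\<Sum>i\<in>UNIV. \<Sum>j\<in>UNIV. \<Sum>k\<in>UNIV.
     (if j = k then (t - s) * (\<integral>\<omega>. Y \<omega> $ i $ j * Y \<omega> $ i $ k \<partial>M) else 0))"
    unfolding eq
    by (simp add: Bochner_Integration.integral_sum Bochner_Integration.integrable_sum im del: vector_minus_component)
  also have "\<dots> = (\<Sum>i\<in>UNIV. \<Sum>j\<in>UNIV. (t - s) * (\<integral>\<omega>. Y \<omega> $ i $ j * Y \<omega> $ i $ j \<partial>M))" by simp
  also have "\<dots> = (t - s) * (\<integral>\<omega>. (norm (Y \<omega>))\<^sup>2 \<partial>M)"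
    unfolding norm_sq_mat
    by (simp add: power2_eq_square Bochner_Integration.integral_sum Bochner_Integration.integrable_sum int sum_distrib_left)
  finally show "(\<integral>\<omega>. (norm (Y \<omega> *v (B t \<omega> - B s \<omega>)))\<^sup>2 \<partial>M) = (t - s) * (\<integral>\<omega>. (norm (Y \<omega>))\<^sup>2 \<partial>M)" .
qed

text \<open>\<open>G\<close> is allowed to be merely square integrable, since it will be the
  integral accumulated up to time \<open>s\<close>, which is unbounded. Against the bounded
  \<open>Y\<close> this still gives integrable coefficients
  \<open>G \<omega> $ i * Y \<omega> $ i $ j\<close> of the increment.\<close>

lemma step_orthogonal:
  fixes Y :: "'w \<Rightarrow> real^'n^'n" and G :: "'w \<Rightarrow> real^'n"
  assumes st: "0 \<le> s" "s \<le> t" and Y: "Y \<in> borel_measurable (F s)" "bounded (Y ` space M)"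
    and G: "G \<in> borel_measurable (F s)" "integrable M (\<lambda>\<omega>. (norm (G \<omega>))\<^sup>2)"
  shows "integrable M (\<lambda>\<omega>. G \<omega> \<bullet> (Y \<omega> *v (B t \<omega> - B s \<omega>)))"
    and "(\<integral>\<omega>. G \<omega> \<bullet> (Y \<omega> *v (B t \<omega> - B s \<omega>)) \<partial>M) = 0"
proof -
  obtain C where C: "norm (Y \<omega>) \<le> C" if "\<omega> \<in> space M" for \<omega>
    using Y(2) by (auto simp: bounded_iff)
  have C2: "\<bar>Y \<omega> $ i $ j\<bar> \<le> C" if "\<omega> \<in> space M" for \<omega> i j
    using order_trans[OF abs_matrix_nth_le C[OF that]] .
  have m: "(\<lambda>\<omega>. G \<omega> $ i * Y \<omega> $ i $ j) \<in> borel_measurable (F s)" for i j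
    using Y(1) G(1) by simp
  have GM [measurable]: "G \<in> borel_measurable M" by (rule measurable_F_M[OF G(1)])
  have YM [measurable]: "Y \<in> borel_measurable M" by (rule measurable_F_M[OF Y(1)])
  have int: "integrable M (\<lambda>\<omega>. G \<omega> $ i * Y \<omega> $ i $ j)" for i j
  proof (rule integrable_sq_mult)
    show "integrable M (\<lambda>x. (G x $ i)\<^sup>2)"
      by (rule Bochner_Integration.integrable_bound[OF G(2)])
        (auto intro!: power_mono order_trans[OF _ Finite_Cartesian_Product.norm_nth_le] simp: abs_le_square_iff[symmetric] component_le_norm_cart)
    show "integrable M (\<lambda>x. (Y x $ i $ j)\<^sup>2)"
      by (rule integrable_const_bound[where B="C\<^sup>2"])
        (use C2 in \<open>auto intro!: AE_I2 simp: abs_le_square_iff[symmetric] intro: order_trans[OF _ abs_ge_self]\<close>)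
  qed auto
  have eq: "G \<omega> \<bullet> (Y \<omega> *v (B t \<omega> - B s \<omega>)) = (\<Sum>i\<in>UNIV. \<Sum>j\<in>UNIV.
    (G \<omega> $ i * Y \<omega> $ i $ j) * (B t \<omega> - B s \<omega>) $ j)" for \<omega>
    by (simp add: inner_vec_def matrix_vector_mult_def sum_distrib_left ac_simps)
  note im = increment_mult_nth(1,2)[OF st m int]
  show "integrable M (\<lambda>\<omega>. G \<omega> \<bullet> (Y \<omega> *v (B t \<omega> - B s \<omega>)))"
    unfolding eq by (intro Bochner_Integration.integrable_sum im)
  show "(\<integral>\<omega>. G \<omega> \<bullet> (Y \<omega> *v (B t \<omega> - B s \<omega>)) \<partial>M) = 0"
    unfolding eq
    by (simp add: Bochner_Integration.integral_sum Bochner_Integration.integrable_sum im del: vector_minus_component)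
qed

lemma simple_processD:
  assumes "simple_process M F t k \<tau> Y"
  shows simple_process_mono: "i \<le> j \<Longrightarrow> j \<le> k \<Longrightarrow> \<tau> i \<le> \<tau> j"
    and simple_process_nonneg: "j \<le> k \<Longrightarrow> 0 \<le> \<tau> j"
    and simple_process_le: "j \<le> k \<Longrightarrow> \<tau> j \<le> t"
    and simple_process_measurable: "i < k \<Longrightarrow> Y i \<in> borel_measurable (F (\<tau> i))"
    and simple_process_bounded: "i < k \<Longrightarrow> bounded (Y i ` space M)"
proof -
  show mono: "\<tau> i \<le> \<tau> j" if "i \<le> j" "j \<le> k" for i j
    using that
  proof (induction j rule: dec_induct)
    case (step n)
    then have "\<tau> n \<le> \<tau> (Suc n)" using assms unfolding simple_process_def by auto
    with step show ?case by simp
  qed simp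
  show "0 \<le> \<tau> j" "\<tau> j \<le> t" if "j \<le> k" for j
    using mono[of 0 j] mono[of j k] that assms by (auto simp: simple_process_def)
qed (use assms in \<open>auto simp: simple_process_def\<close>)

text \<open>Pythagoras by induction on the number of steps: the last step is orthogonal to the
  integral over the earlier ones. The horizon \<open>t\<close> has to vary, because dropping the
  last step leaves a process on a shorter interval.\<close>

lemma simple_integral_isometry:
  assumes "simple_process M F t k \<tau> Y"
  shows "simple_integral B k \<tau> Y \<in> borel_measurable (F t) \<and>
    integrable M (\<lambda>\<omega>. (norm (simple_integral B k \<tau> Y \<omega>))\<^sup>2) \<and>
    (\<integral>\<omega>. (norm (simple_integral B k \<tau> Y \<omega>))\<^sup>2 \<partial>M) =
      (\<Sum>i<k. (\<tau> (Suc i) - \<tau> i) * (\<integral>\<omega>. (norm (Y i \<omega>))\<^sup>2 \<partial>M))"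
  using assms
proof (induction k arbitrary: t)
  case 0
  then show ?case by (simp add: simple_integral_def)
next
  case (Suc k)
  note sp = simple_processD[OF Suc.prems]
  have t: "t = \<tau> (Suc k)" using Suc.prems by (simp add: simple_process_def)
  have "simple_process M F (\<tau> k) k \<tau> Y" using Suc.prems by (auto simp: simple_process_def)
  note IH = Suc.IH[OF this]
  let ?S = "simple_integral B k \<tau> Y" and ?D = "\<lambda>\<omega>. Y k \<omega> *v (B (\<tau> (Suc k)) \<omega> - B (\<tau> k) \<omega>)"
  have eq: "simple_integral B (Suc k) \<tau> Y = (\<lambda>\<omega>. ?S \<omega> + ?D \<omega>)"
    by (simp add: simple_integral_def fun_eq_iff)
  have le: "0 \<le> \<tau> k" "\<tau> k \<le> \<tau> (Suc k)" using sp(2)[of k] sp(1)[of k "Suc k"] by auto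
  note Y = sp(4)[of k, simplified] sp(5)[of k, simplified]
  have S: "?S \<in> borel_measurable (F (\<tau> k))" "integrable M (\<lambda>\<omega>. (norm (?S \<omega>))\<^sup>2)" using IH by auto
  have mD: "?D \<in> borel_measurable (F t)"
    unfolding t using measurable_F_mono[OF le(2) Y(1)] B_measurable_F[of "\<tau> (Suc k)"]
      measurable_F_mono[OF le(2) B_measurable_F[OF le(1)]] le by simp
  note o = step_orthogonal[OF le Y S] step_isometry[OF le Y]
  have expand: "(norm (?S \<omega> + ?D \<omega>))\<^sup>2 = (norm (?S \<omega>))\<^sup>2 + 2 * (?S \<omega> \<bullet> ?D \<omega>) + (norm (?D \<omega>))\<^sup>2" for \<omega>
    by (simp add: power2_norm_eq_inner inner_add_left inner_add_right inner_commute)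
  show ?case
    unfolding eq expand
  proof (intro conjI)
    show "(\<lambda>\<omega>. ?S \<omega> + ?D \<omega>) \<in> borel_measurable (F t)"
      using mD measurable_F_mono[OF _ S(1), of t] le t by simp
    show "integrable M (\<lambda>\<omega>. (norm (?S \<omega>))\<^sup>2 + 2 * (?S \<omega> \<bullet> ?D \<omega>) + (norm (?D \<omega>))\<^sup>2)"
      using o S by auto
    show "(\<integral>\<omega>. (norm (?S \<omega>))\<^sup>2 + 2 * (?S \<omega> \<bullet> ?D \<omega>) + (norm (?D \<omega>))\<^sup>2 \<partial>M) =
      (\<Sum>i<Suc k. (\<tau> (Suc i) - \<tau> i) * (\<integral>\<omega>. (norm (Y i \<omega>))\<^sup>2 \<partial>M))"
      using o S IH by simp
  qed
qed

text \<open>The minimum in the bound carries the induction. If the new summand is kept, the full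
  partial sum including it is at most \<open>d\<close>; if it is dropped, the previous bound remains
  valid because the full sum only grows.\<close>

lemma sum_stopped_le:
  fixes x :: "nat \<Rightarrow> real"
  assumes "\<And>i. 0 \<le> x i" "0 \<le> d"
  shows "(\<Sum>i<m. if (\<Sum>j\<le>i. x j) \<le> d then x i else 0) \<le> min d (\<Sum>i<m. x i)"
proof (induction m)
  case (Suc m)
  have "(\<Sum>j\<le>m. x j) = (\<Sum>j<m. x j) + x m" by (simp add: lessThan_Suc_atMost[symmetric])
  then show ?case using Suc assms(1)[of m] by auto
qed (use assms in auto)

text \<open>Lenglart's inequality: stop the integrand as soon as its accumulated square exceeds \<open>\<delta>\<close>.\<close>

lemma simple_integral_tail:
  assumes sp: "simple_process M F t k \<tau> Y" and pos: "0 < \<epsilon>" "0 \<le> \<delta>"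
  shows "prob {\<omega>\<in>space M. \<epsilon> < norm (simple_integral B k \<tau> Y \<omega>)}
    \<le> prob {\<omega>\<in>space M. \<delta> < (\<Sum>i<k. (\<tau> (Suc i) - \<tau> i) * (norm (Y i \<omega>))\<^sup>2)} + \<delta> / \<epsilon>\<^sup>2"
proof -
  note D = simple_processD[OF sp]
  define x where "x i \<omega> = (if i < k then (\<tau> (Suc i) - \<tau> i) * (norm (Y i \<omega>))\<^sup>2 else 0)" for i \<omega>
  \<comment> \<open>The test includes the i-th term itself, which is already known at time
    \<open>\<tau> i\<close>; hence the stopped integrand is still adapted, and its accumulated
    square never exceeds \<open>\<delta>\<close>.\<close>
  define Z where "Z i \<omega> = (if (\<Sum>j\<le>i. x j \<omega>) \<le> \<delta> then Y i \<omega> else 0)" for i \<omega>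
  have xpos: "0 \<le> x i \<omega>" for i \<omega> using D(1)[of i "Suc i"] by (simp add: x_def)
  have xm: "x j \<in> borel_measurable (F (\<tau> i))" if "j \<le> i" "i < k" for i j
    using measurable_F_mono[OF _ D(4)[of j], of "\<tau> i"] D(1)[of j i] that unfolding x_def[abs_def] by simp
  have Zm: "Z i \<in> borel_measurable (F (\<tau> i))" if "i < k" for i
  proof -
    have [measurable]: "(\<lambda>\<omega>. \<Sum>j\<le>i. x j \<omega>) \<in> borel_measurable (F (\<tau> i))"
      using xm that by (intro borel_measurable_sum) auto
    have [measurable]: "Y i \<in> borel_measurable (F (\<tau> i))" by (rule D(4)[OF that])
    show ?thesis unfolding Z_def[abs_def] by measurable
  qed
  have spZ: "simple_process M F t k \<tau> Z"
  proof -
    have "bounded (Z i ` space M)" if "i < k" for i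
    proof -
      obtain C where "norm (Y i \<omega>) \<le> C" if "\<omega> \<in> space M" for \<omega>
        using D(5)[OF \<open>i < k\<close>] by (auto simp: bounded_iff)
      then have "norm (Z i \<omega>) \<le> \<bar>C\<bar>" if "\<omega> \<in> space M" for \<omega> using that by (force simp: Z_def)
      then show ?thesis by (auto simp: bounded_iff)
    qed
    then show ?thesis using sp Zm by (auto simp: simple_process_def)
  qed
  let ?I = "simple_integral B k \<tau> Y" and ?J = "simple_integral B k \<tau> Z"
  let ?Q = "\<lambda>\<omega>. \<Sum>i<k. (\<tau> (Suc i) - \<tau> i) * (norm (Y i \<omega>))\<^sup>2"
  note isoZ = simple_integral_isometry[OF spZ] and isoY = simple_integral_isometry[OF sp]
  have IM [measurable]: "?I \<in> borel_measurable M" "?J \<in> borel_measurable M"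
    using isoZ isoY measurable_F_M by auto
  have YM: "Y i \<in> borel_measurable M" if "i < k" for i using D(4)[OF that] measurable_F_M by auto
  have QM [measurable]: "?Q \<in> borel_measurable M" using YM by (intro borel_measurable_sum) auto
  \<comment> \<open>If the total is at most \<open>\<delta>\<close>, no term has been suppressed.
    Outside that event nothing is claimed about \<open>?I\<close>; on it, Chebyshev's inequality for
    \<open>?J\<close> gives the term \<delta> / \<epsilon>^2.\<close>
  have eq: "?I \<omega> = ?J \<omega>" if "?Q \<omega> \<le> \<delta>" for \<omega>
  proof -
    have "(\<Sum>j\<le>i. x j \<omega>) \<le> \<delta>" if "i < k" for i
    proof -
      have "(\<Sum>j\<le>i. x j \<omega>) \<le> (\<Sum>j<k. x j \<omega>)" using that xpos by (intro sum_mono2) auto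
      also have "\<dots> = ?Q \<omega>" by (simp add: x_def)
      finally show ?thesis using \<open>?Q \<omega> \<le> \<delta>\<close> by simp
    qed
    then show ?thesis by (simp add: simple_integral_def Z_def)
  qed
  have int: "integrable M (\<lambda>\<omega>. (norm (Z i \<omega>))\<^sup>2)" if i: "i < k" for i
  proof -
    obtain C where C: "norm (Z i \<omega>) \<le> C" if "\<omega> \<in> space M" for \<omega>
      using simple_processD(5)[OF spZ i] by (auto simp: bounded_iff)
    have [measurable]: "Z i \<in> borel_measurable M" using Zm[OF i] measurable_F_M by auto
    show ?thesis
      by (rule integrable_const_bound[where B="C\<^sup>2"])
        (use C in \<open>auto intro!: AE_I2 power_mono\<close>)
  qed
  have "(\<integral>\<omega>. (norm (?J \<omega>))\<^sup>2 \<partial>M) = (\<Sum>i<k. (\<tau> (Suc i) - \<tau> i) * (\<integral>\<omega>. (norm (Z i \<omega>))\<^sup>2 \<partial>M))"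
    using isoZ by simp
  also have "\<dots> = (\<integral>\<omega>. (\<Sum>i<k. (\<tau> (Suc i) - \<tau> i) * (norm (Z i \<omega>))\<^sup>2) \<partial>M)"
    using int by (simp add: Bochner_Integration.integral_sum)
  also have "\<dots> \<le> (\<integral>\<omega>. \<delta> \<partial>M)"
  proof (rule integral_mono)
    fix \<omega>
    have "(\<Sum>i<k. (\<tau> (Suc i) - \<tau> i) * (norm (Z i \<omega>))\<^sup>2) = (\<Sum>i<k. if (\<Sum>j\<le>i. x j \<omega>) \<le> \<delta> then x i \<omega> else 0)"
      by (intro sum.cong) (auto simp: Z_def x_def)
    also have "\<dots> \<le> \<delta>" using sum_stopped_le[of "\<lambda>i. x i \<omega>" \<delta> k] xpos pos by auto
    finally show "(\<Sum>i<k. (\<tau> (Suc i) - \<tau> i) * (norm (Z i \<omega>))\<^sup>2) \<le> \<delta>" .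
  qed (use int in auto)
  also have "\<dots> = \<delta>" by (simp add: prob_space)
  finally have E: "(\<integral>\<omega>. (norm (?J \<omega>))\<^sup>2 \<partial>M) \<le> \<delta>" .
  have "prob {\<omega>\<in>space M. \<epsilon> < norm (?J \<omega>)} \<le> prob {\<omega>\<in>space M. (norm (?J \<omega>))\<^sup>2 \<ge> \<epsilon>\<^sup>2}"
    using pos by (intro finite_measure_mono) (auto intro!: power_mono)
  also have "\<dots> \<le> (\<integral>\<omega>. (norm (?J \<omega>))\<^sup>2 \<partial>M) / \<epsilon>\<^sup>2"
    by (rule integral_Markov_inequality_measure[where A="{}"]) (use isoZ pos in auto)
  also have "\<dots> \<le> \<delta> / \<epsilon>\<^sup>2" using E by (intro divide_right_mono) auto
  finally have M: "prob {\<omega>\<in>space M. \<epsilon> < norm (?J \<omega>)} \<le> \<delta> / \<epsilon>\<^sup>2" .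
  have "prob {\<omega>\<in>space M. \<epsilon> < norm (?I \<omega>)} \<le>
     prob ({\<omega>\<in>space M. \<delta> < ?Q \<omega>} \<union> {\<omega>\<in>space M. \<epsilon> < norm (?J \<omega>)})"
  proof (intro finite_measure_mono subsetI)
    fix \<omega> assume "\<omega> \<in> {\<omega>\<in>space M. \<epsilon> < norm (?I \<omega>)}"
    then show "\<omega> \<in> {\<omega>\<in>space M. \<delta> < ?Q \<omega>} \<union> {\<omega>\<in>space M. \<epsilon> < norm (?J \<omega>)}"
      using eq[of \<omega>] by (cases "?Q \<omega> \<le> \<delta>") auto
  qed measurable
  also have "\<dots> \<le> prob {\<omega>\<in>space M. \<delta> < ?Q \<omega>} + prob {\<omega>\<in>space M. \<epsilon> < norm (?J \<omega>)}"
    by (intro measure_Un_le) measurable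
  finally show ?thesis using M by simp
qed

end

section \<open>Common refinements of simple processes\<close>

lemma finite_grid:
  fixes T :: "real set"
  assumes "finite T" "0 \<in> T" "t \<in> T" "T \<subseteq> {0..t}"
  obtains K :: nat and \<rho> :: "nat \<Rightarrow> real"
  where "\<rho> 0 = 0" "\<rho> K = t" "\<rho> ` {..K} = T" "\<And>i j. j \<le> K \<Longrightarrow> i < j \<Longrightarrow> \<rho> i < \<rho> j"
proof -
  define xs where "xs = sorted_list_of_set T"
  have set: "set xs = T"
    using assms by (simp add: xs_def)
  have ne: "xs \<noteq> []" using set assms by auto
  define K where "K = length xs - 1"
  have len: "length xs = Suc K" using ne by (simp add: K_def)
  have mono: "xs ! i < xs ! j" if "j \<le> K" "i < j" for i j
    using sorted_wrt_nth_less[of "(<)" xs i j] that len by (simp add: xs_def)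
  have img: "(!) xs ` {..K} = T"
    using set len by (auto simp: set_conv_nth less_Suc_eq_le)
  have le: "xs ! i \<le> xs ! j" if "j \<le> K" "i \<le> j" for i j
    using mono[of j i] that by (cases "i = j") auto
  obtain p where p: "p \<le> K" "xs ! p = 0" using img assms(2) by auto
  obtain q where q: "q \<le> K" "xs ! q = t" using img assms(3) by auto
  have "xs ! 0 \<in> T" "xs ! K \<in> T" using img by auto
  then have "0 \<le> xs ! 0" "xs ! K \<le> t" using assms(4) by auto
  with p q le[of p 0] le[of K q] have "xs ! 0 = 0" "xs ! K = t" by auto
  with that[of "\<lambda>i. xs ! i" K] mono img show ?thesis by blast
qed

lemma matrix_vector_mult_sum_right: "A *v (\<Sum>i\<in>I. f i) = (\<Sum>i\<in>I. A *v (f i :: real^'n::finite))"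
  by (induction I rule: infinite_finite_induct) (simp_all add: matrix_vector_right_distrib)

lemma matrix_vector_mult_sum_left: "(\<Sum>i\<in>I. f i) *v x = (\<Sum>i\<in>I. f i *v (x :: real^'n::finite))"
  for f :: "'i \<Rightarrow> real^'n::finite^'m::finite"
  by (induction I rule: infinite_finite_induct) (simp_all add: matrix_vector_mult_add_rdistrib)

context brownian
begin

lemma simple_value_eq:
  assumes sp: "simple_process M F t k \<tau> Y" and i: "i < k" "s \<in> {\<tau> i<..\<tau> (Suc i)}"
  shows "simple_value k \<tau> Y s \<omega> = Y i \<omega>"
    and "(\<Sum>j<k. indicator {\<tau> j<..\<tau> (Suc j)} s * f j) = (f i :: real)"
proof -
  have "s \<notin> {\<tau> j<..\<tau> (Suc j)}" if "j < k" "j \<noteq> i" for j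
  proof (cases "j < i")
    case True
    then show ?thesis using simple_process_mono[OF sp, of "Suc j" i] i by auto
  next
    case False
    then show ?thesis using simple_process_mono[OF sp, of "Suc i" j] i that by auto
  qed
  then have *: "indicator {\<tau> j<..\<tau> (Suc j)} s = (if j = i then 1 else 0 :: real)" if "j < k" for j
    using i that by auto
  show "simple_value k \<tau> Y s \<omega> = Y i \<omega>" "(\<Sum>j<k. indicator {\<tau> j<..\<tau> (Suc j)} s * f j) = f i"
    using i by (auto simp: simple_value_def * if_distrib[of "\<lambda>c. c * _"] if_distrib[of "\<lambda>c. c *\<^sub>R _"] cong: if_cong)
qed

lemma simple_value_outside:
  assumes "\<And>i. i < k \<Longrightarrow> s \<notin> {\<tau> i<..\<tau> (Suc i)}"
  shows "simple_value k \<tau> Y s \<omega> = 0"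
  using assms by (simp add: simple_value_def)

lemma simple_value_norm_sq:
  assumes sp: "simple_process M F t k \<tau> Y"
  shows "(norm (simple_value k \<tau> Y s \<omega>))\<^sup>2 = (\<Sum>i<k. indicator {\<tau> i<..\<tau> (Suc i)} s * (norm (Y i \<omega>))\<^sup>2)"
proof (cases "\<exists>i<k. s \<in> {\<tau> i<..\<tau> (Suc i)}")
  case True
  then obtain i where i: "i < k" "s \<in> {\<tau> i<..\<tau> (Suc i)}" by auto
  show ?thesis unfolding simple_value_eq(1)[OF sp i] simple_value_eq(2)[OF sp i] ..
next
  case False
  then have "simple_value k \<tau> Y s \<omega> = 0" by (intro simple_value_outside) auto
  with False show ?thesis by simp
qed

text \<open>Translates the distance used in the definition of the Ito integral into the quadratic
  sum that governs the tail estimate.\<close>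

lemma nn_integral_simple_value:
  assumes sp: "simple_process M F t k \<tau> Y"
  shows "(\<integral>\<^sup>+ s\<in>{0..t}. ennreal ((norm (simple_value k \<tau> Y s \<omega>))\<^sup>2) \<partial>lborel) =
    ennreal (\<Sum>i<k. (\<tau> (Suc i) - \<tau> i) * (norm (Y i \<omega>))\<^sup>2)"
proof -
  note D = simple_processD[OF sp]
  have "ennreal ((norm (simple_value k \<tau> Y s \<omega>))\<^sup>2) * indicator {0..t} s =
     (\<Sum>i<k. ennreal ((norm (Y i \<omega>))\<^sup>2) * indicator {\<tau> i<..\<tau> (Suc i)} s)" for s
  proof -
    have *: "indicator {\<tau> i<..\<tau> (Suc i)} s * indicator {0..t} s = (indicator {\<tau> i<..\<tau> (Suc i)} s :: real)" if "i < k" for i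
      using D(2)[of i] D(3)[of "Suc i"] that by (auto simp: indicator_def)
    then have "(norm (simple_value k \<tau> Y s \<omega>))\<^sup>2 * indicator {0..t} s =
      (\<Sum>i<k. indicator {\<tau> i<..\<tau> (Suc i)} s * (norm (Y i \<omega>))\<^sup>2)"
      unfolding simple_value_norm_sq[OF sp] sum_distrib_right
    proof (intro sum.cong refl)
      fix i assume "i \<in> {..<k}"
      then have "indicator {\<tau> i<..\<tau> (Suc i)} s * indicator {0..t} s = (indicator {\<tau> i<..\<tau> (Suc i)} s :: real)"
        using * by simp
      then show "indicator {\<tau> i<..\<tau> (Suc i)} s * (norm (Y i \<omega>))\<^sup>2 * indicator {0..t} s =
        indicator {\<tau> i<..\<tau> (Suc i)} s * (norm (Y i \<omega>))\<^sup>2"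
        by (metis mult.assoc mult.commute)
    qed
    moreover have "ennreal ((norm (simple_value k \<tau> Y s \<omega>))\<^sup>2) * indicator {0..t} s =
      ennreal ((norm (simple_value k \<tau> Y s \<omega>))\<^sup>2 * indicator {0..t} s)"
      by (simp add: ennreal_mult'' ennreal_indicator)
    moreover have "ennreal (\<Sum>i<k. indicator {\<tau> i<..\<tau> (Suc i)} s * (norm (Y i \<omega>))\<^sup>2) =
      (\<Sum>i<k. ennreal (indicator {\<tau> i<..\<tau> (Suc i)} s * (norm (Y i \<omega>))\<^sup>2))"
      by (rule sum_ennreal[symmetric]) simp
    moreover have "\<dots> = (\<Sum>i<k. ennreal ((norm (Y i \<omega>))\<^sup>2) * indicator {\<tau> i<..\<tau> (Suc i)} s)"
      by (intro sum.cong refl) (simp add: indicator_def)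
    ultimately show ?thesis by simp
  qed
  then have "(\<integral>\<^sup>+ s\<in>{0..t}. ennreal ((norm (simple_value k \<tau> Y s \<omega>))\<^sup>2) \<partial>lborel) =
     (\<integral>\<^sup>+ s. (\<Sum>i<k. ennreal ((norm (Y i \<omega>))\<^sup>2) * indicator {\<tau> i<..\<tau> (Suc i)} s) \<partial>lborel)" by simp
  also have "\<dots> = (\<Sum>i<k. ennreal ((norm (Y i \<omega>))\<^sup>2) * ennreal (\<tau> (Suc i) - \<tau> i))"
  proof (subst nn_integral_sum)
    show "(\<Sum>i<k. \<integral>\<^sup>+ s. ennreal ((norm (Y i \<omega>))\<^sup>2) * indicator {\<tau> i<..\<tau> (Suc i)} s \<partial>lborel) =
      (\<Sum>i<k. ennreal ((norm (Y i \<omega>))\<^sup>2) * ennreal (\<tau> (Suc i) - \<tau> i))"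
      using D(1)[of _ "Suc _"] by (intro sum.cong refl) (simp add: nn_integral_cmult_indicator)
  qed measurable
  also have "\<dots> = (\<Sum>i<k. ennreal ((\<tau> (Suc i) - \<tau> i) * (norm (Y i \<omega>))\<^sup>2))"
    using D(1)[of _ "Suc _"] by (intro sum.cong refl) (simp add: ennreal_mult mult.commute)
  also have "\<dots> = ennreal (\<Sum>i<k. (\<tau> (Suc i) - \<tau> i) * (norm (Y i \<omega>))\<^sup>2)"
    using D(1)[of _ "Suc _"] by (intro sum_ennreal) simp
  finally show ?thesis .
qed

text \<open>Sampling at the right end point \<open>\<rho> (Suc i)\<close> is dictated by the
  left-open intervals: it lies in the same coarse interval as all of (\<rho> i, \<rho> (Suc i)]. The
  sampled coefficient was fixed at the start of that coarse interval, hence is known at time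
  \<open>\<rho> i\<close>.\<close>

lemma simple_process_refine:
  assumes sp: "simple_process M F t k \<tau> Y"
    and \<rho>: "\<rho> 0 = 0" "\<rho> K = t" "\<tau> ` {..k} \<subseteq> \<rho> ` {..K}" "\<And>i j. j \<le> K \<Longrightarrow> i < j \<Longrightarrow> \<rho> i < \<rho> j"
  defines "G \<equiv> \<lambda>i. simple_value k \<tau> Y (\<rho> (Suc i))"
  shows "simple_process M F t K \<rho> G"
    and "simple_integral B K \<rho> G \<omega> = simple_integral B k \<tau> Y \<omega>"
    and "simple_value K \<rho> G s \<omega> = simple_value k \<tau> Y s \<omega>"
proof -
  note D = simple_processD[OF sp]
  have ends: "\<tau> 0 = 0" "\<tau> k = t" using sp by (auto simp: simple_process_def)
  have less_iff: "\<rho> i < \<rho> j \<longleftrightarrow> i < j" if "i \<le> K" "j \<le> K" for i j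
    using \<rho>(4)[of i j] \<rho>(4)[of j i] that by (metis linorder_cases order_less_asym)
  have le_iff: "\<rho> i \<le> \<rho> j \<longleftrightarrow> i \<le> j" if "i \<le> K" "j \<le> K" for i j
    using less_iff[of j i] that by (simp add: not_less[symmetric])
  \<comment> \<open>The coarse interval around a fine one ends at the first coarse point not before
    \<open>\<rho> (Suc i)\<close>. The coarse point preceding it is a point of the fine grid below
    \<open>\<rho> (Suc i)\<close>, hence at most \<open>\<rho> i\<close>.\<close>
  have "\<exists>j<k. \<tau> j \<le> \<rho> i \<and> \<rho> (Suc i) \<le> \<tau> (Suc j)" if i: "i < K" for i
  proof -
    define m where "m = (LEAST m. \<rho> (Suc i) \<le> \<tau> m)"
    have ex: "\<rho> (Suc i) \<le> \<tau> k" using le_iff[of "Suc i" K] i ends \<rho> by simp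
    have m: "\<rho> (Suc i) \<le> \<tau> m" "m \<le> k"
      unfolding m_def by (rule LeastI[of _ k], rule ex) (rule Least_le, rule ex)
    have "m \<noteq> 0" using m ends \<rho>(1) less_iff[of 0 "Suc i"] i by (metis Suc_leI le0 not_less zero_less_Suc)
    then obtain j where j: "m = Suc j" by (cases m) auto
    have "\<tau> j < \<rho> (Suc i)"
      using not_less_Least[of j "\<lambda>m. \<rho> (Suc i) \<le> \<tau> m"] j m_def by auto
    moreover obtain p where p: "p \<le> K" "\<tau> j = \<rho> p" using \<rho>(3) m j by (force simp: image_subset_iff)
    ultimately have "\<tau> j \<le> \<rho> i" using less_iff[of p "Suc i"] le_iff[of p i] i by auto
    moreover have "j < k" using m j by simp
    ultimately show ?thesis using m j by (intro exI[of _ j]) simp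
  qed
  then obtain J where J: "J i < k" "\<tau> (J i) \<le> \<rho> i" "\<rho> (Suc i) \<le> \<tau> (Suc (J i))" if "i < K" for i
    by metis
  have val: "simple_value k \<tau> Y s \<omega> = Y (J i) \<omega>" if "i < K" "s \<in> {\<rho> i<..\<rho> (Suc i)}" for i s \<omega>
    by (rule simple_value_eq(1)[OF sp]) (use J[of i] that in auto)
  have G: "G i = Y (J i)" if "i < K" for i
    using val[OF that, of "\<rho> (Suc i)"] less_iff[of i "Suc i"] that by (auto simp: G_def fun_eq_iff)
  show spG: "simple_process M F t K \<rho> G"
    unfolding simple_process_def
  proof (intro conjI allI impI)
    fix i assume i: "i < K"
    show "\<rho> i \<le> \<rho> (Suc i)" using le_iff[of i "Suc i"] i by simp
    show "G i \<in> borel_measurable (F (\<rho> i))"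
      unfolding G[OF i] by (rule measurable_F_mono[OF J(2)[OF i] D(4)[OF J(1)[OF i]]])
    show "bounded (G i ` space M)" unfolding G[OF i] by (rule D(5)[OF J(1)[OF i]])
  qed (use \<rho> in auto)
  show "simple_value K \<rho> G s \<omega> = simple_value k \<tau> Y s \<omega>"
  proof (cases "0 < s \<and> s \<le> t")
    case True
    define m where "m = (LEAST m. s \<le> \<rho> m)"
    have ex: "s \<le> \<rho> K" using True \<rho> by simp
    have m: "s \<le> \<rho> m" "m \<le> K"
      unfolding m_def by (rule LeastI[of _ K], rule ex) (rule Least_le, rule ex)
    have "m \<noteq> 0" using m True \<rho>(1) by (metis not_less)
    then obtain j where j: "m = Suc j" by (cases m) auto
    have "\<rho> j < s"
      using not_less_Least[of j "\<lambda>m. s \<le> \<rho> m"] j m_def by auto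
    then have s: "s \<in> {\<rho> j<..\<rho> (Suc j)}" "j < K" using m j by auto
    show ?thesis
      using simple_value_eq(1)[OF spG s(2,1)] val[OF s(2,1)] G[OF s(2)] by simp
  next
    case False
    have "simple_value K \<rho> G s \<omega> = 0"
    proof (rule simple_value_outside)
      fix i assume "i < K"
      then have "0 \<le> \<rho> i" "\<rho> (Suc i) \<le> t"
        using simple_processD(2)[OF spG, of i] simple_processD(3)[OF spG, of "Suc i"] by auto
      with False show "s \<notin> {\<rho> i<..\<rho> (Suc i)}" by auto
    qed
    moreover have "simple_value k \<tau> Y s \<omega> = 0"
    proof (rule simple_value_outside)
      fix i assume "i < k"
      then have "0 \<le> \<tau> i" "\<tau> (Suc i) \<le> t" using D(2)[of i] D(3)[of "Suc i"] by auto
      with False show "s \<notin> {\<tau> i<..\<tau> (Suc i)}" by auto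
    qed
    ultimately show ?thesis by simp
  qed
  \<comment> \<open>The fine increments inside one coarse interval telescope to the coarse
    increment, which may be empty (\<open>p = q\<close>). Exchanging the two sums then recovers the
    coarse integral.\<close>
  have part: "(\<Sum>i<K. indicator {\<tau> j<..\<tau> (Suc j)} (\<rho> (Suc i)) *\<^sub>R (B (\<rho> (Suc i)) \<omega> - B (\<rho> i) \<omega>)) =
     B (\<tau> (Suc j)) \<omega> - B (\<tau> j) \<omega>" if j: "j < k" for j
  proof -
    obtain p where p: "p \<le> K" "\<tau> j = \<rho> p" using \<rho>(3) j by (force simp: image_subset_iff)
    obtain q where q: "q \<le> K" "\<tau> (Suc j) = \<rho> q" using \<rho>(3) j by (force simp: image_subset_iff)
    have pq: "p \<le> q" using D(1)[of j "Suc j"] j p q le_iff[of p q] by auto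
    have "(\<Sum>i<K. indicator {\<tau> j<..\<tau> (Suc j)} (\<rho> (Suc i)) *\<^sub>R (B (\<rho> (Suc i)) \<omega> - B (\<rho> i) \<omega>)) =
      (\<Sum>i<K. if i \<in> {p..<q} then B (\<rho> (Suc i)) \<omega> - B (\<rho> i) \<omega> else 0)"
      using p q less_iff le_iff by (intro sum.cong refl) (auto simp: indicator_def Suc_le_eq less_Suc_eq_le)
    also have "\<dots> = (\<Sum>i\<in>{p..<q}. B (\<rho> (Suc i)) \<omega> - B (\<rho> i) \<omega>)"
      using q by (subst sum.inter_restrict[symmetric]) (auto intro!: sum.cong)
    also have "\<dots> = B (\<rho> q) \<omega> - B (\<rho> p) \<omega>"
      by (rule sum_Suc_diff'[OF pq])
    finally show ?thesis using p q by simp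
  qed
  have "simple_integral B K \<rho> G \<omega> =
    (\<Sum>i<K. \<Sum>j<k. Y j \<omega> *v (indicator {\<tau> j<..\<tau> (Suc j)} (\<rho> (Suc i)) *\<^sub>R (B (\<rho> (Suc i)) \<omega> - B (\<rho> i) \<omega>)))"
    unfolding simple_integral_def G_def simple_value_def matrix_vector_mult_sum_left
    by (simp add: scaleR_matrix_vector_assoc matrix_vector_mult_scaleR)
  also have "\<dots> = (\<Sum>j<k. Y j \<omega> *v (\<Sum>i<K. indicator {\<tau> j<..\<tau> (Suc j)} (\<rho> (Suc i)) *\<^sub>R (B (\<rho> (Suc i)) \<omega> - B (\<rho> i) \<omega>)))"
    unfolding matrix_vector_mult_sum_right by (rule sum.swap)
  also have "\<dots> = simple_integral B k \<tau> Y \<omega>"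
    unfolding simple_integral_def using part by (intro sum.cong refl) (simp only: lessThan_iff)
  finally show "simple_integral B K \<rho> G \<omega> = simple_integral B k \<tau> Y \<omega>" .
qed

text \<open>Processes on different grids can be subtracted coefficient by coefficient once both are
  rewritten on the union of the two grids.\<close>

lemma simple_process_diff:
  assumes sp: "simple_process M F t k \<tau> Y" and sp': "simple_process M F t k' \<tau>' Y'"
  obtains K \<rho> G where "simple_process M F t K \<rho> G"
    "\<And>\<omega>. simple_integral B K \<rho> G \<omega> = simple_integral B k \<tau> Y \<omega> - simple_integral B k' \<tau>' Y' \<omega>"
    "\<And>s \<omega>. simple_value K \<rho> G s \<omega> = simple_value k \<tau> Y s \<omega> - simple_value k' \<tau>' Y' s \<omega>"
proof -
  let ?T = "\<tau> ` {..k} \<union> \<tau>' ` {..k'}"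
  have "\<tau> 0 = 0" "\<tau> k = t" using sp by (auto simp: simple_process_def)
  then have "0 \<in> \<tau> ` {..k}" "t \<in> \<tau> ` {..k}" by (metis atMost_iff imageI le0, blast)
  moreover have "?T \<subseteq> {0..t}"
    using simple_processD(2,3)[OF sp] simple_processD(2,3)[OF sp'] by auto
  ultimately obtain K :: nat and \<rho> :: "nat \<Rightarrow> real"
    where \<rho>: "\<rho> 0 = 0" "\<rho> K = t" "\<rho> ` {..K} = ?T"
      and mono: "\<And>i j. j \<le> K \<Longrightarrow> i < j \<Longrightarrow> \<rho> i < \<rho> j"
    using finite_grid[of ?T t] by (metis UnI1 finite_Un finite_atMost finite_imageI)
  define G where "G i = simple_value k \<tau> Y (\<rho> (Suc i))" for i
  define G' where "G' i = simple_value k' \<tau>' Y' (\<rho> (Suc i))" for i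
  note R = simple_process_refine[OF sp \<rho>(1,2) _ mono, folded G_def, unfolded \<rho>(3)]
  note R' = simple_process_refine[OF sp' \<rho>(1,2) _ mono, folded G'_def, unfolded \<rho>(3)]
  have b: "bounded ((\<lambda>\<omega>. G i \<omega> - G' i \<omega>) ` space M)" if "i < K" for i
    using bounded_minus_comp[of "G i" "space M" "G' i"] simple_processD(5)[OF R(1) that]
      simple_processD(5)[OF R'(1) that] by auto
  have "(\<lambda>\<omega>. G i \<omega> - G' i \<omega>) \<in> borel_measurable (F (\<rho> i))" if "i < K" for i
    using simple_processD(4)[OF R(1) that] simple_processD(4)[OF R'(1) that] by simp
  with b have "simple_process M F t K \<rho> (\<lambda>i \<omega>. G i \<omega> - G' i \<omega>)"
    using R(1) by (simp add: simple_process_def)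
  moreover have "simple_integral B K \<rho> (\<lambda>i \<omega>. G i \<omega> - G' i \<omega>) \<omega> =
     simple_integral B k \<tau> Y \<omega> - simple_integral B k' \<tau>' Y' \<omega>" for \<omega>
    using R(2)[of \<omega>] R'(2)[of \<omega>] by (simp add: simple_integral_def sum_subtractf matrix_vector_mult_diff_rdistrib)
  moreover have "simple_value K \<rho> (\<lambda>i \<omega>. G i \<omega> - G' i \<omega>) s \<omega> =
     simple_value k \<tau> Y s \<omega> - simple_value k' \<tau>' Y' s \<omega>" for s \<omega>
    using R(3)[of s \<omega>] R'(3)[of s \<omega>] by (simp add: simple_value_def sum_subtractf scaleR_diff_right)
  ultimately show ?thesis using that by blast
qed

lemma simple_integral_measurable:
  "simple_process M F t k \<tau> Y \<Longrightarrow> simple_integral B k \<tau> Y \<in> borel_measurable M"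
  using simple_integral_isometry measurable_F_M by blast

text \<open>Lenglart's inequality for a difference: integrands that are close in L2, in probability,
  have integrals that are close in probability. This makes the Ito integral independent of the
  approximating sequence.\<close>

lemma simple_integral_diff_tail:
  assumes sp: "simple_process M F t k \<tau> Y" and sp': "simple_process M F t k' \<tau>' Y'"
    and pos: "0 < \<epsilon>" "0 \<le> \<delta>"
  shows "prob {\<omega>\<in>space M. \<epsilon> < norm (simple_integral B k \<tau> Y \<omega> - simple_integral B k' \<tau>' Y' \<omega>)}
    \<le> prob {\<omega>\<in>space M. ennreal \<delta> < (\<integral>\<^sup>+ s\<in>{0..t}. ennreal ((norm (simple_value k \<tau> Y s \<omega>
         - simple_value k' \<tau>' Y' s \<omega>))\<^sup>2) \<partial>lborel)} + \<delta> / \<epsilon>\<^sup>2"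
proof -
  obtain K \<rho> G where G: "simple_process M F t K \<rho> G"
    "\<And>\<omega>. simple_integral B K \<rho> G \<omega> = simple_integral B k \<tau> Y \<omega> - simple_integral B k' \<tau>' Y' \<omega>"
    "\<And>s \<omega>. simple_value K \<rho> G s \<omega> = simple_value k \<tau> Y s \<omega> - simple_value k' \<tau>' Y' s \<omega>"
    using simple_process_diff[OF sp sp'] by blast
  show ?thesis
    using simple_integral_tail[OF G(1) pos] nn_integral_simple_value[OF G(1)] pos
    unfolding G(2,3) by (simp add: ennreal_less_iff)
qed

end

section \<open>Limits in probability\<close>

context prob_space
begin

lemma prob_tendsto_0_of_AE:
  assumes m: "\<And>n. A n \<in> events" and "\<And>\<omega>. \<omega> \<in> space M \<Longrightarrow> eventually (\<lambda>n. \<omega> \<notin> A n) sequentially"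
  shows "(\<lambda>n. prob (A n)) \<longlonglongrightarrow> 0"
proof -
  have "(\<lambda>n. \<integral>\<omega>. indicator (A n) \<omega> \<partial>M) \<longlonglongrightarrow> (\<integral>\<omega>. (0::real) \<partial>M)"
  proof (rule integral_dominated_convergence[where w="\<lambda>_. 1"])
    show "AE \<omega> in M. (\<lambda>n. indicator (A n) \<omega> :: real) \<longlonglongrightarrow> 0"
    proof (rule AE_I2)
      fix \<omega> assume "\<omega> \<in> space M"
      from assms(2)[OF this] have "eventually (\<lambda>n. indicator (A n) \<omega> = (0::real)) sequentially"
        by eventually_elim simp
      then show "(\<lambda>n. indicator (A n) \<omega> :: real) \<longlonglongrightarrow> 0" by (rule tendsto_eventually)
    qed
  qed (use m in auto)
  moreover have "(\<integral>\<omega>. indicator (A n) \<omega> \<partial>M) = prob (A n)" for n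
    using m[of n] sets.sets_into_space[OF m[of n]] by (simp add: Int_absorb2)
  ultimately show ?thesis by simp
qed

text \<open>Fatou's lemma along an almost surely convergent subsequence. The subsequence comes from
  L1 convergence of the truncated distance \<open>u\<close>, which follows from convergence in
  probability because \<open>u\<close> is bounded by 1.\<close>

lemma second_moment_le_of_tendsto_in_prob:
  fixes U :: "'a \<Rightarrow> real"
  assumes [measurable]: "\<And>n. Us n \<in> borel_measurable M" "U \<in> borel_measurable M"
    and conv: "\<And>e. 0 < e \<Longrightarrow> (\<lambda>n. prob {\<omega>\<in>space M. e < \<bar>Us n \<omega> - U \<omega>\<bar>}) \<longlonglongrightarrow> 0"
    and int: "\<And>n. integrable M (\<lambda>\<omega>. (Us n \<omega>)\<^sup>2)" and le: "\<And>n. (\<integral>\<omega>. (Us n \<omega>)\<^sup>2 \<partial>M) \<le> c"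
  shows "integrable M (\<lambda>\<omega>. (U \<omega>)\<^sup>2)" "(\<integral>\<omega>. (U \<omega>)\<^sup>2 \<partial>M) \<le> c"
proof -
  define u where "u n \<omega> = min 1 \<bar>Us n \<omega> - U \<omega>\<bar>" for n \<omega>
  have um [measurable]: "u n \<in> borel_measurable M" for n unfolding u_def[abs_def] by measurable
  have ui: "integrable M (u n)" for n
    by (rule integrable_const_bound[where B=1]) (auto simp: u_def)
  have "(\<lambda>n. \<integral>\<omega>. norm (u n \<omega>) \<partial>M) \<longlonglongrightarrow> 0"
  proof (rule LIMSEQ_I)
    fix e :: real assume e: "0 < e"
    have "eventually (\<lambda>n. prob {\<omega>\<in>space M. e/2 < \<bar>Us n \<omega> - U \<omega>\<bar>} < e/2) sequentially"
      using order_tendstoD(2)[OF conv[of "e/2"], of "e/2"] e by simp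
    then obtain N where N: "\<And>n. n \<ge> N \<Longrightarrow> prob {\<omega>\<in>space M. e/2 < \<bar>Us n \<omega> - U \<omega>\<bar>} < e/2"
      by (auto simp: eventually_sequentially)
    have "norm ((\<integral>\<omega>. norm (u n \<omega>) \<partial>M) - 0) < e" if "n \<ge> N" for n
    proof -
      define A where "A = {\<omega>\<in>space M. e/2 < \<bar>Us n \<omega> - U \<omega>\<bar>}"
      have A: "A \<in> events" unfolding A_def by measurable
      have iA: "integrable M (indicat_real A)"
        by (rule integrable_const_bound[where B=1]) (use A in auto)
      have pt: "norm (u n \<omega>) \<le> e/2 + indicat_real A \<omega>" if "\<omega> \<in> space M" for \<omega>
      proof (cases "\<omega> \<in> A")
        case True then show ?thesis using e by (simp add: u_def)
      next
        case False
        with that have "\<bar>Us n \<omega> - U \<omega>\<bar> \<le> e/2" by (simp add: A_def not_less)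
        moreover have "u n \<omega> \<le> \<bar>Us n \<omega> - U \<omega>\<bar>" "0 \<le> u n \<omega>" by (simp_all add: u_def)
        ultimately show ?thesis using False by simp
      qed
      have "(\<integral>\<omega>. norm (u n \<omega>) \<partial>M) \<le> (\<integral>\<omega>. e/2 + indicat_real A \<omega> \<partial>M)"
        by (intro integral_mono integrable_norm ui Bochner_Integration.integrable_add integrable_const iA pt)
      also have "\<dots> = e/2 + prob A"
        using iA A sets.sets_into_space[OF A] by (simp add: prob_space Int_absorb2)
      also have "\<dots> < e" using N[OF that] unfolding A_def by linarith
      finally show ?thesis by simp
    qed
    then show "\<exists>N. \<forall>n\<ge>N. norm ((\<integral>\<omega>. norm (u n \<omega>) \<partial>M) - 0) < e" by blast
  qed
  from tendsto_L1_AE_subseq[OF ui this] obtain r where r: "strict_mono r" "AE \<omega> in M. (\<lambda>n. u (r n) \<omega>) \<longlonglongrightarrow> 0"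
    by blast
  have AE: "AE \<omega> in M. liminf (\<lambda>n. ennreal ((Us (r n) \<omega>)\<^sup>2)) = ennreal ((U \<omega>)\<^sup>2)"
    using r(2)
  proof eventually_elim
    fix \<omega> assume *: "(\<lambda>n. u (r n) \<omega>) \<longlonglongrightarrow> 0"
    \<comment> \<open>Once \<open>u\<close> is below 1 the truncation is inactive and
      \<open>u\<close> is the true distance.\<close>
    have "eventually (\<lambda>n. u (r n) \<omega> < 1) sequentially" using order_tendstoD(2)[OF *] by simp
    then have "eventually (\<lambda>n. \<bar>Us (r n) \<omega> - U \<omega>\<bar> = u (r n) \<omega>) sequentially"
      by eventually_elim (auto simp: u_def)
    then have "(\<lambda>n. \<bar>Us (r n) \<omega> - U \<omega>\<bar>) \<longlonglongrightarrow> 0"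
      using * by (simp add: filterlim_cong)
    then have "(\<lambda>n. Us (r n) \<omega>) \<longlonglongrightarrow> U \<omega>"
      by (simp add: tendsto_rabs_zero_iff LIM_zero_iff)
    then have "(\<lambda>n. ennreal ((Us (r n) \<omega>)\<^sup>2)) \<longlonglongrightarrow> ennreal ((U \<omega>)\<^sup>2)"
      by (intro tendsto_intros)
    then show "liminf (\<lambda>n. ennreal ((Us (r n) \<omega>)\<^sup>2)) = ennreal ((U \<omega>)\<^sup>2)"
      by (simp add: lim_imp_Liminf)
  qed
  have "(\<integral>\<^sup>+\<omega>. ennreal ((U \<omega>)\<^sup>2) \<partial>M) = (\<integral>\<^sup>+\<omega>. liminf (\<lambda>n. ennreal ((Us (r n) \<omega>)\<^sup>2)) \<partial>M)"
    by (rule nn_integral_cong_AE) (use AE in eventually_elim, simp)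
  also have "\<dots> \<le> liminf (\<lambda>n. \<integral>\<^sup>+\<omega>. ennreal ((Us (r n) \<omega>)\<^sup>2) \<partial>M)"
    by (rule nn_integral_liminf) measurable
  also have "\<dots> = liminf (\<lambda>n. ennreal (\<integral>\<omega>. (Us (r n) \<omega>)\<^sup>2 \<partial>M))"
    by (simp add: nn_integral_eq_integral int)
  also have "\<dots> \<le> liminf (\<lambda>n::nat. ennreal c)"
    by (intro Liminf_mono always_eventually allI ennreal_leI le)
  also have "\<dots> = ennreal c" by (simp add: Liminf_const)
  finally have fin: "(\<integral>\<^sup>+\<omega>. ennreal ((U \<omega>)\<^sup>2) \<partial>M) \<le> ennreal c" .
  then show i: "integrable M (\<lambda>\<omega>. (U \<omega>)\<^sup>2)"
    by (intro integrableI_bounded) (auto simp: le_less_trans)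
  have "0 \<le> (\<integral>\<omega>. (Us 0 \<omega>)\<^sup>2 \<partial>M)" by simp
  with le[of 0] have "0 \<le> c" by linarith
  with fin show "(\<integral>\<omega>. (U \<omega>)\<^sup>2 \<partial>M) \<le> c"
    by (simp add: nn_integral_eq_integral i)
qed

text \<open>Bounded second moments make the sequence uniformly integrable, so that its mean passes
  to a limit in probability.\<close>

lemma integral_zero_of_tendsto_in_prob:
  fixes S :: "'a \<Rightarrow> real"
  assumes [measurable]: "\<And>n. Sn n \<in> borel_measurable M" "S \<in> borel_measurable M"
    and conv: "\<And>e. 0 < e \<Longrightarrow> (\<lambda>n. prob {\<omega>\<in>space M. e < \<bar>Sn n \<omega> - S \<omega>\<bar>}) \<longlonglongrightarrow> 0"
    and int: "\<And>n. integrable M (\<lambda>\<omega>. (Sn n \<omega>)\<^sup>2)" and le: "\<And>n. (\<integral>\<omega>. (Sn n \<omega>)\<^sup>2 \<partial>M) \<le> c"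
    and zero: "\<And>n. (\<integral>\<omega>. Sn n \<omega> \<partial>M) = 0"
  shows "integrable M S" "(\<integral>\<omega>. S \<omega> \<partial>M) = 0"
proof -
  note S2 = second_moment_le_of_tendsto_in_prob[OF assms(1-5)]
  have i1: "integrable M f" if "f \<in> borel_measurable M" "integrable M (\<lambda>\<omega>. (f \<omega>)\<^sup>2)" for f :: "'a \<Rightarrow> real"
  proof (rule Bochner_Integration.integrable_bound[of M "\<lambda>\<omega>. 1 + (f \<omega>)\<^sup>2"])
    have "\<bar>x\<bar> \<le> 1 + x\<^sup>2" for x :: real
      using sum_squares_bound[of 1 "\<bar>x\<bar>"] by simp
    then show "AE x in M. norm (f x) \<le> norm (1 + (f x)\<^sup>2)" by auto
  qed (use that in auto)
  show iS: "integrable M S" by (rule i1[OF _ S2(1)]) simp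
  have iSn: "integrable M (Sn n)" for n by (rule i1[OF _ int]) simp
  have "0 \<le> (\<integral>\<omega>. (Sn 0 \<omega>)\<^sup>2 \<partial>M)" by simp
  with le[of 0] have c: "0 \<le> c" by linarith
  \<comment> \<open>Off the exceptional event the difference is at most \<open>e\<close>. On it,
    Young's inequality z \<le> h z^2 / 2 + 1 / (2 h) trades the difference for second moments, small
    with \<open>h\<close>, and for the probability of the event, small for large \<open>n\<close>
    once \<open>h\<close> is fixed.\<close>
  have bnd: "\<bar>\<integral>\<omega>. S \<omega> \<partial>M\<bar> \<le> e + (2 * c * h + prob {\<omega>\<in>space M. e < \<bar>Sn n \<omega> - S \<omega>\<bar>} / (2 * h))"
    if "0 < e" "0 < h" for e h n
  proof -
    define A where "A = {\<omega>\<in>space M. e < \<bar>Sn n \<omega> - S \<omega>\<bar>}"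
    have A: "A \<in> events" unfolding A_def by measurable
    have iA: "integrable M (indicat_real A)"
      by (rule integrable_const_bound[where B=1]) (use A in auto)
    have pt: "\<bar>Sn n \<omega> - S \<omega>\<bar> \<le> e + (h * ((Sn n \<omega>)\<^sup>2 + (S \<omega>)\<^sup>2) + indicat_real A \<omega> * (1 / (2 * h)))" if "\<omega> \<in> space M" for \<omega>
    proof (cases "\<omega> \<in> A")
      case True
      let ?z = "\<bar>Sn n \<omega> - S \<omega>\<bar>"
      have "0 \<le> (h * ?z - 1)\<^sup>2 / (2 * h)" using \<open>0 < h\<close> by simp
      also have "\<dots> = h * ?z\<^sup>2 / 2 - ?z + 1 / (2 * h)" using \<open>0 < h\<close> by (simp add: power2_eq_square field_simps)
      finally have "?z \<le> h * ?z\<^sup>2 / 2 + 1 / (2 * h)" by simp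
      moreover have "?z\<^sup>2 \<le> 2 * ((Sn n \<omega>)\<^sup>2 + (S \<omega>)\<^sup>2)"
        using zero_le_power2[of "Sn n \<omega> + S \<omega>"] by (simp add: power2_eq_square algebra_simps)
      then have "h * ?z\<^sup>2 / 2 \<le> h * ((Sn n \<omega>)\<^sup>2 + (S \<omega>)\<^sup>2)" using \<open>0 < h\<close> by simp
      ultimately show ?thesis using True \<open>0 < e\<close> by simp
    next
      case False
      have "0 \<le> h * ((Sn n \<omega>)\<^sup>2 + (S \<omega>)\<^sup>2)" using \<open>0 < h\<close> by simp
      with False that show ?thesis by (auto simp: not_less A_def)
    qed
    have "\<bar>\<integral>\<omega>. S \<omega> \<partial>M\<bar> = \<bar>\<integral>\<omega>. Sn n \<omega> - S \<omega> \<partial>M\<bar>"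
      using iS iSn zero[of n] by simp
    also have "\<dots> \<le> (\<integral>\<omega>. \<bar>Sn n \<omega> - S \<omega>\<bar> \<partial>M)"
      using integral_norm_bound[of M "\<lambda>\<omega>. Sn n \<omega> - S \<omega>"] by simp
    also have "\<dots> \<le> (\<integral>\<omega>. e + (h * ((Sn n \<omega>)\<^sup>2 + (S \<omega>)\<^sup>2) + indicat_real A \<omega> * (1 / (2 * h))) \<partial>M)"
      by (rule integral_mono) (use iS iSn int S2(1) pt iA in auto)
    also have "\<dots> = e + (h * ((\<integral>\<omega>. (Sn n \<omega>)\<^sup>2 \<partial>M) + (\<integral>\<omega>. (S \<omega>)\<^sup>2 \<partial>M)) + prob A * (1 / (2 * h)))"
      using int S2(1) iA sets.sets_into_space[OF A] by (simp add: prob_space Int_absorb2)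
    also have "\<dots> \<le> e + (h * (c + c) + prob A * (1 / (2 * h)))"
      using le[of n] S2(2) \<open>0 < h\<close> by (intro add_mono mult_left_mono) auto
    finally show ?thesis by (simp add: algebra_simps A_def)
  qed
  have "\<bar>\<integral>\<omega>. S \<omega> \<partial>M\<bar> \<le> 0 + e" if e: "0 < e" for e
  proof -
    \<comment> \<open>The choice gives 2 c h \<le> e / 2; adding 1 to \<open>c\<close> keeps the
      denominator positive when \<open>c = 0\<close>.\<close>
    define h where "h = e / (4 * (c + 1))"
    have h: "0 < h" "2 * c * h \<le> e / 2" using e c by (auto simp: h_def field_simps)
    have "(\<lambda>n. e/2 + (2 * c * h + prob {\<omega>\<in>space M. e/2 < \<bar>Sn n \<omega> - S \<omega>\<bar>} / (2 * h)))
      \<longlonglongrightarrow> e/2 + (2 * c * h + 0 / (2 * h))"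
      using e h by (intro tendsto_intros conv) auto
    then have "\<bar>\<integral>\<omega>. S \<omega> \<partial>M\<bar> \<le> e/2 + (2 * c * h + 0 / (2 * h))"
      by (rule LIMSEQ_le_const) (use bnd[of "e/2" h] e h in auto)
    with h show ?thesis by simp
  qed
  then have "\<bar>\<integral>\<omega>. S \<omega> \<partial>M\<bar> \<le> 0" by (rule field_le_epsilon)
  then show "(\<integral>\<omega>. S \<omega> \<partial>M) = 0" by simp
qed

end

context brownian
begin

text \<open>Progressive measurability up to time \<open>t\<close> is the source of joint
  measurability. It is pulled back along the swapped pair to the product of \<open>M\<close> with
  the time interval, where Tonelli's theorem makes the time integral measurable in \<omega>.\<close>

lemma sq_distance_measurable:
  assumes H: "(\<lambda>(s, \<omega>). H s \<omega>) \<in> borel_measurable (restrict_space borel {0..t} \<Otimes>\<^sub>M F t)"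
    and sp: "simple_process M F t k \<tau> Y"
  shows "(\<lambda>\<omega>. \<integral>\<^sup>+ s\<in>{0..t}. ennreal ((norm (simple_value k \<tau> Y s \<omega> - H s \<omega>))\<^sup>2) \<partial>lborel) \<in> borel_measurable M"
proof -
  let ?R = "restrict_space lborel {0..t} :: real measure"
  interpret R: sigma_finite_measure ?R
    by (rule sigma_finite_measure_restrict_space) (auto intro: sigma_finite_lborel)
  \<comment> \<open>The identity is measurable from \<open>M\<close> to \<open>F t\<close> because
    \<open>F t\<close> is coarser.\<close>
  have id: "(\<lambda>x. x) \<in> measurable M (F t)"
    by (rule measurable_F_M[OF measurable_ident_sets[OF refl]])
  have "(\<lambda>p. (snd p, fst p)) \<in> measurable (M \<Otimes>\<^sub>M ?R) (restrict_space borel {0..t} \<Otimes>\<^sub>M F t)"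
  proof (rule measurable_Pair)
    show "snd \<in> measurable (M \<Otimes>\<^sub>M ?R) (restrict_space borel {0..t})"
      by (rule measurable_compose[OF measurable_snd measurable_ident_sets[OF sets_restrict_space_cong[OF sets_lborel]]])
    show "fst \<in> measurable (M \<Otimes>\<^sub>M ?R) (F t)"
      by (rule measurable_compose[OF measurable_fst id])
  qed
  from measurable_compose[OF this H] have Hm: "(\<lambda>p. H (snd p) (fst p)) \<in> borel_measurable (M \<Otimes>\<^sub>M ?R)"
    by (simp add: split_beta')
  have snd_b: "snd \<in> borel_measurable (M \<Otimes>\<^sub>M ?R)"
    by (rule measurable_compose[OF measurable_snd, of "\<lambda>x. x", simplified])
      (auto intro: measurable_restrict_space1)
  have YM: "(\<lambda>p. Y i (fst p)) \<in> borel_measurable (M \<Otimes>\<^sub>M ?R)" if "i < k" for i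
    using measurable_compose[OF measurable_fst measurable_F_M[OF simple_processD(4)[OF sp that]]] .
  have ind: "(\<lambda>p. indicator {\<tau> i<..\<tau> (Suc i)} (snd p) :: real) \<in> borel_measurable (M \<Otimes>\<^sub>M ?R)" for i
    by (rule measurable_compose[OF snd_b]) simp
  have "(\<lambda>p. simple_value k \<tau> Y (snd p) (fst p)) \<in> borel_measurable (M \<Otimes>\<^sub>M ?R)"
    unfolding simple_value_def
    by (intro borel_measurable_sum borel_measurable_scaleR ind YM) auto
  with Hm have "(\<lambda>p. ennreal ((norm (simple_value k \<tau> Y (snd p) (fst p) - H (snd p) (fst p)))\<^sup>2)) \<in> borel_measurable (M \<Otimes>\<^sub>M ?R)"
    by measurable
  then have "(\<lambda>\<omega>. \<integral>\<^sup>+ s. ennreal ((norm (simple_value k \<tau> Y s \<omega> - H s \<omega>))\<^sup>2) \<partial>?R) \<in> borel_measurable M"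
    by (intro R.borel_measurable_nn_integral) (simp add: split_beta')
  then show ?thesis by (simp add: nn_integral_restrict_space)
qed

lemma sq_distance_triangle:
  assumes H: "(\<lambda>(s, \<omega>). H s \<omega>) \<in> borel_measurable (restrict_space borel {0..t} \<Otimes>\<^sub>M F t)"
    and \<omega>: "\<omega> \<in> space M"
  shows "(\<integral>\<^sup>+ s\<in>{0..t}. ennreal ((norm (simple_value k \<tau> Y s \<omega> - simple_value k' \<tau>' Y' s \<omega>))\<^sup>2) \<partial>lborel) \<le>
    2 * (\<integral>\<^sup>+ s\<in>{0..t}. ennreal ((norm (simple_value k \<tau> Y s \<omega> - H s \<omega>))\<^sup>2) \<partial>lborel) +
    2 * (\<integral>\<^sup>+ s\<in>{0..t}. ennreal ((norm (simple_value k' \<tau>' Y' s \<omega> - H s \<omega>))\<^sup>2) \<partial>lborel)"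
proof -
  let ?R = "restrict_space lborel {0..t} :: real measure"
  have "(\<lambda>s. (s, \<omega>)) \<in> measurable ?R (restrict_space borel {0..t} \<Otimes>\<^sub>M F t)"
    using \<omega> by (intro measurable_Pair measurable_const)
      (auto simp: measurable_cong_sets[OF sets_restrict_space_cong[OF sets_lborel] refl])
  from measurable_compose[OF this H] have [measurable]: "(\<lambda>s. H s \<omega>) \<in> borel_measurable ?R" by simp
  have [measurable]: "(\<lambda>s. simple_value k \<tau> Y s \<omega>) \<in> borel_measurable ?R" for k \<tau> Y
    unfolding simple_value_def by (intro measurable_restrict_space1) measurable
  let ?v = "\<lambda>s. simple_value k \<tau> Y s \<omega>" and ?w = "\<lambda>s. simple_value k' \<tau>' Y' s \<omega>"
  have "(\<integral>\<^sup>+ s. ennreal ((norm (?v s - ?w s))\<^sup>2) \<partial>?R) \<le>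
    (\<integral>\<^sup>+ s. 2 * ennreal ((norm (?v s - H s \<omega>))\<^sup>2) + 2 * ennreal ((norm (?w s - H s \<omega>))\<^sup>2) \<partial>?R)"
  proof (rule nn_integral_mono)
    fix s
    have "norm (?v s - ?w s) \<le> norm (?v s - H s \<omega>) + norm (?w s - H s \<omega>)"
      using norm_triangle_ineq4[of "?v s - H s \<omega>" "?w s - H s \<omega>"] by simp
    then have "(norm (?v s - ?w s))\<^sup>2 \<le> (norm (?v s - H s \<omega>) + norm (?w s - H s \<omega>))\<^sup>2"
      by (rule power_mono) simp
    also have "\<dots> \<le> 2 * (norm (?v s - H s \<omega>))\<^sup>2 + 2 * (norm (?w s - H s \<omega>))\<^sup>2"
      using sum_squares_bound[of "norm (?v s - H s \<omega>)" "norm (?w s - H s \<omega>)"]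
      by (simp add: power2_sum)
    finally have "ennreal ((norm (?v s - ?w s))\<^sup>2) \<le>
      ennreal (2 * (norm (?v s - H s \<omega>))\<^sup>2 + 2 * (norm (?w s - H s \<omega>))\<^sup>2)"
      by (rule ennreal_leI)
    then show "ennreal ((norm (?v s - ?w s))\<^sup>2) \<le>
      2 * ennreal ((norm (?v s - H s \<omega>))\<^sup>2) + 2 * ennreal ((norm (?w s - H s \<omega>))\<^sup>2)"
      by (simp add: ennreal_mult)
  qed
  also have "\<dots> = 2 * (\<integral>\<^sup>+ s. ennreal ((norm (?v s - H s \<omega>))\<^sup>2) \<partial>?R) +
    2 * (\<integral>\<^sup>+ s. ennreal ((norm (?w s - H s \<omega>))\<^sup>2) \<partial>?R)"
    by (simp add: nn_integral_add nn_integral_cmult)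
  finally show ?thesis by (simp add: nn_integral_restrict_space)
qed

text \<open>The definition grants one approximating sequence, not a prescribed one. Comparison with
  it through \<open>simple_integral_diff_tail\<close> shows that any simple processes converging to
  the integrand in L2 along each path produce the same integral.\<close>

lemma ito_integral_tendsto_in_prob:
  assumes hi: "has_ito_integral M F B H t J" and t: "0 \<le> t"
    and sp: "\<And>m. simple_process M F t (k m) (\<tau> m) (Z m)"
    and conv: "\<And>\<omega>. \<omega> \<in> space M \<Longrightarrow> (\<lambda>m. \<integral>\<^sup>+ s\<in>{0..t}.
      ennreal ((norm (simple_value (k m) (\<tau> m) (Z m) s \<omega> - H s \<omega>))\<^sup>2) \<partial>lborel) \<longlonglongrightarrow> 0"
    and e: "0 < e"
  shows "(\<lambda>m. prob {\<omega>\<in>space M. e < norm (simple_integral B (k m) (\<tau> m) (Z m) \<omega> - J \<omega>)}) \<longlonglongrightarrow> 0"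
proof -
  from hi t have JM [measurable]: "J \<in> borel_measurable M"
    and HM: "(\<lambda>(s, \<omega>). H s \<omega>) \<in> borel_measurable (restrict_space borel {0..t} \<Otimes>\<^sub>M F t)"
    by (auto simp: has_ito_integral_def)
  from hi obtain k' \<tau>' Y where sp': "\<And>n. simple_process M F t (k' n) (\<tau>' n) (Y n)"
    and c1: "null_in_prob M (\<lambda>n \<omega>. \<integral>\<^sup>+ s\<in>{0..t}.
          ennreal ((norm (simple_value (k' n) (\<tau>' n) (Y n) s \<omega> - H s \<omega>))\<^sup>2) \<partial>lborel)"
    and c2: "null_in_prob M (\<lambda>n \<omega>.
          ennreal (norm (simple_integral B (k' n) (\<tau>' n) (Y n) \<omega> - J \<omega>)))"
    unfolding has_ito_integral_def by blast
  define Q where "Q m \<omega> = (\<integral>\<^sup>+ s\<in>{0..t}.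
      ennreal ((norm (simple_value (k m) (\<tau> m) (Z m) s \<omega> - H s \<omega>))\<^sup>2) \<partial>lborel)" for m \<omega>
  define Q' where "Q' n \<omega> = (\<integral>\<^sup>+ s\<in>{0..t}.
      ennreal ((norm (simple_value (k' n) (\<tau>' n) (Y n) s \<omega> - H s \<omega>))\<^sup>2) \<partial>lborel)" for n \<omega>
  have QM [measurable]: "Q m \<in> borel_measurable M" "Q' n \<in> borel_measurable M" for m n
    unfolding Q_def[abs_def] Q'_def[abs_def] using sq_distance_measurable[OF HM] sp sp' by auto
  define I where "I m = simple_integral B (k m) (\<tau> m) (Z m)" for m
  define I' where "I' n = simple_integral B (k' n) (\<tau>' n) (Y n)" for n
  have IM [measurable]: "I m \<in> borel_measurable M" "I' n \<in> borel_measurable M" for m n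
    unfolding I_def I'_def using simple_integral_measurable sp sp' by auto
  \<comment> \<open>Here \<open>m\<close> is fixed while the index \<open>n\<close> of the sequence
    from the definition tends to infinity, which removes every term that depends on
    \<open>n\<close>. The quarter in \<open>d/4\<close> compensates for the two factors 2 in
    \<open>sq_distance_triangle\<close>.\<close>
  have tail: "prob {\<omega>\<in>space M. e < norm (I m \<omega> - J \<omega>)} \<le>
     prob {\<omega>\<in>space M. ennreal (d/4) < Q m \<omega>} + 4 * d / e\<^sup>2" if d: "0 < d" for m d
  proof -
    have le: "prob {\<omega>\<in>space M. e < norm (I m \<omega> - J \<omega>)} \<le>
      (prob {\<omega>\<in>space M. ennreal (d/4) < Q m \<omega>} + prob {\<omega>\<in>space M. ennreal (d/4) < Q' n \<omega>} + d / (e/2)\<^sup>2)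
       + prob {\<omega>\<in>space M. ennreal (e/2) < ennreal (norm (I' n \<omega> - J \<omega>))}" for n
    proof -
      let ?D = "\<lambda>\<omega>. \<integral>\<^sup>+ s\<in>{0..t}. ennreal ((norm (simple_value (k m) (\<tau> m) (Z m) s \<omega>
          - simple_value (k' n) (\<tau>' n) (Y n) s \<omega>))\<^sup>2) \<partial>lborel"
      have "prob {\<omega>\<in>space M. e < norm (I m \<omega> - J \<omega>)} \<le>
        prob ({\<omega>\<in>space M. e/2 < norm (I m \<omega> - I' n \<omega>)} \<union> {\<omega>\<in>space M. ennreal (e/2) < ennreal (norm (I' n \<omega> - J \<omega>))})"
      proof (intro finite_measure_mono subsetI)
        fix \<omega> assume \<omega>: "\<omega> \<in> {\<omega>\<in>space M. e < norm (I m \<omega> - J \<omega>)}"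
        have "norm (I m \<omega> - J \<omega>) \<le> norm (I m \<omega> - I' n \<omega>) + norm (I' n \<omega> - J \<omega>)"
          by (rule norm_diff_triangle_ineq[of "I m \<omega>" "I' n \<omega>" "I' n \<omega>" "J \<omega>", simplified, THEN order_trans]) 
            (simp add: norm_triangle_ineq)
        with \<omega> e show "\<omega> \<in> {\<omega>\<in>space M. e/2 < norm (I m \<omega> - I' n \<omega>)} \<union> {\<omega>\<in>space M. ennreal (e/2) < ennreal (norm (I' n \<omega> - J \<omega>))}"
          by (auto simp: ennreal_less_iff)
      qed measurable
      also have "\<dots> \<le> prob {\<omega>\<in>space M. e/2 < norm (I m \<omega> - I' n \<omega>)} + prob {\<omega>\<in>space M. ennreal (e/2) < ennreal (norm (I' n \<omega> - J \<omega>))}"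
        by (rule measure_Un_le) measurable
      also have "prob {\<omega>\<in>space M. e/2 < norm (I m \<omega> - I' n \<omega>)} \<le> prob {\<omega>\<in>space M. ennreal d < ?D \<omega>} + d / (e/2)\<^sup>2"
        unfolding I_def I'_def by (rule simple_integral_diff_tail[OF sp sp']) (use e d in auto)
      also have "prob {\<omega>\<in>space M. ennreal d < ?D \<omega>} \<le>
        prob ({\<omega>\<in>space M. ennreal (d/4) < Q m \<omega>} \<union> {\<omega>\<in>space M. ennreal (d/4) < Q' n \<omega>})"
      proof (intro finite_measure_mono subsetI)
        fix \<omega> assume \<omega>: "\<omega> \<in> {\<omega>\<in>space M. ennreal d < ?D \<omega>}"
        then have "\<omega> \<in> space M" by simp
        then have "?D \<omega> \<le> 2 * Q m \<omega> + 2 * Q' n \<omega>"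
          unfolding Q_def Q'_def by (rule sq_distance_triangle[OF HM])
        have "\<not> (Q m \<omega> \<le> ennreal (d/4) \<and> Q' n \<omega> \<le> ennreal (d/4))"
        proof
          assume "Q m \<omega> \<le> ennreal (d/4) \<and> Q' n \<omega> \<le> ennreal (d/4)"
          then have "2 * Q m \<omega> + 2 * Q' n \<omega> \<le> 2 * ennreal (d/4) + 2 * ennreal (d/4)"
            by (intro add_mono mult_left_mono) auto
          also have "\<dots> = ennreal 2 * ennreal (d/4) + ennreal 2 * ennreal (d/4)" by simp
          also have "\<dots> = ennreal d"
            using d by (simp only: ennreal_mult[symmetric] ennreal_plus[symmetric]) simp
          finally show False using \<omega> \<open>?D \<omega> \<le> 2 * Q m \<omega> + 2 * Q' n \<omega>\<close> by (auto simp: not_le[symmetric])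
        qed
        with \<omega> show "\<omega> \<in> {\<omega>\<in>space M. ennreal (d/4) < Q m \<omega>} \<union> {\<omega>\<in>space M. ennreal (d/4) < Q' n \<omega>}"
          by (auto simp: not_le)
      qed measurable
      also have "\<dots> \<le> prob {\<omega>\<in>space M. ennreal (d/4) < Q m \<omega>} + prob {\<omega>\<in>space M. ennreal (d/4) < Q' n \<omega>}"
        by (rule measure_Un_le) measurable
      finally show ?thesis by simp
    qed
    have "(\<lambda>n. (prob {\<omega>\<in>space M. ennreal (d/4) < Q m \<omega>} + prob {\<omega>\<in>space M. ennreal (d/4) < Q' n \<omega>} + d / (e/2)\<^sup>2)
       + prob {\<omega>\<in>space M. ennreal (e/2) < ennreal (norm (I' n \<omega> - J \<omega>))})
       \<longlonglongrightarrow> (prob {\<omega>\<in>space M. ennreal (d/4) < Q m \<omega>} + 0 + d / (e/2)\<^sup>2) + 0"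
      using c1 c2 d e unfolding null_in_prob_def Q'_def[symmetric] I'_def[symmetric]
      by (intro tendsto_intros) auto
    from LIMSEQ_le_const[OF this, of "prob {\<omega>\<in>space M. e < norm (I m \<omega> - J \<omega>)}"] le
    have "prob {\<omega>\<in>space M. e < norm (I m \<omega> - J \<omega>)} \<le>
      prob {\<omega>\<in>space M. ennreal (d/4) < Q m \<omega>} + 0 + d / (e/2)\<^sup>2 + 0" by blast
    also have "d / (e/2)\<^sup>2 = 4 * d / e\<^sup>2" by (simp add: power_divide)
    finally show ?thesis by simp
  qed
  have "(\<lambda>m. prob {\<omega>\<in>space M. e < norm (I m \<omega> - J \<omega>)}) \<longlonglongrightarrow> 0"
  proof (rule LIMSEQ_I)
    fix r :: real assume r: "0 < r"
    \<comment> \<open>Makes the Chebyshev term 4 d / e^2 equal to r / 2.\<close>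
    define d where "d = r * e\<^sup>2 / 8"
    have d: "0 < d" "4 * d / e\<^sup>2 = r / 2" using r e by (auto simp: d_def)
    have "(\<lambda>m. prob {\<omega>\<in>space M. ennreal (d/4) < Q m \<omega>}) \<longlonglongrightarrow> 0"
    proof (rule prob_tendsto_0_of_AE)
      fix \<omega> assume "\<omega> \<in> space M"
      then have "(\<lambda>m. Q m \<omega>) \<longlonglongrightarrow> 0" unfolding Q_def by (rule conv)
      then have "eventually (\<lambda>m. Q m \<omega> < ennreal (d/4)) sequentially"
        by (rule order_tendstoD) (use d in simp)
      then show "eventually (\<lambda>m. \<omega> \<notin> {\<omega>\<in>space M. ennreal (d/4) < Q m \<omega>}) sequentially"
        by eventually_elim (auto simp: not_less)
    qed measurable
    then have "eventually (\<lambda>m. prob {\<omega>\<in>space M. ennreal (d/4) < Q m \<omega>} < r/2) sequentially"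
      by (rule order_tendstoD) (use r in simp)
    then have "eventually (\<lambda>m. norm (prob {\<omega>\<in>space M. e < norm (I m \<omega> - J \<omega>)} - 0) < r) sequentially"
      proof eventually_elim
      fix m assume "prob {\<omega>\<in>space M. ennreal (d/4) < Q m \<omega>} < r/2"
      with tail[OF d(1), of m] d(2) show "norm (prob {\<omega>\<in>space M. e < norm (I m \<omega> - J \<omega>)} - 0) < r"
        by simp
    qed
    then show "\<exists>N. \<forall>m\<ge>N. norm (prob {\<omega>\<in>space M. e < norm (I m \<omega> - J \<omega>)} - 0) < r"
      by (auto simp: eventually_sequentially)
  qed
  then show ?thesis by (simp add: I_def)
qed

end

section \<open>The Euler scheme of a diffusion\<close>

text \<open>\<open>\<sigma>\<close> gets a global bound, which uniform ellipticity will supply. The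
  drift will contain the gradient of \<open>W\<close> and is only continuous, hence bounded along a
  path or on a ball but not globally.\<close>

locale diffusion = brownian M F B
  for M :: "'w measure" and F :: "real \<Rightarrow> 'w measure" and B :: "real \<Rightarrow> 'w \<Rightarrow> real^'n::finite" +
  fixes \<beta> :: "real^'n \<Rightarrow> real^'n" and \<sigma> :: "real^'n \<Rightarrow> real^'n^'n" and x :: "real^'n"
    and X :: "real \<Rightarrow> 'w \<Rightarrow> real^'n" and C :: real
  assumes sol: "sde_solution M F B \<beta> \<sigma> x X"
    and cont_\<sigma>: "continuous_on UNIV \<sigma>" and bound_\<sigma>: "\<And>y. norm (\<sigma> y) \<le> C"
    and cont_\<beta>: "continuous_on UNIV \<beta>"
begin

text \<open>The part of the path that the equation declares to be the Ito integral of
  \<open>\<sigma> (X s \<omega>)\<close>; its probabilistic properties are all drawn from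
  \<open>ito\<close>.\<close>

definition mart :: "real \<Rightarrow> 'w \<Rightarrow> real^'n" where
  "mart t \<omega> = X t \<omega> - X 0 \<omega> - (LINT s:{0..t}|lborel. \<beta> (X s \<omega>))"

lemma X_measurable_F: "0 \<le> t \<Longrightarrow> X t \<in> borel_measurable (F t)"
  and X_path: "\<omega> \<in> space M \<Longrightarrow> continuous_on {0..} (\<lambda>t. X t \<omega>)"
  and X_start: "AE \<omega> in M. X 0 \<omega> = x"
  and ito: "0 \<le> t \<Longrightarrow> has_ito_integral M F B (\<lambda>s \<omega>. \<sigma> (X s \<omega>)) t (mart t)"
  using sol unfolding sde_solution_def mart_def[abs_def] by blast+

lemma X_measurable [measurable]: "0 \<le> t \<Longrightarrow> X t \<in> borel_measurable M"
  using X_measurable_F measurable_F_M by blast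

lemma mart_measurable [measurable]: "0 \<le> t \<Longrightarrow> mart t \<in> borel_measurable M"
  using ito[of t] unfolding has_ito_integral_def by blast

lemma C_nonneg: "0 \<le> C"
  using bound_\<sigma>[of x] norm_ge_zero order_trans by blast

lemma \<sigma>_measurable_F: "0 \<le> s \<Longrightarrow> s \<le> t \<Longrightarrow> (\<lambda>\<omega>. \<sigma> (X s \<omega>)) \<in> borel_measurable (F t)"
  using measurable_compose[OF X_measurable_F borel_measurable_continuous_onI[OF cont_\<sigma>]] measurable_F_mono by blast

lemma \<sigma>_path: "\<omega> \<in> space M \<Longrightarrow> continuous_on {0..} (\<lambda>t. \<sigma> (X t \<omega>))"
  using continuous_on_compose2[OF cont_\<sigma> X_path] by blast

text \<open>The supremum is taken over rational times so that it is measurable.\<close>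

definition modulus :: "nat \<Rightarrow> 'w \<Rightarrow> real" where
  "modulus n \<omega> = (SUP p\<in>{(u, v). u \<in> \<rat> \<and> v \<in> \<rat> \<and> 0 \<le> u \<and> u \<le> 1 \<and> 0 \<le> v \<and> v \<le> 1 \<and> \<bar>u - v\<bar> \<le> 1 / real n}.
     norm (\<sigma> (X (fst p) \<omega>) - \<sigma> (X (snd p) \<omega>)))"

lemma \<sigma>_diff_le: "norm (\<sigma> y - \<sigma> z) \<le> 2 * C"
  using norm_triangle_ineq4[of "\<sigma> y" "\<sigma> z"] bound_\<sigma>[of y] bound_\<sigma>[of z] by linarith

lemma modulus_upper:
  assumes "u \<in> \<rat>" "v \<in> \<rat>" "0 \<le> u" "u \<le> 1" "0 \<le> v" "v \<le> 1" "\<bar>u - v\<bar> \<le> 1 / real n"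
  shows "norm (\<sigma> (X u \<omega>) - \<sigma> (X v \<omega>)) \<le> modulus n \<omega>"
proof -
  have "norm (\<sigma> (X (fst (u, v)) \<omega>) - \<sigma> (X (snd (u, v)) \<omega>)) \<le> modulus n \<omega>"
    unfolding modulus_def
    by (rule cSUP_upper) (use assms in \<open>auto intro!: bdd_aboveI[of _ "2 * C"] \<sigma>_diff_le\<close>)
  then show ?thesis by simp
qed

lemma modulus_le:
  assumes "\<And>u v. 0 \<le> u \<Longrightarrow> u \<le> 1 \<Longrightarrow> 0 \<le> v \<Longrightarrow> v \<le> 1 \<Longrightarrow> \<bar>u - v\<bar> \<le> 1 / real n \<Longrightarrow>
     norm (\<sigma> (X u \<omega>) - \<sigma> (X v \<omega>)) \<le> c"
  shows "modulus n \<omega> \<le> c"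
  unfolding modulus_def
  by (rule cSUP_least) (use assms in \<open>auto intro!: exI[of _ 0]\<close>)

lemma modulus_nonneg: "0 \<le> modulus n \<omega>"
  using modulus_upper[of 0 0 n \<omega>] by simp

lemma modulus_bound: "modulus n \<omega> \<le> 2 * C"
  by (rule modulus_le) (rule \<sigma>_diff_le)

lemma modulus_measurable [measurable]: "modulus n \<in> borel_measurable M"
  unfolding modulus_def[abs_def]
proof (rule borel_measurable_cSUP)
  show "countable {(u, v). u \<in> \<rat> \<and> v \<in> \<rat> \<and> 0 \<le> u \<and> u \<le> 1 \<and> 0 \<le> v \<and> v \<le> 1 \<and> \<bar>u - v\<bar> \<le> 1 / real n}"
    by (rule countable_subset[of _ "\<rat> \<times> \<rat>"]) (auto intro!: countable_SIGMA countable_rat)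
  fix p :: "real \<times> real" assume "p \<in> {(u, v). u \<in> \<rat> \<and> v \<in> \<rat> \<and> 0 \<le> u \<and> u \<le> 1 \<and> 0 \<le> v \<and> v \<le> 1 \<and> \<bar>u - v\<bar> \<le> 1 / real n}"
  then have "0 \<le> fst p" "0 \<le> snd p" by auto
  then have "(\<lambda>\<omega>. \<sigma> (X (fst p) \<omega>)) \<in> borel_measurable M" "(\<lambda>\<omega>. \<sigma> (X (snd p) \<omega>)) \<in> borel_measurable M"
    using \<sigma>_measurable_F measurable_F_M by blast+
  then show "(\<lambda>\<omega>. norm (\<sigma> (X (fst p) \<omega>) - \<sigma> (X (snd p) \<omega>))) \<in> borel_measurable M" by measurable
qed (auto intro!: bdd_aboveI[of _ "2 * C"] \<sigma>_diff_le)

lemma modulus_tendsto: "\<omega> \<in> space M \<Longrightarrow> (\<lambda>n. modulus n \<omega>) \<longlonglongrightarrow> 0"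
proof (rule LIMSEQ_I)
  fix r :: real assume \<omega>: "\<omega> \<in> space M" and r: "0 < r"
  have "uniformly_continuous_on {0..1} (\<lambda>t. \<sigma> (X t \<omega>))"
    by (intro compact_uniformly_continuous continuous_on_subset[OF \<sigma>_path[OF \<omega>]]) auto
  then obtain d where d: "0 < d" "\<And>u v. u \<in> {0..1} \<Longrightarrow> v \<in> {0..1} \<Longrightarrow> dist u v < d \<Longrightarrow>
      dist (\<sigma> (X u \<omega>)) (\<sigma> (X v \<omega>)) < r / 2"
    using r unfolding uniformly_continuous_on_def by (meson half_gt_zero)
  obtain N where N: "0 < N" "1 / real N < d"
    using real_arch_inverse[of d] d by (auto simp: inverse_eq_divide)
  have "norm (modulus n \<omega> - 0) < r" if "n \<ge> N" for n
  proof -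
    have "1 / real n \<le> 1 / real N" using that N by (simp add: frac_le)
    then have "modulus n \<omega> \<le> r / 2"
      using d(2) N by (intro modulus_le less_imp_le) (auto simp: dist_norm)
    then show ?thesis using r modulus_nonneg[of n \<omega>] by simp
  qed
  then show "\<exists>N. \<forall>n\<ge>N. norm (modulus n \<omega> - 0) < r" by blast
qed

lemma modulus_sq_le: "norm ((modulus n \<omega>)\<^sup>2) \<le> (2 * C)\<^sup>2"
  using power_mono[OF modulus_bound modulus_nonneg, of n \<omega> 2] by simp

lemma modulus_sq_integrable: "integrable M (\<lambda>\<omega>. (modulus n \<omega>)\<^sup>2)"
  by (rule integrable_const_bound[OF AE_I2[OF modulus_sq_le]]) measurable

text \<open>Dominated convergence with the bound 2 C. No rate comes with it, so the estimate of a
  single Euler step has to carry a full factor 1/n besides the modulus.\<close>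

lemma modulus_sq_tendsto: "(\<lambda>n. \<integral>\<omega>. (modulus n \<omega>)\<^sup>2 \<partial>M) \<longlonglongrightarrow> 0"
proof -
  have "(\<lambda>n. \<integral>\<omega>. (modulus n \<omega>)\<^sup>2 \<partial>M) \<longlonglongrightarrow> (\<integral>\<omega>. 0 \<partial>M)"
  proof (rule integral_dominated_convergence[where w="\<lambda>_. (2 * C)\<^sup>2"])
    show "AE \<omega> in M. (\<lambda>n. (modulus n \<omega>)\<^sup>2) \<longlonglongrightarrow> 0"
      using tendsto_power[OF modulus_tendsto, of _ 2] by (intro AE_I2) simp
  qed (rule AE_I2[OF modulus_sq_le] | simp)+
  then show ?thesis by simp
qed

text \<open>Each step of length 1/n is cut into \<open>Suc p\<close> equal parts. The time i/n is
  then the grid point of index \<open>i * Suc p\<close> for every \<open>p\<close>, so all fine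
  grids contain the coarse one.\<close>

lemma euler_simple_process:
  assumes n: "0 < n"
  shows "simple_process M F (real i / real n) (i * Suc p) (\<lambda>j. real j / real (n * Suc p))
    (\<lambda>j \<omega>. \<sigma> (X (real j / real (n * Suc p)) \<omega>))"
  unfolding simple_process_def
proof (intro conjI allI impI)
  show "real (i * Suc p) / real (n * Suc p) = real i / real n"
    unfolding of_nat_mult by (rule mult_divide_mult_cancel_right) simp
  show "bounded ((\<lambda>\<omega>. \<sigma> (X (real j / real (n * Suc p)) \<omega>)) ` space M)" for j
    using bound_\<sigma> by (auto simp: bounded_iff)
qed (auto intro!: \<sigma>_measurable_F divide_right_mono)

lemma euler_tendsto_path:
  assumes n: "0 < n" and \<omega>: "\<omega> \<in> space M"
  shows "(\<lambda>p. \<integral>\<^sup>+ s\<in>{0..real i / real n}. ennreal ((norm (simple_value (i * Suc p) (\<lambda>j. real j / real (n * Suc p))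
    (\<lambda>j \<omega>. \<sigma> (X (real j / real (n * Suc p)) \<omega>)) s \<omega> - \<sigma> (X s \<omega>)))\<^sup>2) \<partial>lborel) \<longlonglongrightarrow> 0"
    (is "?Q \<longlonglongrightarrow> 0")
proof -
  define t where "t = real i / real n"
  have t: "0 \<le> t" by (simp add: t_def)
  have bnd: "eventually (\<lambda>p. ?Q p \<le> ennreal (e\<^sup>2 * t)) sequentially" if e: "0 < e" for e
  proof -
    have "uniformly_continuous_on {0..t} (\<lambda>t. \<sigma> (X t \<omega>))"
      by (intro compact_uniformly_continuous continuous_on_subset[OF \<sigma>_path[OF \<omega>]]) auto
    then obtain d where d: "0 < d" "\<And>u v. u \<in> {0..t} \<Longrightarrow> v \<in> {0..t} \<Longrightarrow> dist u v < d \<Longrightarrow>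
        dist (\<sigma> (X u \<omega>)) (\<sigma> (X v \<omega>)) < e"
      using e unfolding uniformly_continuous_on_def by meson
    obtain N where N: "1 / real (Suc N) < d" using nat_approx_posE[OF d(1)] by metis
    have "?Q p \<le> ennreal (e\<^sup>2 * t)" if p: "p \<ge> N" for p
    proof -
      define h where "h = 1 / real (n * Suc p)"
      have h: "0 < h" "h < d"
      proof -
        have "0 < n * Suc p" using n by simp
        then show "0 < h" unfolding h_def by (metis of_nat_0_less_iff zero_less_divide_1_iff)
        have "real (Suc N) \<le> real (Suc p)" using p by simp
        also have "\<dots> \<le> real (n * Suc p)" using n by (cases n) auto
        finally have "h \<le> 1 / real (Suc N)" unfolding h_def by (intro divide_left_mono) (use n in auto)
        with N show "h < d" by simp
      qed
      have th: "t = real (i * Suc p) * h"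
        unfolding t_def h_def of_nat_mult using n
        by (simp only: times_divide_eq_right mult_1_right) (rule mult_divide_mult_cancel_right[symmetric], simp)
      let ?v = "simple_value (i * Suc p) (\<lambda>j. real j / real (n * Suc p))
         (\<lambda>j \<omega>. \<sigma> (X (real j / real (n * Suc p)) \<omega>))"
      have *: "norm (?v s \<omega> - \<sigma> (X s \<omega>)) \<le> e" if s: "0 < s" "s \<le> t" for s
      proof -
        \<comment> \<open>Index of the left-open interval (j h, (j + 1) h] that contains
          \<open>s\<close>.\<close>
        define j where "j = nat (\<lceil>s / h\<rceil> - 1)"
        have pos: "0 < s / h" using s h by simp
        then have "1 \<le> \<lceil>s / h\<rceil>" by linarith
        then have j: "real j = of_int \<lceil>s / h\<rceil> - 1" by (simp add: j_def)
        have "real j < s / h" "s / h \<le> real j + 1" unfolding j by linarith+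
        then have js: "real j * h < s" "s \<le> (real j + 1) * h"
          using h by (simp_all add: pos_less_divide_eq pos_divide_le_eq)
        have "real j * h < real (i * Suc p) * h" using js s th by linarith
        then have jk: "j < i * Suc p" by (simp only: mult_less_cancel_right_pos[OF h(1)] of_nat_less_iff)
        have "?v s \<omega> = \<sigma> (X (real j / real (n * Suc p)) \<omega>)"
          by (rule simple_value_eq(1)[OF euler_simple_process[OF n] jk])
            (use js in \<open>simp add: h_def add.commute del: of_nat_mult\<close>)
        also have "real j / real (n * Suc p) = real j * h" by (simp add: h_def)
        finally have v: "?v s \<omega> = \<sigma> (X (real j * h) \<omega>)" .
        have "dist (real j * h) s < d" using js h by (simp add: dist_real_def algebra_simps)
        then have "dist (\<sigma> (X (real j * h) \<omega>)) (\<sigma> (X s \<omega>)) < e"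
          using js s h by (intro d(2)) auto
        then show ?thesis unfolding v by (simp add: dist_norm)
      qed
      have "?Q p \<le> (\<integral>\<^sup>+ s. ennreal (e\<^sup>2) * indicator {0..t} s \<partial>lborel)"
      proof (rule nn_integral_mono_AE)
        \<comment> \<open>Time 0 belongs to none of the left-open intervals, so the simple process
          vanishes there; a single point is a null set.\<close>
        have "AE s in lborel. s \<noteq> (0::real)" by (rule AE_lborel_singleton)
        then show "AE s in lborel. ennreal ((norm (?v s \<omega> - \<sigma> (X s \<omega>)))\<^sup>2) * indicator {0..real i / real n} s
          \<le> ennreal (e\<^sup>2) * indicator {0..t} s"
        proof eventually_elim
          case (elim s)
          show ?case
          proof (cases "s \<in> {0..t}")
            case True
            with elim * have "norm (?v s \<omega> - \<sigma> (X s \<omega>)) \<le> e" by auto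
            then show ?thesis using True by (auto simp: t_def intro!: ennreal_leI power_mono)
          qed (simp add: t_def)
        qed
      qed
      also have "\<dots> = ennreal (e\<^sup>2 * t)"
        using t by (simp add: nn_integral_cmult_indicator ennreal_mult)
      finally show ?thesis .
    qed
    then show ?thesis unfolding eventually_sequentially by blast
  qed
  show ?thesis
  proof (rule order_tendstoI)
    fix a :: ennreal assume "0 < a"
    then obtain b where b: "0 < b" "b < a" using dense by blast
    obtain r where r: "b = ennreal r" "0 < r"
      using b by (cases b) (auto simp: ennreal_less_zero_iff)
    \<comment> \<open>With e^2 = r / (t + 1) the bound e^2 t stays below \<open>r\<close>, and
      \<open>e\<close> is well defined even when \<open>t = 0\<close>.\<close>
    have "eventually (\<lambda>p. ?Q p \<le> ennreal ((sqrt (r / (t + 1)))\<^sup>2 * t)) sequentially"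
      by (rule bnd) (use r t in simp)
    moreover have "ennreal ((sqrt (r / (t + 1)))\<^sup>2 * t) \<le> b"
      unfolding r(1) using r(2) t by (intro ennreal_leI) (simp add: field_simps)
    ultimately show "eventually (\<lambda>p. ?Q p < a) sequentially"
      using b(2) by (auto elim!: eventually_mono)
  qed simp
qed

lemma euler_tendsto_in_prob:
  assumes n: "0 < n" and e: "0 < e"
  shows "(\<lambda>p. prob {\<omega>\<in>space M. e < norm (simple_integral B (i * Suc p) (\<lambda>j. real j / real (n * Suc p))
    (\<lambda>j \<omega>. \<sigma> (X (real j / real (n * Suc p)) \<omega>)) \<omega> - mart (real i / real n) \<omega>)}) \<longlonglongrightarrow> 0"
  by (rule ito_integral_tendsto_in_prob[OF ito _ euler_simple_process[OF n] euler_tendsto_path[OF n] e]) auto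

section \<open>The error of freezing the diffusion coefficient over one step\<close>

definition euler_remainder :: "nat \<Rightarrow> nat \<Rightarrow> 'w \<Rightarrow> real^'n" where
  "euler_remainder n i \<omega> = mart (real (Suc i) / real n) \<omega> - mart (real i / real n) \<omega>
     - \<sigma> (X (real i / real n) \<omega>) *v (B (real (Suc i) / real n) \<omega> - B (real i / real n) \<omega>)"

text \<open>An approximation of \<open>euler_remainder n i\<close> by a single simple integral
  started at time 0. Its coefficients vanish before i/n, so the isometry and the orthogonality of
  simple integrals apply to it directly.\<close>

definition fine_remainder :: "nat \<Rightarrow> nat \<Rightarrow> nat \<Rightarrow> 'w \<Rightarrow> real^'n" where
  "fine_remainder n i p \<omega> = simple_integral B (Suc i * Suc p) (\<lambda>j. real j / real (n * Suc p))
     (\<lambda>j \<omega>. if j < i * Suc p then 0 else \<sigma> (X (real j / real (n * Suc p)) \<omega>) - \<sigma> (X (real i / real n) \<omega>)) \<omega>"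

lemma grid_le:
  assumes "i * Suc p \<le> j" shows "real i / real n \<le> real j / real (n * Suc p)"
proof -
  have "real i / real n = real (i * Suc p) / real (n * Suc p)"
    unfolding of_nat_mult by (rule mult_divide_mult_cancel_right[symmetric]) simp
  also have "\<dots> \<le> real j / real (n * Suc p)"
    using assms by (intro divide_right_mono) (simp_all only: of_nat_le_iff of_nat_0_le_iff)
  finally show ?thesis .
qed

lemma fine_simple_process:
  assumes n: "0 < n"
  shows "simple_process M F (real (Suc i) / real n) (Suc i * Suc p) (\<lambda>j. real j / real (n * Suc p))
    (\<lambda>j \<omega>. if j < i * Suc p then 0 else \<sigma> (X (real j / real (n * Suc p)) \<omega>) - \<sigma> (X (real i / real n) \<omega>))"
proof -
  have "(\<lambda>\<omega>. if j < i * Suc p then 0 else \<sigma> (X (real j / real (n * Suc p)) \<omega>) - \<sigma> (X (real i / real n) \<omega>))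
      \<in> borel_measurable (F (real j / real (n * Suc p)))" for j
    using \<sigma>_measurable_F[of "real j / real (n * Suc p)" "real j / real (n * Suc p)"]
      \<sigma>_measurable_F[OF _ grid_le[of i p j n]] by (cases "j < i * Suc p") auto
  moreover have "bounded ((\<lambda>\<omega>. if j < i * Suc p then 0 else \<sigma> (X (real j / real (n * Suc p)) \<omega>) - \<sigma> (X (real i / real n) \<omega>)) ` space M)" for j
    using \<sigma>_diff_le C_nonneg by (auto simp: bounded_iff intro!: exI[of _ "2 * C"])
  ultimately show ?thesis
    using euler_simple_process[OF n, of "Suc i" p] unfolding simple_process_def by blast
qed

lemma fine_remainder_eq:
  assumes n: "0 < n"
  shows "fine_remainder n i p \<omega> =
    simple_integral B (Suc i * Suc p) (\<lambda>j. real j / real (n * Suc p)) (\<lambda>j \<omega>. \<sigma> (X (real j / real (n * Suc p)) \<omega>)) \<omega>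
    - simple_integral B (i * Suc p) (\<lambda>j. real j / real (n * Suc p)) (\<lambda>j \<omega>. \<sigma> (X (real j / real (n * Suc p)) \<omega>)) \<omega>
    - \<sigma> (X (real i / real n) \<omega>) *v (B (real (Suc i) / real n) \<omega> - B (real i / real n) \<omega>)"
proof -
  let ?t = "\<lambda>j. real j / real (n * Suc p)"
  let ?D = "\<lambda>j. B (?t (Suc j)) \<omega> - B (?t j) \<omega>"
  let ?K = "i * Suc p" and ?L = "Suc i * Suc p"
  have KL: "?K \<le> ?L" by simp
  have split: "(\<Sum>j<?L. f j) = (\<Sum>j<?K. f j) + (\<Sum>j=?K..<?L. f j)" for f :: "nat \<Rightarrow> real^'n"
    using sum.atLeastLessThan_concat[of 0 ?K ?L f] KL by (simp add: lessThan_atLeast0 del: mult_Suc mult_Suc_right)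
  have end1: "?t ?L = real (Suc i) / real n" and end2: "?t ?K = real i / real n"
    unfolding of_nat_mult by (rule mult_divide_mult_cancel_right, simp)+
  have "(\<Sum>j=?K..<?L. ?D j) = B (?t ?L) \<omega> - B (?t ?K) \<omega>"
    by (rule sum_Suc_diff'[OF KL])
  then have tel: "(\<Sum>j=?K..<?L. ?D j) = B (real (Suc i) / real n) \<omega> - B (real i / real n) \<omega>"
    unfolding end1 end2 .
  have "fine_remainder n i p \<omega> = (\<Sum>j=?K..<?L. (\<sigma> (X (?t j) \<omega>) - \<sigma> (X (real i / real n) \<omega>)) *v ?D j)"
    unfolding fine_remainder_def simple_integral_def split
    by (simp del: mult_Suc mult_Suc_right of_nat_Suc of_nat_mult)
  also have "\<dots> = (\<Sum>j=?K..<?L. \<sigma> (X (?t j) \<omega>) *v ?D j) - \<sigma> (X (real i / real n) \<omega>) *v (\<Sum>j=?K..<?L. ?D j)"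
    unfolding matrix_vector_mult_sum_right by (simp only: matrix_vector_mult_diff_rdistrib sum_subtractf)
  also have "\<dots> = (\<Sum>j<?L. \<sigma> (X (?t j) \<omega>) *v ?D j) - (\<Sum>j<?K. \<sigma> (X (?t j) \<omega>) *v ?D j)
    - \<sigma> (X (real i / real n) \<omega>) *v (B (real (Suc i) / real n) \<omega> - B (real i / real n) \<omega>)"
    unfolding tel split by simp
  finally show ?thesis unfolding simple_integral_def .
qed

lemma euler_remainder_measurable [measurable]: "euler_remainder n i \<in> borel_measurable M"
proof -
  have [measurable]: "(\<lambda>\<omega>. \<sigma> (X (real i / real n) \<omega>)) \<in> borel_measurable M"
    using \<sigma>_measurable_F[of "real i / real n" "real i / real n"] measurable_F_M by simp
  have [measurable]: "B (real (Suc i) / real n) \<in> borel_measurable M" "B (real i / real n) \<in> borel_measurable M"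
    "mart (real (Suc i) / real n) \<in> borel_measurable M" "mart (real i / real n) \<in> borel_measurable M"
    by (intro B_measurable mart_measurable, simp)+
  show ?thesis unfolding euler_remainder_def[abs_def] by measurable
qed

lemma fine_remainder_measurable [measurable]: "0 < n \<Longrightarrow> fine_remainder n i p \<in> borel_measurable M"
  unfolding fine_remainder_def[abs_def] by (rule simple_integral_measurable[OF fine_simple_process])

lemma fine_remainder_tendsto:
  assumes n: "0 < n" and e: "0 < e"
  shows "(\<lambda>p. prob {\<omega>\<in>space M. e < norm (fine_remainder n i p \<omega> - euler_remainder n i \<omega>)}) \<longlonglongrightarrow> 0"
proof -
  define I where "I i p = simple_integral B (i * Suc p) (\<lambda>j. real j / real (n * Suc p)) (\<lambda>j \<omega>. \<sigma> (X (real j / real (n * Suc p)) \<omega>))" for i p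
  have [measurable]: "I i p \<in> borel_measurable M" for i p
    unfolding I_def by (rule simple_integral_measurable[OF euler_simple_process[OF n]])
  have [measurable]: "mart (real i / real n) \<in> borel_measurable M" for i by (rule mart_measurable) simp
  have c: "(\<lambda>p. prob {\<omega>\<in>space M. e/2 < norm (I i p \<omega> - mart (real i / real n) \<omega>)}) \<longlonglongrightarrow> 0" for i
    unfolding I_def by (rule euler_tendsto_in_prob[OF n]) (use e in simp)
  have le: "prob {\<omega>\<in>space M. e < norm (fine_remainder n i p \<omega> - euler_remainder n i \<omega>)} \<le>
    prob {\<omega>\<in>space M. e/2 < norm (I (Suc i) p \<omega> - mart (real (Suc i) / real n) \<omega>)} +
    prob {\<omega>\<in>space M. e/2 < norm (I i p \<omega> - mart (real i / real n) \<omega>)}" for p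
  proof -
    have "prob {\<omega>\<in>space M. e < norm (fine_remainder n i p \<omega> - euler_remainder n i \<omega>)} \<le>
      prob ({\<omega>\<in>space M. e/2 < norm (I (Suc i) p \<omega> - mart (real (Suc i) / real n) \<omega>)} \<union>
        {\<omega>\<in>space M. e/2 < norm (I i p \<omega> - mart (real i / real n) \<omega>)})"
    proof (intro finite_measure_mono subsetI)
      fix \<omega> assume \<omega>: "\<omega> \<in> {\<omega>\<in>space M. e < norm (fine_remainder n i p \<omega> - euler_remainder n i \<omega>)}"
      have "fine_remainder n i p \<omega> - euler_remainder n i \<omega> =
        (I (Suc i) p \<omega> - mart (real (Suc i) / real n) \<omega>) - (I i p \<omega> - mart (real i / real n) \<omega>)"
        unfolding fine_remainder_eq[OF n] euler_remainder_def I_def by simp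
      then have "norm (fine_remainder n i p \<omega> - euler_remainder n i \<omega>) \<le>
        norm (I (Suc i) p \<omega> - mart (real (Suc i) / real n) \<omega>) + norm (I i p \<omega> - mart (real i / real n) \<omega>)"
        by (simp only: norm_triangle_ineq4)
      with \<omega> show "\<omega> \<in> {\<omega>\<in>space M. e/2 < norm (I (Suc i) p \<omega> - mart (real (Suc i) / real n) \<omega>)} \<union>
        {\<omega>\<in>space M. e/2 < norm (I i p \<omega> - mart (real i / real n) \<omega>)}"
        by (auto simp del: of_nat_Suc)
    qed measurable
    also have "\<dots> \<le> prob {\<omega>\<in>space M. e/2 < norm (I (Suc i) p \<omega> - mart (real (Suc i) / real n) \<omega>)} +
      prob {\<omega>\<in>space M. e/2 < norm (I i p \<omega> - mart (real i / real n) \<omega>)}"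
      by (rule measure_Un_le) measurable
    finally show ?thesis .
  qed
  show ?thesis
    by (rule tendsto_sandwich[OF _ _ tendsto_const tendsto_add_zero[OF c[of "Suc i"] c[of i]]])
      (rule always_eventually, rule allI, (rule measure_nonneg | rule le))+
qed

text \<open>Only the \<open>Suc p\<close> coefficients of the last coarse step can be nonzero. Each
  is bounded by \<open>modulus n\<close>, and their intervals have total length 1/n. The bound is
  free of \<open>p\<close> and so survives the limit.\<close>

lemma fine_remainder_sq:
  assumes n: "0 < n" "i < n"
  shows "integrable M (\<lambda>\<omega>. (norm (fine_remainder n i p \<omega>))\<^sup>2)"
    and "(\<integral>\<omega>. (norm (fine_remainder n i p \<omega>))\<^sup>2 \<partial>M) \<le> (\<integral>\<omega>. (modulus n \<omega>)\<^sup>2 \<partial>M) / real n"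
proof -
  let ?t = "\<lambda>j. real j / real (n * Suc p)"
  let ?Y = "\<lambda>j \<omega>. if j < i * Suc p then 0 else \<sigma> (X (?t j) \<omega>) - \<sigma> (X (real i / real n) \<omega>)"
  let ?W = "\<integral>\<omega>. (modulus n \<omega>)\<^sup>2 \<partial>M"
  note iso = simple_integral_isometry[OF fine_simple_process[OF n(1), of i p], folded fine_remainder_def[of n i p, abs_def]]
  show "integrable M (\<lambda>\<omega>. (norm (fine_remainder n i p \<omega>))\<^sup>2)"
    using iso unfolding fine_remainder_def by blast
  have W: "0 \<le> ?W" by simp
  have np: "0 < real (n * Suc p)" using n by (simp only: of_nat_0_less_iff) simp
  have Y: "(\<integral>\<omega>. (norm (?Y j \<omega>))\<^sup>2 \<partial>M) \<le> (if j < i * Suc p then 0 else ?W)" if j: "j < Suc i * Suc p" for j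
  proof (cases "j < i * Suc p")
    case False
    have "?t j - real i / real n \<le> 1 / real n"
    proof -
      have "?t j \<le> real (Suc i * Suc p) / real (n * Suc p)"
        using j by (intro divide_right_mono) (simp_all only: of_nat_le_iff of_nat_0_le_iff less_imp_le)
      also have "\<dots> = real (Suc i) / real n"
        unfolding of_nat_mult by (rule mult_divide_mult_cancel_right) simp
      finally show ?thesis by (simp add: add_divide_distrib)
    qed
    moreover have "?t j \<le> 1"
    proof -
      have "Suc i * Suc p \<le> n * Suc p" using n by (intro mult_right_mono) auto
      with j have "j \<le> n * Suc p" by linarith
      then show ?thesis using np by (simp only: divide_le_eq_1 of_nat_le_iff) simp
    qed
    moreover have "real i / real n \<le> ?t j" using False by (intro grid_le) simp
    \<comment> \<open>Rationality admits this pair of times to the supremum that defines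
      \<open>modulus\<close>.\<close>
    moreover have "?t j \<in> \<rat>" "real i / real n \<in> \<rat>" by (intro Rats_divide Rats_of_nat)+
    moreover have "0 \<le> ?t j" "0 \<le> real i / real n" by simp_all
    moreover have "real i / real n \<le> 1" using n by simp
    ultimately have le: "norm (?Y j \<omega>) \<le> modulus n \<omega>" for \<omega>
      using False modulus_upper[of "?t j" "real i / real n" n \<omega>] by (simp only: if_False)
    have "(\<integral>\<omega>. (norm (?Y j \<omega>))\<^sup>2 \<partial>M) \<le> ?W"
      by (rule integral_mono') (use modulus_sq_integrable le in \<open>auto intro!: power_mono\<close>)
    then show ?thesis using False by simp
  qed simp
  have "(\<integral>\<omega>. (norm (fine_remainder n i p \<omega>))\<^sup>2 \<partial>M) =
      (\<Sum>j<Suc i * Suc p. (?t (Suc j) - ?t j) * (\<integral>\<omega>. (norm (?Y j \<omega>))\<^sup>2 \<partial>M))"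
    using iso unfolding fine_remainder_def by blast
  also have "\<dots> \<le> (\<Sum>j<Suc i * Suc p. (1 / real (n * Suc p)) * (if j < i * Suc p then 0 else ?W))"
  proof (intro sum_mono mult_mono)
    fix j assume "j \<in> {..<Suc i * Suc p}"
    then show "(\<integral>\<omega>. (norm (?Y j \<omega>))\<^sup>2 \<partial>M) \<le> (if j < i * Suc p then 0 else ?W)" by (intro Y) simp
    show "?t (Suc j) - ?t j \<le> 1 / real (n * Suc p)" by (simp only: diff_divide_distrib[symmetric]) simp
  qed simp_all
  also have "\<dots> = (1 / real (n * Suc p)) * (\<Sum>j<Suc i * Suc p. if j < i * Suc p then 0 else ?W)"
    by (rule sum_distrib_left[symmetric])
  also have "(\<Sum>j<Suc i * Suc p. if j < i * Suc p then 0 else ?W) = real (Suc p) * ?W"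
  proof -
    have "(\<Sum>j<Suc i * Suc p. if j < i * Suc p then 0 else ?W) = (\<Sum>j\<in>{i * Suc p..<Suc i * Suc p}. ?W)"
      by (rule sum.mono_neutral_cong_right) auto
    then show ?thesis by simp
  qed
  also have "(1 / real (n * Suc p)) * (real (Suc p) * ?W) = ?W / real n"
    unfolding of_nat_mult using n by (simp add: field_simps del: of_nat_Suc)
  finally show "(\<integral>\<omega>. (norm (fine_remainder n i p \<omega>))\<^sup>2 \<partial>M) \<le> ?W / real n" .
qed

lemma euler_remainder_sq:
  assumes n: "0 < n" "i < n"
  shows "integrable M (\<lambda>\<omega>. (norm (euler_remainder n i \<omega>))\<^sup>2)"
    and "(\<integral>\<omega>. (norm (euler_remainder n i \<omega>))\<^sup>2 \<partial>M) \<le> (\<integral>\<omega>. (modulus n \<omega>)\<^sup>2 \<partial>M) / real n"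
proof -
  have conv: "(\<lambda>p. prob {\<omega>\<in>space M. e < \<bar>norm (fine_remainder n i p \<omega>) - norm (euler_remainder n i \<omega>)\<bar>}) \<longlonglongrightarrow> 0"
    if e: "0 < e" for e
  proof (rule tendsto_sandwich[OF _ _ tendsto_const fine_remainder_tendsto[OF n(1) e, of i]])
    show "\<forall>\<^sub>F p in sequentially. prob {\<omega>\<in>space M. e < \<bar>norm (fine_remainder n i p \<omega>) - norm (euler_remainder n i \<omega>)\<bar>}
      \<le> prob {\<omega>\<in>space M. e < norm (fine_remainder n i p \<omega> - euler_remainder n i \<omega>)}"
      using n by (intro always_eventually allI finite_measure_mono)
        (auto intro: less_le_trans[OF _ norm_triangle_ineq3])
  qed simp
  note * = second_moment_le_of_tendsto_in_prob[OF _ _ conv fine_remainder_sq[OF n]]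
  show "integrable M (\<lambda>\<omega>. (norm (euler_remainder n i \<omega>))\<^sup>2)"
    "(\<integral>\<omega>. (norm (euler_remainder n i \<omega>))\<^sup>2 \<partial>M) \<le> (\<integral>\<omega>. (modulus n \<omega>)\<^sup>2 \<partial>M) / real n"
    by (rule *; use n in measurable)+
qed

text \<open>This serves as the martingale property of \<open>mart\<close> on one step. The fine
  approximations have mean zero against \<open>\<zeta>\<close>, since every substep with a nonzero
  coefficient starts at i/n or later, when \<open>\<zeta>\<close> is known; bounded second moments
  carry this to the limit.\<close>

lemma euler_remainder_orthogonal:
  assumes n: "0 < n" "i < n"
    and \<zeta>: "\<zeta> \<in> borel_measurable (F (real i / real n))" "\<And>\<omega>. \<omega> \<in> space M \<Longrightarrow> norm (\<zeta> \<omega>) \<le> c"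
  shows "integrable M (\<lambda>\<omega>. \<zeta> \<omega> \<bullet> euler_remainder n i \<omega>)"
    and "(\<integral>\<omega>. \<zeta> \<omega> \<bullet> euler_remainder n i \<omega> \<partial>M) = 0"
proof -
  \<comment> \<open>Strictly positive, so that the threshold can be rescaled to
    \<open>e / c'\<close>.\<close>
  define c' where "c' = \<bar>c\<bar> + 1"
  have c': "norm (\<zeta> \<omega>) \<le> c'" if "\<omega> \<in> space M" for \<omega>
    using \<zeta>(2)[OF that] by (auto simp: c'_def)
  have c'pos: "0 < c'" by (simp add: c'_def)
  have [measurable]: "\<zeta> \<in> borel_measurable M" by (rule measurable_F_M[OF \<zeta>(1)])
  note fm = fine_remainder_measurable[OF n(1), measurable]
  let ?S = "\<lambda>p \<omega>. \<zeta> \<omega> \<bullet> fine_remainder n i p \<omega>"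
  have conv: "(\<lambda>p. prob {\<omega>\<in>space M. e < \<bar>?S p \<omega> - \<zeta> \<omega> \<bullet> euler_remainder n i \<omega>\<bar>}) \<longlonglongrightarrow> 0"
    if e: "0 < e" for e
  proof (rule tendsto_sandwich[OF _ _ tendsto_const fine_remainder_tendsto[OF n(1), of "e / c'" i]])
    show "\<forall>\<^sub>F p in sequentially. prob {\<omega>\<in>space M. e < \<bar>?S p \<omega> - \<zeta> \<omega> \<bullet> euler_remainder n i \<omega>\<bar>}
      \<le> prob {\<omega>\<in>space M. e / c' < norm (fine_remainder n i p \<omega> - euler_remainder n i \<omega>)}"
    proof (intro always_eventually allI finite_measure_mono subsetI)
      fix p \<omega> assume \<omega>: "\<omega> \<in> {\<omega>\<in>space M. e < \<bar>?S p \<omega> - \<zeta> \<omega> \<bullet> euler_remainder n i \<omega>\<bar>}"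
      let ?d = "fine_remainder n i p \<omega> - euler_remainder n i \<omega>"
      have "\<bar>?S p \<omega> - \<zeta> \<omega> \<bullet> euler_remainder n i \<omega>\<bar> = \<bar>\<zeta> \<omega> \<bullet> ?d\<bar>" by (simp add: inner_diff_right)
      also have "\<dots> \<le> norm (\<zeta> \<omega>) * norm ?d" by (rule Cauchy_Schwarz_ineq2)
      also have "\<dots> \<le> c' * norm ?d" using c' \<omega> by (intro mult_right_mono) auto
      finally have "e < c' * norm ?d" using \<omega> by auto
      then show "\<omega> \<in> {\<omega>\<in>space M. e / c' < norm (fine_remainder n i p \<omega> - euler_remainder n i \<omega>)}"
        using \<omega> c'pos by (simp add: pos_divide_less_eq mult.commute)
    qed measurable
  qed (use e c'pos in auto)
  have sq: "(?S p \<omega>)\<^sup>2 \<le> c'\<^sup>2 * (norm (fine_remainder n i p \<omega>))\<^sup>2" if "\<omega> \<in> space M" for p \<omega>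
  proof -
    have "\<bar>?S p \<omega>\<bar> \<le> c' * norm (fine_remainder n i p \<omega>)"
      using Cauchy_Schwarz_ineq2[of "\<zeta> \<omega>" "fine_remainder n i p \<omega>"] c'[OF that]
      by (meson mult_right_mono norm_ge_zero order_trans)
    then have "\<bar>?S p \<omega>\<bar>\<^sup>2 \<le> (c' * norm (fine_remainder n i p \<omega>))\<^sup>2" by (intro power_mono) auto
    then show ?thesis by (simp add: power_mult_distrib)
  qed
  have intS: "integrable M (\<lambda>\<omega>. (?S p \<omega>)\<^sup>2)" for p
    by (rule Bochner_Integration.integrable_bound[OF integrable_mult_right[OF fine_remainder_sq(1)[OF n], of "c'\<^sup>2" p]])
      (use sq in auto)
  have le: "(\<integral>\<omega>. (?S p \<omega>)\<^sup>2 \<partial>M) \<le> c'\<^sup>2 * ((\<integral>\<omega>. (modulus n \<omega>)\<^sup>2 \<partial>M) / real n)" for p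
  proof -
    have "(\<integral>\<omega>. (?S p \<omega>)\<^sup>2 \<partial>M) \<le> (\<integral>\<omega>. c'\<^sup>2 * (norm (fine_remainder n i p \<omega>))\<^sup>2 \<partial>M)"
      by (rule integral_mono) (use intS fine_remainder_sq(1)[OF n] sq in auto)
    also have "\<dots> \<le> c'\<^sup>2 * ((\<integral>\<omega>. (modulus n \<omega>)\<^sup>2 \<partial>M) / real n)"
      unfolding integral_mult_right_zero by (rule mult_left_mono[OF fine_remainder_sq(2)[OF n]]) simp
    finally show ?thesis .
  qed
  have zero: "(\<integral>\<omega>. ?S p \<omega> \<partial>M) = 0" for p
  proof -
    let ?t = "\<lambda>j. real j / real (n * Suc p)"
    let ?Y = "\<lambda>j \<omega>. if j < i * Suc p then 0 else \<sigma> (X (?t j) \<omega>) - \<sigma> (X (real i / real n) \<omega>)"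
    note sp = simple_processD[OF fine_simple_process[OF n(1), of i p]]
    have i2: "integrable M (\<lambda>\<omega>. (norm (\<zeta> \<omega>))\<^sup>2)"
      by (rule integrable_const_bound[where B="c'\<^sup>2"]) (use c' in \<open>auto intro!: AE_I2 power_mono\<close>)
    have o: "integrable M (\<lambda>\<omega>. \<zeta> \<omega> \<bullet> (?Y j \<omega> *v (B (?t (Suc j)) \<omega> - B (?t j) \<omega>))) \<and>
      (\<integral>\<omega>. \<zeta> \<omega> \<bullet> (?Y j \<omega> *v (B (?t (Suc j)) \<omega> - B (?t j) \<omega>)) \<partial>M) = 0" if j: "j < Suc i * Suc p" for j
    proof (cases "j < i * Suc p")
      case False
      have z: "\<zeta> \<in> borel_measurable (F (?t j))"
        by (rule measurable_F_mono[OF grid_le \<zeta>(1)]) (use False in simp)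
      have "0 \<le> ?t j" "?t j \<le> ?t (Suc j)" using sp(2)[of j] sp(1)[of j "Suc j"] j by auto
      from step_orthogonal[OF this sp(4)[OF j] sp(5)[OF j] z i2] show ?thesis by blast
    qed simp
    have "?S p = (\<lambda>\<omega>. \<Sum>j<Suc i * Suc p. \<zeta> \<omega> \<bullet> (?Y j \<omega> *v (B (?t (Suc j)) \<omega> - B (?t j) \<omega>)))"
      unfolding fine_remainder_def simple_integral_def inner_sum_right ..
    moreover have "(\<integral>\<omega>. (\<Sum>j<Suc i * Suc p. \<zeta> \<omega> \<bullet> (?Y j \<omega> *v (B (?t (Suc j)) \<omega> - B (?t j) \<omega>))) \<partial>M) =
      (\<Sum>j<Suc i * Suc p. \<integral>\<omega>. \<zeta> \<omega> \<bullet> (?Y j \<omega> *v (B (?t (Suc j)) \<omega> - B (?t j) \<omega>)) \<partial>M)"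
      by (rule Bochner_Integration.integral_sum) (use o in blast)
    moreover have "\<dots> = 0" by (rule sum.neutral) (use o in blast)
    ultimately show ?thesis by simp
  qed
  note * = integral_zero_of_tendsto_in_prob[OF _ _ conv intS le zero]
  show "integrable M (\<lambda>\<omega>. \<zeta> \<omega> \<bullet> euler_remainder n i \<omega>)" "(\<integral>\<omega>. \<zeta> \<omega> \<bullet> euler_remainder n i \<omega> \<partial>M) = 0"
    by (rule *; measurable)+
qed

end

section \<open>An Ito inequality for bounded functions\<close>

lemma bounded_on_cball:
  fixes u :: "'a::{heine_borel, real_normed_vector} \<Rightarrow> 'b::real_normed_vector"
  assumes "continuous_on UNIV u"
  obtains c where "0 \<le> c" "\<And>y. norm y \<le> R \<Longrightarrow> norm (u y) \<le> c"
proof -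
  have "compact (u ` cball 0 R)"
    by (intro compact_continuous_image continuous_on_subset[OF assms]) auto
  then obtain c where "\<And>y. y \<in> cball 0 R \<Longrightarrow> norm (u y) \<le> c"
    using compact_imp_bounded by (force simp: bounded_iff)
  then show ?thesis using that[of "max 0 c"] by (force simp: dist_norm)
qed

text \<open>The norm is at most the sum of the absolute coordinates, hence at most the dimension
  times the largest of them; the cube of that one is a single summand on the right.\<close>

lemma norm_cube_le: "norm (v :: real^'n::finite) ^ 3 \<le> real CARD('n) ^ 3 * (\<Sum>i\<in>UNIV. \<bar>v $ i\<bar> ^ 3)"
proof -
  have "Max (range (\<lambda>i. \<bar>v $ i\<bar>)) \<in> range (\<lambda>i. \<bar>v $ i\<bar>)" by (rule Max_in) auto
  then obtain i where i: "\<bar>v $ i\<bar> = Max (range (\<lambda>i. \<bar>v $ i\<bar>))" by (rule rangeE) (rule that, rule sym)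
  have "norm v \<le> (\<Sum>j\<in>UNIV. \<bar>v $ j\<bar>)" by (rule norm_le_l1_cart)
  also have "\<dots> \<le> (\<Sum>j\<in>(UNIV::'n set). \<bar>v $ i\<bar>)" unfolding i by (intro sum_mono Max_ge) auto
  finally have "norm v \<le> real CARD('n) * \<bar>v $ i\<bar>" by simp
  then have "norm v ^ 3 \<le> (real CARD('n) * \<bar>v $ i\<bar>) ^ 3" by (rule power_mono) simp
  also have "\<dots> = real CARD('n) ^ 3 * \<bar>v $ i\<bar> ^ 3" by (rule power_mult_distrib)
  also have "\<dots> \<le> real CARD('n) ^ 3 * (\<Sum>i\<in>UNIV. \<bar>v $ i\<bar> ^ 3)"
    by (intro mult_left_mono member_le_sum) auto
  finally show ?thesis .
qed

text \<open>The larger summand dominates the sum up to a factor 2, whence 8 and 4. The Taylor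
  remainder is thereby charged to third moments of the Gaussian part \<open>a\<close> and to second
  moments of the remaining part \<open>b\<close>.\<close>

lemma min_square_cube_le:
  fixes a b :: "'a::real_normed_vector"
  shows "min (norm (a + b) ^ 2) (norm (a + b) ^ 3) \<le> 8 * norm a ^ 3 + 4 * norm b ^ 2"
proof (cases "norm b \<le> norm a")
  case True
  then have "norm (a + b) \<le> 2 * norm a" using norm_triangle_ineq[of a b] by linarith
  then have "norm (a + b) ^ 3 \<le> (2 * norm a) ^ 3" by (rule power_mono) simp
  then have "norm (a + b) ^ 3 \<le> 8 * norm a ^ 3" by (simp add: power_mult_distrib)
  then show ?thesis by (simp add: min.coboundedI2 add_increasing2)
next
  case False
  then have "norm (a + b) \<le> 2 * norm b" using norm_triangle_ineq[of a b] by linarith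
  then have "norm (a + b) ^ 2 \<le> (2 * norm b) ^ 2" by (rule power_mono) simp
  then have "norm (a + b) ^ 2 \<le> 4 * norm b ^ 2" by (simp add: power_mult_distrib)
  then show ?thesis by (simp add: min.coboundedI1 add_increasing)
qed

lemma quadratic_form_le: "\<bar>u \<bullet> (Q *v w)\<bar> \<le> norm (Q :: real^'n::finite^'n) * (norm u * norm w)"
proof -
  have "\<bar>u \<bullet> (Q *v w)\<bar> \<le> norm u * norm (Q *v w)" by (rule Cauchy_Schwarz_ineq2)
  also have "\<dots> \<le> norm u * (norm Q * norm w)" by (intro mult_left_mono norm_matrix_vector_mult_le) simp
  finally show ?thesis by (simp add: ac_simps)
qed

text \<open>Young's inequality with weight \<open>d\<close> on the cross terms. The Gaussian part
  \<open>\<xi>\<close> receives the small factor \<open>d\<close>, because its second moments add up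
  to order one over all steps; \<open>\<rho>\<close> can bear the factor 1/d, because its second
  moments add up to something that vanishes.\<close>

lemma quadratic_form_perturb:
  assumes Q: "norm (Q :: real^'n::finite^'n) \<le> q" and d: "0 < d"
  shows "(\<xi> + \<rho>) \<bullet> (Q *v (\<xi> + \<rho>)) \<ge> \<xi> \<bullet> (Q *v \<xi>) - 2 * q * d * (norm \<xi>)\<^sup>2 - (2 * q / d + q) * (norm \<rho>)\<^sup>2"
proof -
  have q: "0 \<le> q" using Q norm_ge_zero order_trans by blast
  have b: "\<bar>u \<bullet> (Q *v w)\<bar> \<le> q * (norm u * norm w)" for u w
    by (rule order_trans[OF quadratic_form_le]) (intro mult_right_mono Q, simp)
  have "norm \<xi> * norm \<rho> \<le> d * (norm \<xi>)\<^sup>2 + (norm \<rho>)\<^sup>2 / d"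
  proof -
    have "0 \<le> (d * norm \<xi> - norm \<rho>)\<^sup>2 / d" "0 \<le> norm \<xi> * norm \<rho>" using d by simp_all
    moreover have "(d * norm \<xi> - norm \<rho>)\<^sup>2 / d = d * (norm \<xi>)\<^sup>2 + (norm \<rho>)\<^sup>2 / d - 2 * (norm \<xi> * norm \<rho>)"
      using d by (simp add: power2_eq_square field_simps)
    ultimately show ?thesis by linarith
  qed
  then have m: "q * (norm \<xi> * norm \<rho>) \<le> q * (d * (norm \<xi>)\<^sup>2 + (norm \<rho>)\<^sup>2 / d)"
    using q by (rule mult_left_mono)
  have "(\<xi> + \<rho>) \<bullet> (Q *v (\<xi> + \<rho>)) = \<xi> \<bullet> (Q *v \<xi>) + \<xi> \<bullet> (Q *v \<rho>) + \<rho> \<bullet> (Q *v \<xi>) + \<rho> \<bullet> (Q *v \<rho>)"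
    by (simp add: matrix_vector_right_distrib inner_add_left inner_add_right)
  moreover have "\<rho> \<bullet> (Q *v \<rho>) \<ge> - (q * (norm \<rho>)\<^sup>2)"
    using b[of \<rho> \<rho>] by (simp add: power2_eq_square abs_le_iff)
  moreover have "\<xi> \<bullet> (Q *v \<rho>) \<ge> - (q * (norm \<xi> * norm \<rho>))" using b[of \<xi> \<rho>] by linarith
  moreover have "\<rho> \<bullet> (Q *v \<xi>) \<ge> - (q * (norm \<xi> * norm \<rho>))" using b[of \<rho> \<xi>] by (simp add: mult.commute[of "norm \<rho>"])
  ultimately have "(\<xi> + \<rho>) \<bullet> (Q *v (\<xi> + \<rho>)) \<ge> \<xi> \<bullet> (Q *v \<xi>) - 2 * (q * (d * (norm \<xi>)\<^sup>2 + (norm \<rho>)\<^sup>2 / d)) - q * (norm \<rho>)\<^sup>2"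
    using m by linarith
  then show ?thesis by (simp add: algebra_simps)
qed

text \<open>Compares the drift accumulated over a step with a frozen value \<open>v\<close>; taken
  with \<open>v = 0\<close> it becomes a plain bound on the size of that drift.\<close>

lemma integral_increment_bound:
  fixes g :: "real \<Rightarrow> real^'n::finite"
  assumes g: "continuous_on {0..b} g" and ab: "0 \<le> a" "a \<le> b"
    and e: "\<And>s. s \<in> {a..b} \<Longrightarrow> norm (g s - v) \<le> e"
  shows "norm ((LINT s:{0..b}|lborel. g s) - (LINT s:{0..a}|lborel. g s) - (b - a) *\<^sub>R v) \<le> (b - a) * e"
proof -
  have i: "set_integrable lborel {0..b} g" by (rule borel_integrable_atLeastAtMost'[OF g])
  have ia: "set_integrable lborel {0..a} g" by (rule set_integrable_subset[OF i]) (use ab in auto)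
  have ic: "set_integrable lborel {a<..b} g" by (rule set_integrable_subset[OF i]) (use ab in auto)
  have "(LINT s:{0..b}|lborel. g s) = (LINT s:{0..a}|lborel. g s) + (LINT s:{a<..b}|lborel. g s)"
  proof -
    have "{0..a} \<inter> {a<..b} = {}" "{0..b} = {0..a} \<union> {a<..b}" using ab by auto
    then show ?thesis using set_integral_Un[OF _ ia ic] by simp
  qed
  moreover have ci: "set_integrable lborel {a<..b} (\<lambda>_. w)" for w :: "'c::{banach, second_countable_topology}"
    unfolding set_integrable_def using ab
    by (intro integrable_scaleR_left integrable_real_indicator) auto
  note iv = ci[of v]
  moreover have "(LINT s:{a<..b}|lborel. v) = (b - a) *\<^sub>R v"
    using ab by (simp add: set_lebesgue_integral_def)
  ultimately have "(LINT s:{0..b}|lborel. g s) - (LINT s:{0..a}|lborel. g s) - (b - a) *\<^sub>R v = (LINT s:{a<..b}|lborel. g s - v)"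
    using set_integral_diff(2)[OF ic iv] by simp
  also have "norm \<dots> \<le> (LINT s:{a<..b}|lborel. norm (g s - v))"
    by (rule set_integral_norm_bound) (use set_integral_diff(1)[OF ic iv] in simp)
  also have "\<dots> \<le> (LINT s:{a<..b}|lborel. e)"
    by (rule set_integral_mono[OF set_integrable_norm[OF set_integral_diff(1)[OF ic iv]] ci]) (use e in auto)
  also have "\<dots> = (b - a) * e" using ab by (simp add: set_lebesgue_integral_def)
  finally show ?thesis .
qed

context brownian
begin

text \<open>Source of the second-order term of the generator: the coordinates of the increment are
  uncorrelated with variance t - s, so only the diagonal of \<open>S\<close> contributes in the
  mean.\<close>

lemma quadratic_increment:
  fixes S :: "'w \<Rightarrow> real^'n^'n"
  assumes st: "0 \<le> s" "s \<le> t" and S: "S \<in> borel_measurable (F s)" "\<And>\<omega>. \<omega> \<in> space M \<Longrightarrow> norm (S \<omega>) \<le> c"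
  shows "integrable M (\<lambda>\<omega>. (B t \<omega> - B s \<omega>) \<bullet> (S \<omega> *v (B t \<omega> - B s \<omega>)))"
    and "(\<integral>\<omega>. (B t \<omega> - B s \<omega>) \<bullet> (S \<omega> *v (B t \<omega> - B s \<omega>)) \<partial>M) = (t - s) * (\<integral>\<omega>. trace (S \<omega>) \<partial>M)"
proof -
  have m: "(\<lambda>\<omega>. S \<omega> $ i $ j) \<in> borel_measurable (F s)" for i j
    using S(1) by simp
  have int: "integrable M (\<lambda>\<omega>. S \<omega> $ i $ j)" for i j
  proof (rule integrable_const_bound[where B=c])
    show "AE \<omega> in M. norm (S \<omega> $ i $ j) \<le> c"
      using order_trans[OF abs_matrix_nth_le S(2)] by (intro AE_I2) simp
  qed (rule measurable_F_M[OF m])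
  have eq: "(B t \<omega> - B s \<omega>) \<bullet> (S \<omega> *v (B t \<omega> - B s \<omega>)) = (\<Sum>i\<in>UNIV. \<Sum>j\<in>UNIV.
    S \<omega> $ i $ j * ((B t \<omega> - B s \<omega>) $ i * (B t \<omega> - B s \<omega>) $ j))" for \<omega>
    by (simp add: inner_vec_def matrix_vector_mult_def sum_distrib_left ac_simps)
  note im = increment_mult_nth(3,4)[OF st m int]
  show "integrable M (\<lambda>\<omega>. (B t \<omega> - B s \<omega>) \<bullet> (S \<omega> *v (B t \<omega> - B s \<omega>)))"
    unfolding eq by (intro Bochner_Integration.integrable_sum im)
  show "(\<integral>\<omega>. (B t \<omega> - B s \<omega>) \<bullet> (S \<omega> *v (B t \<omega> - B s \<omega>)) \<partial>M) = (t - s) * (\<integral>\<omega>. trace (S \<omega>) \<partial>M)"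
    unfolding eq trace_def
    by (simp add: Bochner_Integration.integral_sum Bochner_Integration.integrable_sum im int sum_distrib_left del: vector_minus_component)
qed

text \<open>The fourth power of the dimension is the cube from \<open>norm_cube_le\<close> times the
  number of coordinates.\<close>

lemma increment_norm_moments:
  assumes st: "0 \<le> s" "s \<le> t"
  shows "integrable M (\<lambda>\<omega>. (norm (B t \<omega> - B s \<omega>))\<^sup>2)"
    and "(\<integral>\<omega>. (norm (B t \<omega> - B s \<omega>))\<^sup>2 \<partial>M) = real CARD('n) * (t - s)"
    and "integrable M (\<lambda>\<omega>. norm (B t \<omega> - B s \<omega>) ^ 3)"
    and "(\<integral>\<omega>. norm (B t \<omega> - B s \<omega>) ^ 3 \<partial>M) \<le> 2 * real CARD('n) ^ 4 * sqrt (t - s) ^ 3"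
proof -
  note [measurable] = B_measurable[OF st(1)] B_measurable[OF order_trans[OF st]]
  note sq = increment_integrable_sq[OF st] and var = increment_var[OF st]
    and ic = increment_integrable_cube[OF st] and cube = increment_cube[OF st]
  show "integrable M (\<lambda>\<omega>. (norm (B t \<omega> - B s \<omega>))\<^sup>2)"
    unfolding norm_sq_vec by (intro Bochner_Integration.integrable_sum sq)
  show "(\<integral>\<omega>. (norm (B t \<omega> - B s \<omega>))\<^sup>2 \<partial>M) = real CARD('n) * (t - s)"
    unfolding norm_sq_vec using sq var by (simp add: Bochner_Integration.integral_sum del: vector_minus_component)
  have i3: "integrable M (\<lambda>\<omega>. real CARD('n) ^ 3 * (\<Sum>i\<in>UNIV. \<bar>(B t \<omega> - B s \<omega>) $ i\<bar> ^ 3))"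
    by (intro integrable_mult_right Bochner_Integration.integrable_sum ic)
  show i: "integrable M (\<lambda>\<omega>. norm (B t \<omega> - B s \<omega>) ^ 3)"
    by (rule Bochner_Integration.integrable_bound[OF i3])
      (use norm_cube_le in \<open>auto simp del: vector_minus_component intro: order_trans[OF _ abs_ge_self]\<close>)
  have "(\<integral>\<omega>. norm (B t \<omega> - B s \<omega>) ^ 3 \<partial>M) \<le> (\<integral>\<omega>. real CARD('n) ^ 3 * (\<Sum>i\<in>UNIV. \<bar>(B t \<omega> - B s \<omega>) $ i\<bar> ^ 3) \<partial>M)"
    by (intro integral_mono i i3 norm_cube_le)
  also have "\<dots> = real CARD('n) ^ 3 * (\<Sum>i\<in>UNIV. \<integral>\<omega>. \<bar>(B t \<omega> - B s \<omega>) $ i\<bar> ^ 3 \<partial>M)"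
    using ic by (simp add: Bochner_Integration.integral_sum del: vector_minus_component)
  also have "\<dots> \<le> real CARD('n) ^ 3 * (\<Sum>i\<in>(UNIV::'n set). 2 * sqrt (t - s) ^ 3)"
    by (intro mult_left_mono sum_mono cube) simp
  also have "\<dots> = 2 * real CARD('n) ^ 4 * sqrt (t - s) ^ 3"
    by (simp add: power_numeral_reduce)
  finally show "(\<integral>\<omega>. norm (B t \<omega> - B s \<omega>) ^ 3 \<partial>M) \<le> 2 * real CARD('n) ^ 4 * sqrt (t - s) ^ 3" .
qed

end

section \<open>Localisation to a ball\<close>

context diffusion
begin

text \<open>Plays the part of a stopping time: whether the path has remained in the ball is recorded
  as one event per time, decreasing in \<open>t\<close>.\<close>

definition stay :: "real \<Rightarrow> real \<Rightarrow> 'w set" where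
  "stay R t = {\<omega>\<in>space M. \<forall>u\<in>{0..t}. norm (X u \<omega>) \<le> R}"

text \<open>Continuity reduces the condition to countably many times: a violation at some
  \<open>u < t\<close> persists on an interval to the right of \<open>u\<close> and is therefore
  seen at a rational time before \<open>t\<close>.\<close>

lemma stay_sets_F:
  assumes t: "0 \<le> t" shows "stay R t \<in> sets (F t)"
proof -
  \<comment> \<open>\<open>t\<close> is added because it may be irrational, and a violation at
    \<open>t\<close> has no later time in the interval that would detect it.\<close>
  let ?I = "insert t (\<rat> \<inter> {0..t})"
  have "stay R t = (\<Inter>q\<in>?I. {\<omega>\<in>space (F t). norm (X q \<omega>) \<le> R})"
  proof (intro equalityI subsetI)
    fix \<omega> assume "\<omega> \<in> stay R t"
    then show "\<omega> \<in> (\<Inter>q\<in>?I. {\<omega>\<in>space (F t). norm (X q \<omega>) \<le> R})" using t by (auto simp: stay_def)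
  next
    fix \<omega> assume \<omega>: "\<omega> \<in> (\<Inter>q\<in>?I. {\<omega>\<in>space (F t). norm (X q \<omega>) \<le> R})"
    then have sp: "\<omega> \<in> space M" by auto
    have "norm (X u \<omega>) \<le> R" if u: "u \<in> {0..t}" for u
    proof (rule ccontr)
      assume n: "\<not> norm (X u \<omega>) \<le> R"
      with \<omega> have ut: "u < t" using u by (cases "u = t") auto
      have "continuous_on {0..} (\<lambda>s. norm (X s \<omega>))" using X_path[OF sp] by (intro continuous_intros)
      then have "\<forall>e>0. \<exists>d>0. \<forall>s\<in>{0..}. dist s u < d \<longrightarrow> dist (norm (X s \<omega>)) (norm (X u \<omega>)) < e"
        using u unfolding continuous_on_iff by auto
      then obtain d where d: "0 < d" "\<And>s. s \<ge> 0 \<Longrightarrow> dist s u < d \<Longrightarrow> dist (norm (X s \<omega>)) (norm (X u \<omega>)) < norm (X u \<omega>) - R"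
        using n by (metis atLeast_iff diff_gt_0_iff_gt not_le)
      obtain q where q: "q \<in> \<rat>" "u < q" "q < min t (u + d)"
        using Rats_dense_in_real[of u "min t (u + d)"] ut d(1) by auto
      then have "norm (X q \<omega>) \<le> R" using \<omega> u by auto
      moreover have "dist (norm (X q \<omega>)) (norm (X u \<omega>)) < norm (X u \<omega>) - R"
        by (rule d(2)) (use q u in \<open>auto simp: dist_real_def\<close>)
      ultimately show False by (simp add: dist_real_def)
    qed
    with sp show "\<omega> \<in> stay R t" by (simp add: stay_def)
  qed
  also have "\<dots> \<in> sets (F t)"
  proof (rule sets.countable_INT')
    show "countable ?I" by (simp add: countable_rat countable_Int1)
    show "(\<lambda>q. {\<omega>\<in>space (F t). norm (X q \<omega>) \<le> R}) ` ?I \<subseteq> sets (F t)"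
    proof (rule image_subsetI)
      fix q assume "q \<in> ?I"
      then have "X q \<in> borel_measurable (F t)" using t by (auto intro: measurable_F_mono[OF _ X_measurable_F])
      then show "{\<omega>\<in>space (F t). norm (X q \<omega>) \<le> R} \<in> sets (F t)" by measurable
    qed
  qed auto
  finally show ?thesis .
qed

lemma stay_sets [measurable]: "0 \<le> t \<Longrightarrow> stay R t \<in> events"
  by (rule sets_F[OF stay_sets_F])

lemma stay_antimono: "s \<le> t \<Longrightarrow> stay R t \<subseteq> stay R s"
  by (auto simp: stay_def)

text \<open>Each path is bounded on [0,1] by compactness, so every \<omega> eventually leaves the
  exit event.\<close>

lemma leave_tendsto: "(\<lambda>R. prob (space M - stay (real R) 1)) \<longlonglongrightarrow> 0"
proof (rule prob_tendsto_0_of_AE)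
  fix \<omega> assume \<omega>: "\<omega> \<in> space M"
  have "compact ((\<lambda>t. X t \<omega>) ` {0..1})"
    by (intro compact_continuous_image continuous_on_subset[OF X_path[OF \<omega>]]) auto
  then obtain b where b: "\<And>u. u \<in> {0..1} \<Longrightarrow> norm (X u \<omega>) \<le> b"
    using compact_imp_bounded by (force simp: bounded_iff)
  obtain N :: nat where "b \<le> real N" using real_arch_simple by blast
  then have "\<omega> \<notin> space M - stay (real R) 1" if "R \<ge> N" for R
    using that b \<omega> by (force simp: stay_def)
  then show "eventually (\<lambda>R. \<omega> \<notin> space M - stay (real R) 1) sequentially"
    by (auto simp: eventually_sequentially)
qed auto

end

text \<open>\<open>g\<close> and \<open>Q\<close> play gradient and Hessian of \<open>f\<close>, and
  \<open>h\<close> is a bounded minorant of the generator applied to \<open>f\<close>. The expansion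
  is required at base points of a ball but for all increments, as Gaussian steps are
  unbounded.\<close>

locale test_function = diffusion M F B \<beta> \<sigma> x X C
  for M :: "'w measure" and F B \<beta> \<sigma> and x :: "real^'n::finite" and X C +
  fixes f h :: "real^'n \<Rightarrow> real" and g :: "real^'n \<Rightarrow> real^'n" and Q :: "real^'n \<Rightarrow> real^'n^'n"
    and c\<^sub>f c\<^sub>h :: real
  assumes f_cont: "continuous_on UNIV f" and g_cont: "continuous_on UNIV g"
    and Q_cont: "continuous_on UNIV Q" and h_cont: "continuous_on UNIV h"
    and f_bound: "\<And>y. \<bar>f y\<bar> \<le> c\<^sub>f" and h_bound: "\<And>y. \<bar>h y\<bar> \<le> c\<^sub>h"
    and taylor: "\<And>R. \<exists>K\<ge>0. \<forall>y \<Delta>. norm y \<le> R \<longrightarrow>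
      f y + g y \<bullet> \<Delta> + 1/2 * (\<Delta> \<bullet> (Q y *v \<Delta>)) - K * min (norm \<Delta> ^ 2) (norm \<Delta> ^ 3) \<le> f (y + \<Delta>)"
    and h_le: "\<And>y. h y \<le> g y \<bullet> \<beta> y + 1/2 * trace (transpose (\<sigma> y) ** Q y ** \<sigma> y)"
begin

lemma f_measurable: "f \<in> borel_measurable borel" and g_measurable: "g \<in> borel_measurable borel"
  and h_measurable: "h \<in> borel_measurable borel"
  and \<sigma>_measurable: "\<sigma> \<in> borel_measurable borel" and \<beta>_measurable: "\<beta> \<in> borel_measurable borel"
  using f_cont g_cont h_cont cont_\<sigma> cont_\<beta> by (auto intro: borel_measurable_continuous_onI)

text \<open>The Hessian form expressed in the Brownian increment; half of its trace is the
  second-order part of the generator.\<close>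

definition pullback :: "real^'n \<Rightarrow> real^'n^'n" where
  "pullback y = transpose (\<sigma> y) ** Q y ** \<sigma> y"

lemma pullback_cont: "continuous_on UNIV pullback"
  unfolding pullback_def[abs_def] matrix_matrix_mult_def transpose_def
  by (intro continuous_intros continuous_on_component Q_cont cont_\<sigma>)

lemma pullback_measurable: "pullback \<in> borel_measurable borel"
  by (rule borel_measurable_continuous_onI[OF pullback_cont])

lemma pullback_quadratic: "v \<bullet> (pullback y *v v) = (\<sigma> y *v v) \<bullet> (Q y *v (\<sigma> y *v v))"
proof -
  have "v \<bullet> (pullback y *v v) = v \<bullet> (transpose (\<sigma> y) *v (Q y *v (\<sigma> y *v v)))"
    by (simp only: pullback_def matrix_vector_mul_assoc matrix_mul_assoc)
  also have "\<dots> = (v v* transpose (\<sigma> y)) \<bullet> (Q y *v (\<sigma> y *v v))"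
    by (simp only: dot_lmul_matrix)
  finally show ?thesis by (simp only: vector_transpose_matrix)
qed

lemma trace_pullback_measurable: "(\<lambda>y. trace (pullback y)) \<in> borel_measurable borel"
  unfolding trace_def using pullback_measurable by simp

text \<open>If the path exits during the step, its drift is uncontrolled and is replaced by the
  drift frozen at the start of the step. The size is then at most k/n whenever the step begins
  inside the ball, where \<open>k\<close> bounds \<open>\<beta>\<close> on the ball.\<close>

definition drift_inc :: "real \<Rightarrow> nat \<Rightarrow> nat \<Rightarrow> 'w \<Rightarrow> real^'n" where
  "drift_inc R n i \<omega> = (if \<omega> \<in> stay R (real (Suc i) / real n)
     then X (real (Suc i) / real n) \<omega> - X (real i / real n) \<omega>
       - (mart (real (Suc i) / real n) \<omega> - mart (real i / real n) \<omega>)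
     else (1 / real n) *\<^sub>R \<beta> (X (real i / real n) \<omega>))"

text \<open>A fictitious end point if the path exits during the step. Only the drift is altered: the
  increment of \<open>mart\<close> stays intact, because cutting it at the exit would spoil its
  orthogonality to the past.\<close>

definition step_end :: "real \<Rightarrow> nat \<Rightarrow> nat \<Rightarrow> 'w \<Rightarrow> real^'n" where
  "step_end R n i \<omega> = X (real i / real n) \<omega> + drift_inc R n i \<omega>
     + (mart (real (Suc i) / real n) \<omega> - mart (real i / real n) \<omega>)"

lemma step_end_stay: "\<omega> \<in> stay R (real (Suc i) / real n) \<Longrightarrow> step_end R n i \<omega> = X (real (Suc i) / real n) \<omega>"
  by (simp add: step_end_def drift_inc_def)

lemma X_grid_measurable [measurable]: "X (real i / real n) \<in> borel_measurable M"
  "mart (real i / real n) \<in> borel_measurable M" "B (real i / real n) \<in> borel_measurable M"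
  "stay R (real i / real n) \<in> events"
  by (auto intro!: X_measurable mart_measurable stay_sets B_measurable)

lemma drift_inc_measurable [measurable]: "drift_inc R n i \<in> borel_measurable M"
  unfolding drift_inc_def[abs_def] using \<beta>_measurable by measurable

lemma step_end_measurable [measurable]: "step_end R n i \<in> borel_measurable M"
  unfolding step_end_def[abs_def] by measurable

lemma grid_step: "real (Suc i) / real n - real i / real n = 1 / real n"
  by (simp add: diff_divide_distrib[symmetric])

lemma drift_inc_eq:
  assumes "\<omega> \<in> stay R (real (Suc i) / real n)"
  shows "drift_inc R n i \<omega> = (LINT s:{0..real (Suc i) / real n}|lborel. \<beta> (X s \<omega>))
    - (LINT s:{0..real i / real n}|lborel. \<beta> (X s \<omega>))"
  using assms by (simp add: drift_inc_def mart_def del: of_nat_Suc)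

lemma \<beta>_path: "\<omega> \<in> space M \<Longrightarrow> continuous_on {0..t} (\<lambda>s. \<beta> (X s \<omega>))"
  using continuous_on_compose2[OF cont_\<beta> X_path] continuous_on_subset[of "{0..}" _ "{0..t}"] by force

lemma drift_inc_bound:
  assumes k: "\<And>y. norm y \<le> R \<Longrightarrow> norm (\<beta> y) \<le> k" and \<omega>: "\<omega> \<in> stay R (real i / real n)"
  shows "norm (drift_inc R n i \<omega>) \<le> k / real n"
proof (cases "\<omega> \<in> stay R (real (Suc i) / real n)")
  case True
  have "norm ((LINT s:{0..real (Suc i) / real n}|lborel. \<beta> (X s \<omega>))
    - (LINT s:{0..real i / real n}|lborel. \<beta> (X s \<omega>)) - (real (Suc i) / real n - real i / real n) *\<^sub>R 0)
    \<le> (real (Suc i) / real n - real i / real n) * k"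
  proof (rule integral_increment_bound[OF \<beta>_path])
    show "\<omega> \<in> space M" using \<omega> by (simp add: stay_def)
    fix s assume "s \<in> {real i / real n..real (Suc i) / real n}"
    then have "real i / real n \<le> s" "s \<le> real (Suc i) / real n" by (simp_all only: atLeastAtMost_iff)
    moreover have "0 \<le> real i / real n" by simp
    ultimately have "0 \<le> s" "s \<le> real (Suc i) / real n" by linarith+
    then have "s \<in> {0..real (Suc i) / real n}" by (simp only: atLeastAtMost_iff)
    then have "norm (X s \<omega>) \<le> R" using True unfolding stay_def by blast
    then show "norm (\<beta> (X s \<omega>) - 0) \<le> k" using k by simp
  qed (auto intro!: divide_right_mono)
  then show ?thesis unfolding drift_inc_eq[OF True] grid_step by simp
next
  case False
  have "norm (X (real i / real n) \<omega>) \<le> R" using \<omega> by (simp add: stay_def)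
  from k[OF this] show ?thesis using False by (simp add: drift_inc_def divide_right_mono)
qed

definition drift_error :: "real \<Rightarrow> nat \<Rightarrow> nat \<Rightarrow> 'w \<Rightarrow> real" where
  "drift_error R n i \<omega> = indicator (stay R (real i / real n)) \<omega> *
     norm (drift_inc R n i \<omega> - (1 / real n) *\<^sub>R \<beta> (X (real i / real n) \<omega>))"

lemma drift_error_measurable [measurable]: "drift_error R n i \<in> borel_measurable M"
  unfolding drift_error_def[abs_def] using \<beta>_measurable by measurable

lemma drift_error_bound:
  assumes k: "\<And>y. norm y \<le> R \<Longrightarrow> norm (\<beta> y) \<le> k" and "0 \<le> k"
  shows "drift_error R n i \<omega> \<le> 2 * k / real n"
proof (cases "\<omega> \<in> stay R (real i / real n)")
  case True
  then have "norm (X (real i / real n) \<omega>) \<le> R" by (simp add: stay_def)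
  from k[OF this] have "norm ((1 / real n) *\<^sub>R \<beta> (X (real i / real n) \<omega>)) \<le> k / real n"
    by (simp add: divide_right_mono)
  with drift_inc_bound[OF k True] show ?thesis
    using True norm_triangle_ineq4[of "drift_inc R n i \<omega>" "(1 / real n) *\<^sub>R \<beta> (X (real i / real n) \<omega>)"]
    unfolding drift_error_def by simp
qed (use assms in \<open>simp add: drift_error_def\<close>)

lemma drift_error_nonneg: "0 \<le> drift_error R n i \<omega>"
  by (simp add: drift_error_def)

lemma drift_error_sum_tendsto:
  assumes k: "\<And>y. norm y \<le> R \<Longrightarrow> norm (\<beta> y) \<le> k" and k0: "0 \<le> k"
  shows "(\<lambda>n. \<integral>\<omega>. (\<Sum>i<n. drift_error R n i \<omega>) \<partial>M) \<longlonglongrightarrow> 0"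
proof -
  have le: "(\<Sum>i<n. drift_error R n i \<omega>) \<le> 2 * k" for n \<omega>
  proof -
    have "(\<Sum>i<n. drift_error R n i \<omega>) \<le> (\<Sum>i<n. 2 * k / real n)"
      by (rule sum_mono) (rule drift_error_bound[OF k k0])
    also have "\<dots> \<le> 2 * k" using k0 by simp
    finally show ?thesis .
  qed
  have "(\<lambda>n. \<integral>\<omega>. (\<Sum>i<n. drift_error R n i \<omega>) \<partial>M) \<longlonglongrightarrow> (\<integral>\<omega>. 0 \<partial>M)"
  proof (rule integral_dominated_convergence[where w="\<lambda>_. 2 * k"])
    show "AE \<omega> in M. norm (\<Sum>i<n. drift_error R n i \<omega>) \<le> 2 * k" for n
      using le by (simp add: sum_nonneg drift_error_nonneg)
    show "AE \<omega> in M. (\<lambda>n. \<Sum>i<n. drift_error R n i \<omega>) \<longlonglongrightarrow> 0"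
    proof (rule AE_I2)
      fix \<omega> assume \<omega>: "\<omega> \<in> space M"
      show "(\<lambda>n. \<Sum>i<n. drift_error R n i \<omega>) \<longlonglongrightarrow> 0"
      proof (rule LIMSEQ_I)
        fix r :: real assume r: "0 < r"
        have "uniformly_continuous_on {0..1} (\<lambda>t. \<beta> (X t \<omega>))"
          by (intro compact_uniformly_continuous \<beta>_path[OF \<omega>]) auto
        then obtain d where d: "0 < d" "\<And>u v. u \<in> {0..1} \<Longrightarrow> v \<in> {0..1} \<Longrightarrow> dist u v < d \<Longrightarrow>
            dist (\<beta> (X u \<omega>)) (\<beta> (X v \<omega>)) < r / 2"
          using r unfolding uniformly_continuous_on_def by (meson half_gt_zero)
        obtain N :: nat where N: "0 < N" "1 / real N < d"
          using real_arch_inverse[of d] d by (auto simp: inverse_eq_divide)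
        have "norm ((\<Sum>i<n. drift_error R n i \<omega>) - 0) < r" if n: "n \<ge> N" for n
        proof -
          have n0: "0 < n" using n N by simp
          have nd: "1 / real n < d"
          proof -
            have "1 / real n \<le> 1 / real N" using n N by (simp add: frac_le)
            with N show ?thesis by simp
          qed
          have "drift_error R n i \<omega> \<le> (r / 2) / real n" if i: "i < n" for i
          proof (cases "\<omega> \<in> stay R (real (Suc i) / real n)")
            case True
            have "norm ((LINT s:{0..real (Suc i) / real n}|lborel. \<beta> (X s \<omega>))
              - (LINT s:{0..real i / real n}|lborel. \<beta> (X s \<omega>)) - (real (Suc i) / real n - real i / real n) *\<^sub>R \<beta> (X (real i / real n) \<omega>))
              \<le> (real (Suc i) / real n - real i / real n) * (r / 2)"
            proof (rule integral_increment_bound[OF \<beta>_path[OF \<omega>]])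
              fix s assume s: "s \<in> {real i / real n..real (Suc i) / real n}"
              have "real (Suc i) / real n \<le> 1" using i n0 by simp
              moreover have "0 \<le> real i / real n" by simp
              moreover have "real i / real n \<le> s" "s \<le> real (Suc i) / real n"
                using s by (simp_all only: atLeastAtMost_iff)
              ultimately have "0 \<le> s" "s \<le> 1" "0 \<le> real i / real n" "real i / real n \<le> 1" "\<bar>s - real i / real n\<bar> < d"
                using nd grid_step[of i n] by linarith+
              then have "s \<in> {0..1}" "real i / real n \<in> {0..1}" "dist s (real i / real n) < d"
                by (simp_all only: atLeastAtMost_iff dist_real_def simp_thms)
              then have "dist (\<beta> (X s \<omega>)) (\<beta> (X (real i / real n) \<omega>)) < r / 2" by (intro d(2))
              then show "norm (\<beta> (X s \<omega>) - \<beta> (X (real i / real n) \<omega>)) \<le> r / 2" by (simp add: dist_norm)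
            qed (auto intro!: divide_right_mono)
            then have "norm (drift_inc R n i \<omega> - (1 / real n) *\<^sub>R \<beta> (X (real i / real n) \<omega>)) \<le> (r / 2) / real n"
              unfolding drift_inc_eq[OF True] grid_step by simp
            moreover have "drift_error R n i \<omega> \<le> norm (drift_inc R n i \<omega> - (1 / real n) *\<^sub>R \<beta> (X (real i / real n) \<omega>))"
              unfolding drift_error_def by (simp add: indicator_def)
            ultimately show ?thesis by linarith
          next
            case False
            then show ?thesis using r by (simp add: drift_error_def drift_inc_def)
          qed
          then have "(\<Sum>i<n. drift_error R n i \<omega>) \<le> (\<Sum>i<n. (r / 2) / real n)" by (intro sum_mono) simp
          also have "\<dots> = r / 2" using n0 by simp
          finally show ?thesis using r by (simp add: sum_nonneg drift_error_nonneg)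
        qed
        then show "\<exists>N. \<forall>n\<ge>N. norm ((\<Sum>i<n. drift_error R n i \<omega>) - 0) < r" by blast
      qed
    qed
  qed (auto intro!: borel_measurable_sum)
  then show ?thesis by simp
qed

text \<open>Until the exit the sum telescopes. The exit step ends at a fictitious point, which
  leaves the sum below \<open>2 * c\<^sub>f\<close>, and later steps contribute nothing; comparison
  with the difference of the two end values of \<open>f\<close> costs another
  \<open>2 * c\<^sub>f\<close>.\<close>

lemma telescoping:
  assumes \<omega>: "\<omega> \<in> space M"
  shows "(\<Sum>i<n. indicator (stay R (real i / real n)) \<omega> * (f (step_end R n i \<omega>) - f (X (real i / real n) \<omega>)))
    \<le> f (X (real n / real n) \<omega>) - f (X (real 0 / real n) \<omega>) + 4 * c\<^sub>f * indicator (space M - stay R (real n / real n)) \<omega>"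
proof -
  let ?T = "\<lambda>m. \<Sum>i<m. indicator (stay R (real i / real n)) \<omega> * (f (step_end R n i \<omega>) - f (X (real i / real n) \<omega>))"
  have b: "f y - f z \<le> 2 * c\<^sub>f" for y z using f_bound[of y] f_bound[of z] by linarith
  \<comment> \<open>The equality inside the ball belongs to the invariant: it lets the exit step
    cancel the last true value of \<open>f\<close>.\<close>
  have "?T m \<le> (if \<omega> \<in> stay R (real m / real n) then f (X (real m / real n) \<omega>) - f (X (real 0 / real n) \<omega>) else 2 * c\<^sub>f) \<and>
     (\<omega> \<in> stay R (real m / real n) \<longrightarrow> ?T m = f (X (real m / real n) \<omega>) - f (X (real 0 / real n) \<omega>))" for m
  proof (induction m)
    case 0
    show ?case using f_bound[of undefined] by simp
  next
    case (Suc m)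
    have sub: "\<omega> \<in> stay R (real (Suc m) / real n) \<Longrightarrow> \<omega> \<in> stay R (real m / real n)"
      using stay_antimono[of "real m / real n" "real (Suc m) / real n" R] by (auto simp: divide_right_mono)
    show ?case
    proof (cases "\<omega> \<in> stay R (real (Suc m) / real n)")
      case True
      then show ?thesis using Suc.IH sub[OF True] step_end_stay[OF True] by simp
    next
      case False
      show ?thesis
      proof (cases "\<omega> \<in> stay R (real m / real n)")
        case True
        with Suc.IH False b[of "step_end R n m \<omega>" "X (real 0 / real n) \<omega>"] show ?thesis by simp
      next
        case False2: False
        with Suc.IH False show ?thesis by simp
      qed
    qed
  qed
  from this[of n] show ?thesis
    using \<omega> b[of "X (real 0 / real n) \<omega>" "X (real n / real n) \<omega>"] by (auto simp: indicator_def split: if_splits)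
qed

text \<open>\<open>u\<close> is the drift, \<open>r\<close> the remainder of the stochastic integral
  and \<open>v\<close> the Brownian increment. The Gaussian part \<open>\<sigma> y *v v\<close> is
  kept apart from \<open>u + r\<close> in the quadratic term and in the Taylor remainder.\<close>

lemma step_pointwise:
  assumes K: "0 \<le> K" "\<And>\<Delta>. f y + g y \<bullet> \<Delta> + 1/2 * (\<Delta> \<bullet> (Q y *v \<Delta>)) - K * min (norm \<Delta> ^ 2) (norm \<Delta> ^ 3) \<le> f (y + \<Delta>)"
    and q: "norm (Q y) \<le> q" and d: "0 < d"
  shows "f (y + (u + (r + \<sigma> y *v v))) - f y \<ge> g y \<bullet> u + g y \<bullet> r + g y \<bullet> (\<sigma> y *v v) + 1/2 * (v \<bullet> (pullback y *v v))
    - (q * d * C\<^sup>2 * (norm v)\<^sup>2 + (q / d + q / 2 + 4 * K) * (2 * (norm u)\<^sup>2 + 2 * (norm r)\<^sup>2) + 8 * K * C ^ 3 * norm v ^ 3)"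
proof -
  let ?\<xi> = "\<sigma> y *v v" and ?\<rho> = "u + r"
  have q0: "0 \<le> q" using q norm_ge_zero order_trans by blast
  have v: "norm ?\<xi> \<le> C * norm v"
    by (rule order_trans[OF norm_matrix_vector_mult_le]) (intro mult_right_mono bound_\<sigma>, simp)
  have v2: "(norm ?\<xi>)\<^sup>2 \<le> C\<^sup>2 * (norm v)\<^sup>2" using power_mono[OF v, of 2] by (simp add: power_mult_distrib)
  have v3: "norm ?\<xi> ^ 3 \<le> C ^ 3 * norm v ^ 3" using power_mono[OF v, of 3] by (simp add: power_mult_distrib)
  have r2: "(norm ?\<rho>)\<^sup>2 \<le> 2 * (norm u)\<^sup>2 + 2 * (norm r)\<^sup>2"
  proof -
    have "(norm ?\<rho>)\<^sup>2 \<le> (norm u + norm r)\<^sup>2" by (rule power_mono) (rule norm_triangle_ineq, simp)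
    then show ?thesis using sum_squares_bound[of "norm u" "norm r"] by (simp add: power2_sum)
  qed
  have "f (y + (?\<xi> + ?\<rho>)) - f y \<ge> g y \<bullet> (?\<xi> + ?\<rho>) + 1/2 * ((?\<xi> + ?\<rho>) \<bullet> (Q y *v (?\<xi> + ?\<rho>)))
     - K * min (norm (?\<xi> + ?\<rho>) ^ 2) (norm (?\<xi> + ?\<rho>) ^ 3)"
    using K(2)[of "?\<xi> + ?\<rho>"] by linarith
  moreover have "K * min (norm (?\<xi> + ?\<rho>) ^ 2) (norm (?\<xi> + ?\<rho>) ^ 3) \<le> K * (8 * norm ?\<xi> ^ 3 + 4 * norm ?\<rho> ^ 2)"
    by (rule mult_left_mono[OF min_square_cube_le K(1)])
  moreover have "K * (8 * norm ?\<xi> ^ 3 + 4 * norm ?\<rho> ^ 2) \<le> K * (8 * (C ^ 3 * norm v ^ 3) + 4 * (2 * (norm u)\<^sup>2 + 2 * (norm r)\<^sup>2))"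
    using v3 r2 K(1) by (intro mult_left_mono[OF add_mono[OF mult_left_mono[OF v3] mult_left_mono[OF r2]]]) simp_all
  moreover note quadratic_form_perturb[OF q d, of ?\<xi> ?\<rho>]
  moreover have "2 * q * d * (norm ?\<xi>)\<^sup>2 \<le> 2 * q * d * (C\<^sup>2 * (norm v)\<^sup>2)"
    using q0 d v2 by (intro mult_left_mono) auto
  moreover have "(2 * q / d + q) * (norm ?\<rho>)\<^sup>2 \<le> (2 * q / d + q) * (2 * (norm u)\<^sup>2 + 2 * (norm r)\<^sup>2)"
    using q0 d r2 by (intro mult_left_mono) auto
  moreover have "g y \<bullet> (?\<xi> + ?\<rho>) = g y \<bullet> u + g y \<bullet> r + g y \<bullet> ?\<xi>"
    by (simp add: inner_add_right)
  moreover have "v \<bullet> (pullback y *v v) = ?\<xi> \<bullet> (Q y *v ?\<xi>)" by (rule pullback_quadratic)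
  ultimately have "f (y + (?\<xi> + ?\<rho>)) - f y \<ge> g y \<bullet> u + g y \<bullet> r + g y \<bullet> ?\<xi> + 1/2 * (v \<bullet> (pullback y *v v))
    - 1/2 * (2 * q * d * (C\<^sup>2 * (norm v)\<^sup>2)) - 1/2 * ((2 * q / d + q) * (2 * (norm u)\<^sup>2 + 2 * (norm r)\<^sup>2))
    - K * (8 * (C ^ 3 * norm v ^ 3) + 4 * (2 * (norm u)\<^sup>2 + 2 * (norm r)\<^sup>2))"
    by linarith
  moreover have "y + (?\<xi> + ?\<rho>) = y + (u + (r + ?\<xi>))" by (simp add: ac_simps)
  ultimately show ?thesis by (simp add: algebra_simps)
qed

text \<open>In the mean the terms linear in the noise vanish: the Gaussian one by
  \<open>step_orthogonal\<close>, the remainder by \<open>euler_remainder_orthogonal\<close>. Drift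
  and trace survive, with errors whose sum over \<open>n\<close> steps can be made small.\<close>

lemma step_estimate:
  assumes n: "0 < n" "i < n"
    and K: "0 \<le> K" "\<And>y \<Delta>. norm y \<le> R \<Longrightarrow> f y + g y \<bullet> \<Delta> + 1/2 * (\<Delta> \<bullet> (Q y *v \<Delta>)) - K * min (norm \<Delta> ^ 2) (norm \<Delta> ^ 3) \<le> f (y + \<Delta>)"
    and q: "0 \<le> q" "\<And>y. norm y \<le> R \<Longrightarrow> norm (Q y) \<le> q"
    and l: "0 \<le> l" "\<And>y. norm y \<le> R \<Longrightarrow> norm (g y) \<le> l"
    and k: "0 \<le> k" "\<And>y. norm y \<le> R \<Longrightarrow> norm (\<beta> y) \<le> k" and d: "0 < d"
  defines "A \<equiv> indicat_real (stay R (real i / real n))" and "Y \<equiv> X (real i / real n)"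
    and "c \<equiv> q / d + q / 2 + 4 * K" and "W \<equiv> \<integral>\<omega>. (modulus n \<omega>)\<^sup>2 \<partial>M"
  shows "(\<integral>\<omega>. A \<omega> * (f (step_end R n i \<omega>) - f (Y \<omega>)) \<partial>M) \<ge>
      (\<integral>\<omega>. A \<omega> * (g (Y \<omega>) \<bullet> drift_inc R n i \<omega> + trace (pullback (Y \<omega>)) / (2 * real n)) \<partial>M)
      - (q * d * C\<^sup>2 * (real CARD('n) / real n) + c * (2 * (k / real n)\<^sup>2 + 2 * (W / real n))
         + 8 * K * C ^ 3 * (2 * real CARD('n) ^ 4 * sqrt (1 / real n) ^ 3))"
proof -
  let ?s = "real i / real n" and ?t = "real (Suc i) / real n"
  have st: "0 \<le> ?s" "?s \<le> ?t" by (auto intro: divide_right_mono)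
  define D where "D = (\<lambda>\<omega>. B ?t \<omega> - B ?s \<omega>)"
  define r where "r = euler_remainder n i"
  \<comment> \<open>The indicator makes gradient and Hessian form bounded while keeping them known
    at the start of the step.\<close>
  define G where "G \<omega> = A \<omega> *\<^sub>R g (Y \<omega>)" for \<omega>
  define T where "T \<omega> = A \<omega> *\<^sub>R pullback (Y \<omega>)" for \<omega>
  have stay: "stay R ?s \<in> sets (F ?s)" by (rule stay_sets_F[OF st(1)])
  have AF: "A \<in> borel_measurable (F ?s)" unfolding A_def using stay by simp
  have YF: "Y \<in> borel_measurable (F ?s)" unfolding Y_def by (rule X_measurable_F[OF st(1)])
  have AM [measurable]: "A \<in> borel_measurable M" and YM [measurable]: "Y \<in> borel_measurable M"
    using AF YF measurable_F_M by auto
  have GF: "G \<in> borel_measurable (F ?s)"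
    unfolding G_def by (intro borel_measurable_scaleR AF measurable_compose[OF YF g_measurable])
  have TF: "T \<in> borel_measurable (F ?s)"
    unfolding T_def by (intro borel_measurable_scaleR AF measurable_compose[OF YF pullback_measurable])
  have GM [measurable]: "G \<in> borel_measurable M" and TM [measurable]: "T \<in> borel_measurable M"
    using GF TF measurable_F_M by auto
  have \<sigma>F: "(\<lambda>\<omega>. \<sigma> (Y \<omega>)) \<in> borel_measurable (F ?s)" by (rule measurable_compose[OF YF \<sigma>_measurable])
  have YR: "norm (Y \<omega>) \<le> R" if "A \<omega> \<noteq> 0" for \<omega>
    using that by (auto simp: A_def Y_def stay_def indicator_def split: if_splits)
  have A01: "A \<omega> = 0 \<or> A \<omega> = 1" for \<omega> by (simp add: A_def indicator_def)
  have Gb: "norm (G \<omega>) \<le> l" for \<omega> using A01[of \<omega>] l YR[of \<omega>] by (auto simp: G_def)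
  obtain sb where sb: "0 \<le> sb" "\<And>y. norm y \<le> R \<Longrightarrow> norm (pullback y) \<le> sb"
    using bounded_on_cball[where R=R, OF pullback_cont] by metis
  have Tb: "norm (T \<omega>) \<le> sb" for \<omega> using A01[of \<omega>] sb YR[of \<omega>] by (auto simp: T_def)
  note [measurable] = measurable_compose[OF _ f_measurable]
  have DM [measurable]: "D \<in> borel_measurable M" unfolding D_def by measurable
  have rM [measurable]: "r \<in> borel_measurable M" unfolding r_def by measurable
  have h: "?t - ?s = 1 / real n" by (rule grid_step)
  have quad: "integrable M (\<lambda>\<omega>. D \<omega> \<bullet> (T \<omega> *v D \<omega>))"
    "(\<integral>\<omega>. D \<omega> \<bullet> (T \<omega> *v D \<omega>) \<partial>M) = 1 / real n * (\<integral>\<omega>. trace (T \<omega>) \<partial>M)"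
    using quadratic_increment[OF st TF Tb] unfolding h D_def by blast+
  note mom = increment_norm_moments[OF st, unfolded D_def[symmetric, unfolded fun_eq_iff, rule_format] h]
  have b\<sigma>: "bounded ((\<lambda>\<omega>. \<sigma> (Y \<omega>)) ` space M)" using bound_\<sigma> by (auto simp: bounded_iff)
  have iG: "integrable M (\<lambda>\<omega>. (norm (G \<omega>))\<^sup>2)"
    by (rule integrable_const_bound[where B="l\<^sup>2"]) (use Gb in \<open>auto intro!: AE_I2 power_mono\<close>)
  have o1: "integrable M (\<lambda>\<omega>. G \<omega> \<bullet> (\<sigma> (Y \<omega>) *v D \<omega>))" "(\<integral>\<omega>. G \<omega> \<bullet> (\<sigma> (Y \<omega>) *v D \<omega>) \<partial>M) = 0"
    using step_orthogonal[OF st \<sigma>F b\<sigma> GF iG] by (simp_all add: D_def)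
  have o2: "integrable M (\<lambda>\<omega>. G \<omega> \<bullet> r \<omega>)" "(\<integral>\<omega>. G \<omega> \<bullet> r \<omega> \<partial>M) = 0"
    using euler_remainder_orthogonal[OF n GF Gb] by (simp_all add: r_def)
  have r2: "integrable M (\<lambda>\<omega>. (norm (r \<omega>))\<^sup>2)" "(\<integral>\<omega>. (norm (r \<omega>))\<^sup>2 \<partial>M) \<le> W / real n"
    using euler_remainder_sq[OF n] by (simp_all add: r_def W_def)
  have Du: "norm (drift_inc R n i \<omega>) \<le> k / real n" if "A \<omega> \<noteq> 0" for \<omega>
    by (rule drift_inc_bound[OF k(2)]) (use that in \<open>auto simp: A_def indicator_def split: if_splits\<close>)
  have iu: "integrable M (\<lambda>\<omega>. G \<omega> \<bullet> drift_inc R n i \<omega>)"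
  proof (rule integrable_const_bound[where B="l * (k / real n)"])
    have "\<bar>G \<omega> \<bullet> drift_inc R n i \<omega>\<bar> \<le> l * (k / real n)" for \<omega>
    proof (cases "A \<omega> = 0")
      case True then show ?thesis using l k by (simp add: G_def)
    next
      case False
      have "\<bar>G \<omega> \<bullet> drift_inc R n i \<omega>\<bar> \<le> norm (G \<omega>) * norm (drift_inc R n i \<omega>)" by (rule Cauchy_Schwarz_ineq2)
      also have "\<dots> \<le> l * (k / real n)" using Gb Du[OF False] l by (intro mult_mono) auto
      finally show ?thesis .
    qed
    then show "AE \<omega> in M. norm (G \<omega> \<bullet> drift_inc R n i \<omega>) \<le> l * (k / real n)" by simp
  qed measurable
  have iT: "integrable M (\<lambda>\<omega>. trace (T \<omega>))"
  proof -
    have "\<bar>T \<omega> $ j $ j\<bar> \<le> sb" for \<omega> j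
      by (rule order_trans[OF abs_matrix_nth_le Tb])
    then have "integrable M (\<lambda>\<omega>. T \<omega> $ j $ j)" for j
      by (intro integrable_const_bound[where B=sb]) auto
    then show ?thesis unfolding trace_def by (intro Bochner_Integration.integrable_sum)
  qed
  have c0: "0 \<le> c" using q(1) K(1) d by (simp add: c_def)
  have pt: "A \<omega> * (f (step_end R n i \<omega>) - f (Y \<omega>)) \<ge>
     G \<omega> \<bullet> drift_inc R n i \<omega> + G \<omega> \<bullet> r \<omega> + G \<omega> \<bullet> (\<sigma> (Y \<omega>) *v D \<omega>) + 1/2 * (D \<omega> \<bullet> (T \<omega> *v D \<omega>))
     - (q * d * C\<^sup>2 * (norm (D \<omega>))\<^sup>2 + c * (2 * (k / real n)\<^sup>2 + 2 * (norm (r \<omega>))\<^sup>2) + 8 * K * C ^ 3 * norm (D \<omega>) ^ 3)" for \<omega>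
  proof (cases "A \<omega> = 0")
    case True
    have "0 \<le> q * d * C\<^sup>2 * (norm (D \<omega>))\<^sup>2" "0 \<le> c * (2 * (k / real n)\<^sup>2 + 2 * (norm (r \<omega>))\<^sup>2)"
      "0 \<le> 8 * K * C ^ 3 * norm (D \<omega>) ^ 3"
      using q d c0 K(1) C_nonneg by (auto intro!: mult_nonneg_nonneg)
    then show ?thesis using True by (simp add: G_def T_def)
  next
    case False
    with A01[of \<omega>] have A1: "A \<omega> = 1" by simp
    note yR = YR[OF False]
    have se: "step_end R n i \<omega> = Y \<omega> + (drift_inc R n i \<omega> + (r \<omega> + \<sigma> (Y \<omega>) *v D \<omega>))"
      by (simp add: step_end_def r_def euler_remainder_def Y_def D_def)
    have "(norm (drift_inc R n i \<omega>))\<^sup>2 \<le> (k / real n)\<^sup>2" by (rule power_mono[OF Du[OF False]]) simp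
    then have "c * (2 * (norm (drift_inc R n i \<omega>))\<^sup>2 + 2 * (norm (r \<omega>))\<^sup>2) \<le> c * (2 * (k / real n)\<^sup>2 + 2 * (norm (r \<omega>))\<^sup>2)"
      using c0 by (intro mult_left_mono) auto
    moreover note step_pointwise[OF K(1) K(2)[OF yR] q(2)[OF yR] d, of "drift_inc R n i \<omega>" "r \<omega>" "D \<omega>", folded c_def se]
    ultimately show ?thesis unfolding G_def T_def A1 by simp
  qed
  have iL: "integrable M (\<lambda>\<omega>. A \<omega> * (f (step_end R n i \<omega>) - f (Y \<omega>)))"
  proof (rule integrable_const_bound[where B="2 * c\<^sub>f"])
    have "\<bar>A \<omega> * (f (step_end R n i \<omega>) - f (Y \<omega>))\<bar> \<le> 2 * c\<^sub>f" for \<omega>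
      using f_bound[of "step_end R n i \<omega>"] f_bound[of "Y \<omega>"] A01[of \<omega>] by auto
    then show "AE \<omega> in M. norm (A \<omega> * (f (step_end R n i \<omega>) - f (Y \<omega>))) \<le> 2 * c\<^sub>f" by simp
  qed measurable
  have "(\<integral>\<omega>. A \<omega> * (f (step_end R n i \<omega>) - f (Y \<omega>)) \<partial>M) \<ge>
     (\<integral>\<omega>. G \<omega> \<bullet> drift_inc R n i \<omega> + G \<omega> \<bullet> r \<omega> + G \<omega> \<bullet> (\<sigma> (Y \<omega>) *v D \<omega>) + 1/2 * (D \<omega> \<bullet> (T \<omega> *v D \<omega>))
     - (q * d * C\<^sup>2 * (norm (D \<omega>))\<^sup>2 + c * (2 * (k / real n)\<^sup>2 + 2 * (norm (r \<omega>))\<^sup>2) + 8 * K * C ^ 3 * norm (D \<omega>) ^ 3) \<partial>M)"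
    by (rule integral_mono) (use iL iu o1 o2 quad(1) mom r2 pt in auto)
  also have "(\<integral>\<omega>. G \<omega> \<bullet> drift_inc R n i \<omega> + G \<omega> \<bullet> r \<omega> + G \<omega> \<bullet> (\<sigma> (Y \<omega>) *v D \<omega>) + 1/2 * (D \<omega> \<bullet> (T \<omega> *v D \<omega>))
     - (q * d * C\<^sup>2 * (norm (D \<omega>))\<^sup>2 + c * (2 * (k / real n)\<^sup>2 + 2 * (norm (r \<omega>))\<^sup>2) + 8 * K * C ^ 3 * norm (D \<omega>) ^ 3) \<partial>M)
     = (\<integral>\<omega>. G \<omega> \<bullet> drift_inc R n i \<omega> \<partial>M) + 1/2 * (1 / real n * (\<integral>\<omega>. trace (T \<omega>) \<partial>M))
     - (q * d * C\<^sup>2 * (\<integral>\<omega>. (norm (D \<omega>))\<^sup>2 \<partial>M) + c * (2 * (k / real n)\<^sup>2 + 2 * (\<integral>\<omega>. (norm (r \<omega>))\<^sup>2 \<partial>M)) + 8 * K * C ^ 3 * (\<integral>\<omega>. norm (D \<omega>) ^ 3 \<partial>M))"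
    using iu o1 o2 quad mom(1,3) r2(1) by (simp add: prob_space)
  finally have main: "(\<integral>\<omega>. A \<omega> * (f (step_end R n i \<omega>) - f (Y \<omega>)) \<partial>M) \<ge>
     (\<integral>\<omega>. G \<omega> \<bullet> drift_inc R n i \<omega> \<partial>M) + 1/2 * (1 / real n * (\<integral>\<omega>. trace (T \<omega>) \<partial>M))
     - (q * d * C\<^sup>2 * (\<integral>\<omega>. (norm (D \<omega>))\<^sup>2 \<partial>M) + c * (2 * (k / real n)\<^sup>2 + 2 * (\<integral>\<omega>. (norm (r \<omega>))\<^sup>2 \<partial>M)) + 8 * K * C ^ 3 * (\<integral>\<omega>. norm (D \<omega>) ^ 3 \<partial>M))" .
  have "q * d * C\<^sup>2 * (\<integral>\<omega>. (norm (D \<omega>))\<^sup>2 \<partial>M) = q * d * C\<^sup>2 * (real CARD('n) / real n)"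
    using mom(2) by simp
  moreover have "c * (2 * (k / real n)\<^sup>2 + 2 * (\<integral>\<omega>. (norm (r \<omega>))\<^sup>2 \<partial>M)) \<le> c * (2 * (k / real n)\<^sup>2 + 2 * (W / real n))"
    using r2 c0 by (intro mult_left_mono) auto
  moreover have "8 * K * C ^ 3 * (\<integral>\<omega>. norm (D \<omega>) ^ 3 \<partial>M) \<le> 8 * K * C ^ 3 * (2 * real CARD('n) ^ 4 * sqrt (1 / real n) ^ 3)"
    using mom(4) K(1) C_nonneg by (intro mult_left_mono) auto
  moreover have "(\<integral>\<omega>. A \<omega> * (g (Y \<omega>) \<bullet> drift_inc R n i \<omega> + trace (pullback (Y \<omega>)) / (2 * real n)) \<partial>M) =
     (\<integral>\<omega>. G \<omega> \<bullet> drift_inc R n i \<omega> \<partial>M) + 1/2 * (1 / real n * (\<integral>\<omega>. trace (T \<omega>) \<partial>M))"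
  proof -
    have "trace (T \<omega>) = A \<omega> * trace (pullback (Y \<omega>))" for \<omega>
      by (simp add: T_def trace_def sum_distrib_left)
    then have "A \<omega> * (g (Y \<omega>) \<bullet> drift_inc R n i \<omega> + trace (pullback (Y \<omega>)) / (2 * real n)) =
      G \<omega> \<bullet> drift_inc R n i \<omega> + trace (T \<omega>) * (1 / (2 * real n))" for \<omega>
      by (simp add: G_def algebra_simps)
    then show ?thesis using iu iT by simp
  qed
  ultimately show ?thesis using main by linarith
qed

lemma drift_pointwise:
  assumes n: "0 < n" "i \<le> n" and \<omega>: "\<omega> \<in> space M"
    and l: "0 \<le> l" "\<And>y. norm y \<le> R \<Longrightarrow> norm (g y) \<le> l"
  shows "indicat_real (stay R (real i / real n)) \<omega> * (g (X (real i / real n) \<omega>) \<bullet> drift_inc R n i \<omega>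
       + trace (pullback (X (real i / real n) \<omega>)) / (2 * real n))
    \<ge> h (X (real i / real n) \<omega>) / real n - c\<^sub>h / real n * indicator (space M - stay R 1) \<omega> - l * drift_error R n i \<omega>"
proof (cases "\<omega> \<in> stay R (real i / real n)")
  case True
  let ?y = "X (real i / real n) \<omega>"
  let ?e = "drift_inc R n i \<omega> - (1 / real n) *\<^sub>R \<beta> ?y"
  have "norm ?y \<le> R" using True by (simp add: stay_def)
  then have gl: "norm (g ?y) \<le> l" by (rule l(2))
  have "\<bar>g ?y \<bullet> ?e\<bar> \<le> norm (g ?y) * norm ?e" by (rule Cauchy_Schwarz_ineq2)
  also have "\<dots> \<le> l * norm ?e" using gl by (intro mult_right_mono) auto
  finally have e: "g ?y \<bullet> ?e \<ge> - (l * norm ?e)" by linarith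
  have "g ?y \<bullet> drift_inc R n i \<omega> = g ?y \<bullet> \<beta> ?y / real n + g ?y \<bullet> ?e"
    by (simp add: inner_diff_right)
  moreover have "h ?y / real n \<le> (g ?y \<bullet> \<beta> ?y + 1/2 * trace (pullback ?y)) / real n"
    using h_le[of ?y] by (intro divide_right_mono) (auto simp: pullback_def)
  moreover have "(g ?y \<bullet> \<beta> ?y + 1/2 * trace (pullback ?y)) / real n = g ?y \<bullet> \<beta> ?y / real n + trace (pullback ?y) / (2 * real n)"
    by (simp add: add_divide_distrib)
  moreover have "0 \<le> c\<^sub>h" using h_bound[of ?y] by linarith
  then have "0 \<le> c\<^sub>h / real n * indicator (space M - stay R 1) \<omega>" by simp
  ultimately show ?thesis using True e by (simp add: drift_error_def)
next
  case False
  have "real i / real n \<le> 1" using n by simp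
  then have "\<omega> \<notin> stay R 1" using False stay_antimono by blast
  moreover have "h (X (real i / real n) \<omega>) / real n \<le> c\<^sub>h / real n"
    using h_bound[of "X (real i / real n) \<omega>"] by (intro divide_right_mono) auto
  ultimately show ?thesis using False \<omega> by (simp add: drift_error_def)
qed

lemma f_X_integrable: "0 \<le> t \<Longrightarrow> integrable M (\<lambda>\<omega>. f (X t \<omega>))"
  by (rule integrable_const_bound[where B=c\<^sub>f])
    (use f_bound f_measurable X_measurable[of t] in \<open>auto intro: measurable_compose\<close>)

lemma h_X_integrable: "0 \<le> t \<Longrightarrow> integrable M (\<lambda>\<omega>. h (X t \<omega>))"
  by (rule integrable_const_bound[where B=c\<^sub>h])
    (use h_bound h_measurable X_measurable[of t] in \<open>auto intro: measurable_compose\<close>)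

text \<open>Summing the step estimates multiplies the errors by \<open>n\<close>: the Young term
  becomes a constant times \<open>d\<close>, while the others become \<open>W\<close> and terms of
  order 1/n and n^(-1/2).\<close>

lemma riemann_sum_le:
  assumes n: "0 < n"
    and K: "0 \<le> K" "\<And>y \<Delta>. norm y \<le> R \<Longrightarrow> f y + g y \<bullet> \<Delta> + 1/2 * (\<Delta> \<bullet> (Q y *v \<Delta>)) - K * min (norm \<Delta> ^ 2) (norm \<Delta> ^ 3) \<le> f (y + \<Delta>)"
    and q: "0 \<le> q" "\<And>y. norm y \<le> R \<Longrightarrow> norm (Q y) \<le> q"
    and l: "0 \<le> l" "\<And>y. norm y \<le> R \<Longrightarrow> norm (g y) \<le> l"
    and k: "0 \<le> k" "\<And>y. norm y \<le> R \<Longrightarrow> norm (\<beta> y) \<le> k" and d: "0 < d"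
  defines "c \<equiv> q / d + q / 2 + 4 * K" and "W \<equiv> \<integral>\<omega>. (modulus n \<omega>)\<^sup>2 \<partial>M"
  shows "(\<Sum>i<n. \<integral>\<omega>. h (X (real i / real n) \<omega>) \<partial>M) / real n \<le>
    (\<integral>\<omega>. f (X 1 \<omega>) \<partial>M) - f x + (4 * c\<^sub>f + c\<^sub>h) * prob (space M - stay R 1) + q * d * C\<^sup>2 * real CARD('n)
    + (l * (\<integral>\<omega>. (\<Sum>i<n. drift_error R n i \<omega>) \<partial>M) + c * (2 * k\<^sup>2 / real n + 2 * W)
       + 16 * K * C ^ 3 * real CARD('n) ^ 4 * sqrt (1 / real n))"
proof -
  let ?A = "\<lambda>i. indicat_real (stay R (real i / real n))" and ?Y = "\<lambda>i. X (real i / real n)"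
  let ?Z = "space M - stay R 1"
  let ?L = "\<lambda>i \<omega>. ?A i \<omega> * (f (step_end R n i \<omega>) - f (?Y i \<omega>))"
  let ?E = "q * d * C\<^sup>2 * (real CARD('n) / real n) + c * (2 * (k / real n)\<^sup>2 + 2 * (W / real n))
         + 8 * K * C ^ 3 * (2 * real CARD('n) ^ 4 * sqrt (1 / real n) ^ 3)"
  let ?H = "\<lambda>i \<omega>. h (?Y i \<omega>) / real n - c\<^sub>h / real n * indicat_real ?Z \<omega> - l * drift_error R n i \<omega>"
  have Zm: "?Z \<in> events" by simp
  have iZ: "integrable M (indicat_real ?Z)"
    by (rule integrable_const_bound[where B=1]) (use Zm in auto)
  have EZ: "(\<integral>\<omega>. indicat_real ?Z \<omega> \<partial>M) = prob ?Z" using Zm by (simp add: Int_absorb2)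
  note [measurable] = measurable_compose[OF _ f_measurable] measurable_compose[OF _ g_measurable] measurable_compose[OF _ trace_pullback_measurable]
  have ide: "integrable M (drift_error R n i)" for i
    by (rule integrable_const_bound[where B="2 * k / real n"])
      (use drift_error_bound[OF k(2,1)] drift_error_nonneg in auto)
  have iL: "integrable M (?L i)" for i
  proof (rule integrable_const_bound[where B="2 * c\<^sub>f"])
    have "\<bar>?L i \<omega>\<bar> \<le> 2 * c\<^sub>f" for \<omega>
      using f_bound[of "step_end R n i \<omega>"] f_bound[of "?Y i \<omega>"] by (auto simp: indicator_def)
    then show "AE \<omega> in M. norm (?L i \<omega>) \<le> 2 * c\<^sub>f" by simp
  qed measurable
  have "(\<integral>\<omega>. ?H i \<omega> \<partial>M) - ?E \<le> (\<integral>\<omega>. ?L i \<omega> \<partial>M)" if i: "i < n" for i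
  proof -
    have iH: "integrable M (?H i)" using h_X_integrable[of "real i / real n"] iZ ide by simp
    have "(\<integral>\<omega>. ?H i \<omega> \<partial>M) \<le> (\<integral>\<omega>. ?A i \<omega> * (g (?Y i \<omega>) \<bullet> drift_inc R n i \<omega> + trace (pullback (?Y i \<omega>)) / (2 * real n)) \<partial>M)"
    proof (rule integral_mono[OF iH])
      obtain sb where sb: "0 \<le> sb" "\<And>y. norm y \<le> R \<Longrightarrow> norm (pullback y) \<le> sb"
        using bounded_on_cball[where R=R, OF pullback_cont] by metis
      have tr: "\<bar>trace (pullback y)\<bar> \<le> real CARD('n) * sb" if "norm y \<le> R" for y
      proof -
        have "\<bar>pullback y $ j $ j\<bar> \<le> sb" for j
          by (rule order_trans[OF abs_matrix_nth_le sb(2)[OF that]])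
        then have "(\<Sum>j\<in>UNIV. \<bar>pullback y $ j $ j\<bar>) \<le> (\<Sum>j\<in>(UNIV::'n set). sb)" by (intro sum_mono) auto
        then have "\<bar>\<Sum>j\<in>UNIV. pullback y $ j $ j\<bar> \<le> (\<Sum>j\<in>(UNIV::'n set). sb)" by (rule order_trans[OF sum_abs])
        then show ?thesis unfolding trace_def by simp
      qed
      show "integrable M (\<lambda>\<omega>. ?A i \<omega> * (g (?Y i \<omega>) \<bullet> drift_inc R n i \<omega> + trace (pullback (?Y i \<omega>)) / (2 * real n)))"
      proof (rule integrable_const_bound[where B="l * (k / real n) + real CARD('n) * sb / (2 * real n)"])
        have "\<bar>?A i \<omega> * (g (?Y i \<omega>) \<bullet> drift_inc R n i \<omega> + trace (pullback (?Y i \<omega>)) / (2 * real n))\<bar> \<le>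
          l * (k / real n) + real CARD('n) * sb / (2 * real n)" for \<omega>
        proof (cases "\<omega> \<in> stay R (real i / real n)")
          case True
          then have y: "norm (?Y i \<omega>) \<le> R" by (simp add: stay_def)
          have "\<bar>g (?Y i \<omega>) \<bullet> drift_inc R n i \<omega>\<bar> \<le> norm (g (?Y i \<omega>)) * norm (drift_inc R n i \<omega>)"
            by (rule Cauchy_Schwarz_ineq2)
          also have "\<dots> \<le> l * (k / real n)"
            using l(2)[OF y] drift_inc_bound[OF k(2) True] l(1) by (intro mult_mono) auto
          finally have 1: "\<bar>g (?Y i \<omega>) \<bullet> drift_inc R n i \<omega>\<bar> \<le> l * (k / real n)" .
          have "\<bar>trace (pullback (?Y i \<omega>)) / (2 * real n)\<bar> \<le> real CARD('n) * sb / (2 * real n)"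
            using tr[OF y] by (simp add: divide_right_mono)
          with 1 have "\<bar>g (?Y i \<omega>) \<bullet> drift_inc R n i \<omega> + trace (pullback (?Y i \<omega>)) / (2 * real n)\<bar> \<le>
            l * (k / real n) + real CARD('n) * sb / (2 * real n)" by linarith
          with True show ?thesis by simp
        next
          case False
          then show ?thesis using l k sb by simp
        qed
        then show "AE \<omega> in M. norm (?A i \<omega> * (g (?Y i \<omega>) \<bullet> drift_inc R n i \<omega> + trace (pullback (?Y i \<omega>)) / (2 * real n))) \<le>
          l * (k / real n) + real CARD('n) * sb / (2 * real n)" by simp
      qed measurable
      fix \<omega> assume "\<omega> \<in> space M"
      then show "?H i \<omega> \<le> ?A i \<omega> * (g (?Y i \<omega>) \<bullet> drift_inc R n i \<omega> + trace (pullback (?Y i \<omega>)) / (2 * real n))"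
        by (rule drift_pointwise[where R=R, OF n less_imp_le[OF i] _ l])
    qed
    with step_estimate[where R=R, OF n i K q l k d, folded c_def W_def] show ?thesis by linarith
  qed
  then have "(\<Sum>i<n. (\<integral>\<omega>. ?H i \<omega> \<partial>M) - ?E) \<le> (\<Sum>i<n. \<integral>\<omega>. ?L i \<omega> \<partial>M)" by (intro sum_mono) simp
  also have "\<dots> = (\<integral>\<omega>. (\<Sum>i<n. ?L i \<omega>) \<partial>M)"
    by (rule Bochner_Integration.integral_sum[symmetric]) (rule iL)
  also have "\<dots> \<le> (\<integral>\<omega>. f (X 1 \<omega>) - f (X 0 \<omega>) + 4 * c\<^sub>f * indicat_real ?Z \<omega> \<partial>M)"
    proof (rule integral_mono[OF Bochner_Integration.integrable_sum[OF iL]])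
    show "integrable M (\<lambda>\<omega>. f (X 1 \<omega>) - f (X 0 \<omega>) + 4 * c\<^sub>f * indicat_real ?Z \<omega>)"
      using f_X_integrable[of 0] f_X_integrable[of 1] iZ by simp
    fix \<omega> assume \<omega>: "\<omega> \<in> space M"
    have e: "real n / real n = 1" "real 0 / real n = 0" using n by simp_all
    show "(\<Sum>i<n. ?L i \<omega>) \<le> f (X 1 \<omega>) - f (X 0 \<omega>) + 4 * c\<^sub>f * indicat_real ?Z \<omega>"
      by (rule telescoping[OF \<omega>, of R n, unfolded e])
  qed
  also have "\<dots> = (\<integral>\<omega>. f (X 1 \<omega>) \<partial>M) - (\<integral>\<omega>. f (X 0 \<omega>) \<partial>M) + 4 * c\<^sub>f * prob ?Z"
    using f_X_integrable[of 0] f_X_integrable[of 1] iZ EZ by simp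
  also have "(\<integral>\<omega>. f (X 0 \<omega>) \<partial>M) = (\<integral>\<omega>. f x \<partial>M)"
    by (rule integral_cong_AE) (use X_start f_measurable X_measurable[of 0] in \<open>auto intro: measurable_compose\<close>)
  also have "\<dots> = f x" by (simp add: prob_space)
  finally have 1: "(\<Sum>i<n. (\<integral>\<omega>. ?H i \<omega> \<partial>M) - ?E) \<le> (\<integral>\<omega>. f (X 1 \<omega>) \<partial>M) - f x + 4 * c\<^sub>f * prob ?Z" .
  have "(\<integral>\<omega>. ?H i \<omega> \<partial>M) = (\<integral>\<omega>. h (?Y i \<omega>) \<partial>M) / real n - c\<^sub>h / real n * prob ?Z - l * (\<integral>\<omega>. drift_error R n i \<omega> \<partial>M)" for i
    using h_X_integrable[of "real i / real n"] iZ EZ ide by simp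
  then have "(\<Sum>i<n. (\<integral>\<omega>. ?H i \<omega> \<partial>M) - ?E) = (\<Sum>i<n. \<integral>\<omega>. h (?Y i \<omega>) \<partial>M) / real n - real n * (c\<^sub>h / real n * prob ?Z)
    - l * (\<Sum>i<n. \<integral>\<omega>. drift_error R n i \<omega> \<partial>M) - real n * ?E"
    by (simp only: sum_subtractf sum_divide_distrib sum_distrib_left sum_constant card_lessThan)
  moreover have "real n * (c\<^sub>h / real n * prob ?Z) = c\<^sub>h * prob ?Z" using n by simp
  moreover have "(\<Sum>i<n. \<integral>\<omega>. drift_error R n i \<omega> \<partial>M) = (\<integral>\<omega>. (\<Sum>i<n. drift_error R n i \<omega>) \<partial>M)"
    using ide by (simp add: Bochner_Integration.integral_sum)
  moreover have "real n * ?E = q * d * C\<^sup>2 * real CARD('n) + (c * (2 * k\<^sup>2 / real n + 2 * W)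
       + 16 * K * C ^ 3 * real CARD('n) ^ 4 * sqrt (1 / real n))"
  proof -
    have "real n * (q * d * C\<^sup>2 * (real CARD('n) / real n)) = q * d * C\<^sup>2 * real CARD('n)" using n by simp
    moreover have "real n * (c * (2 * (k / real n)\<^sup>2 + 2 * (W / real n))) = c * (2 * k\<^sup>2 / real n + 2 * W)"
      using n by (simp add: field_simps power2_eq_square)
    moreover have "sqrt (1 / real n) ^ 3 = 1 / real n * sqrt (1 / real n)" by (simp add: power3_eq_cube)
    then have "real n * (8 * K * C ^ 3 * (2 * real CARD('n) ^ 4 * sqrt (1 / real n) ^ 3)) =
       16 * K * C ^ 3 * real CARD('n) ^ 4 * sqrt (1 / real n)" using n by simp
    ultimately show ?thesis by (simp only: distrib_left add.assoc)
  qed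
  ultimately show ?thesis using 1 by (simp add: distrib_right)
qed

text \<open>The constants are fixed in this order: the radius from the exit probability, the local
  bounds on that ball, \<open>d\<close> for the Young term, and finally \<open>n\<close>, which may
  depend on all of them.\<close>

lemma riemann_sum_limit:
  assumes \<epsilon>: "0 < \<epsilon>"
  shows "\<forall>\<^sub>F n in sequentially. (\<Sum>i<n. \<integral>\<omega>. h (X (real i / real n) \<omega>) \<partial>M) / real n \<le> (\<integral>\<omega>. f (X 1 \<omega>) \<partial>M) - f x + \<epsilon>"
proof -
  have "(\<lambda>R. (4 * c\<^sub>f + c\<^sub>h) * prob (space M - stay (real R) 1)) \<longlonglongrightarrow> (4 * c\<^sub>f + c\<^sub>h) * 0"
    by (intro tendsto_intros leave_tendsto)
  then have "\<forall>\<^sub>F R in sequentially. (4 * c\<^sub>f + c\<^sub>h) * prob (space M - stay (real R) 1) < \<epsilon> / 3"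
    by (rule order_tendstoD) (use \<epsilon> in simp)
  then obtain R' :: nat where R': "(4 * c\<^sub>f + c\<^sub>h) * prob (space M - stay (real R') 1) < \<epsilon> / 3"
    by (auto simp: eventually_sequentially)
  define R where "R = real R'"
  obtain K where K: "0 \<le> K" "\<And>y \<Delta>. norm y \<le> R \<Longrightarrow> f y + g y \<bullet> \<Delta> + 1/2 * (\<Delta> \<bullet> (Q y *v \<Delta>)) - K * min (norm \<Delta> ^ 2) (norm \<Delta> ^ 3) \<le> f (y + \<Delta>)"
    using taylor[of R] by blast
  obtain q where q: "0 \<le> q" "\<And>y. norm y \<le> R \<Longrightarrow> norm (Q y) \<le> q" using bounded_on_cball[where R=R, OF Q_cont] by metis
  obtain l where l: "0 \<le> l" "\<And>y. norm y \<le> R \<Longrightarrow> norm (g y) \<le> l" using bounded_on_cball[where R=R, OF g_cont] by metis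
  obtain k where k: "0 \<le> k" "\<And>y. norm y \<le> R \<Longrightarrow> norm (\<beta> y) \<le> k" using bounded_on_cball[where R=R, OF cont_\<beta>] by metis
  \<comment> \<open>Holds the Young term below a third of \<open>\<epsilon>\<close>; the added 1
    covers a vanishing \<open>q\<close> or \<open>C\<close>.\<close>
  define d where "d = \<epsilon> / (3 * (q * C\<^sup>2 * real CARD('n) + 1))"
  have pos: "0 \<le> q * C\<^sup>2 * real CARD('n)" using q by simp
  have d: "0 < d" "q * d * C\<^sup>2 * real CARD('n) \<le> \<epsilon> / 3"
    using \<epsilon> pos by (auto simp: d_def field_simps add_pos_nonneg)
  define c where "c = q / d + q / 2 + 4 * K"
  have "(\<lambda>n. l * (\<integral>\<omega>. (\<Sum>i<n. drift_error R n i \<omega>) \<partial>M) + c * (2 * k\<^sup>2 / real n + 2 * (\<integral>\<omega>. (modulus n \<omega>)\<^sup>2 \<partial>M))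
       + 16 * K * C ^ 3 * real CARD('n) ^ 4 * sqrt (1 / real n)) \<longlonglongrightarrow>
       l * 0 + c * (0 + 2 * 0) + 16 * K * C ^ 3 * real CARD('n) ^ 4 * sqrt 0"
    by (intro tendsto_intros drift_error_sum_tendsto[OF k(2,1)] modulus_sq_tendsto lim_const_over_n lim_1_over_n)
  then have "\<forall>\<^sub>F n in sequentially. l * (\<integral>\<omega>. (\<Sum>i<n. drift_error R n i \<omega>) \<partial>M) + c * (2 * k\<^sup>2 / real n + 2 * (\<integral>\<omega>. (modulus n \<omega>)\<^sup>2 \<partial>M))
       + 16 * K * C ^ 3 * real CARD('n) ^ 4 * sqrt (1 / real n) < \<epsilon> / 3"
    by (rule order_tendstoD) (use \<epsilon> in simp)
  then show ?thesis
    using eventually_gt_at_top[of 0]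
  proof eventually_elim
    case (elim n)
    from riemann_sum_le[where R=R, OF elim(2) K q l k d(1), folded c_def] elim(1) d(2) R'[folded R_def]
    show ?case by linarith
  qed
qed

end

section \<open>Smooth functions and Taylor's formula\<close>

lemma differentiable_frechet:
  "f differentiable (at x) \<Longrightarrow> (f has_derivative frechet_derivative f (at x)) (at x)"
  by (simp add: frechet_derivative_works)

lemma times_cont_diff_Suc: "times_cont_diff (Suc k) f \<Longrightarrow> times_cont_diff k f"
proof (induction k arbitrary: f)
  case 0
  then show ?case by (simp add: continuous_on_eq_continuous_at differentiable_imp_continuous_within)
next
  case (Suc k)
  from Suc.prems have "\<forall>x. f differentiable (at x)" "\<And>i. times_cont_diff (Suc k) (part_deriv i f)"
    unfolding times_cont_diff.simps(2)[of "Suc k" f] by blast+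
  with Suc.IH show ?case by (simp only: times_cont_diff.simps(2)) blast
qed

lemma smooth_differentiable: "smooth f \<Longrightarrow> f differentiable (at x)"
  unfolding smooth_def using times_cont_diff.simps(2) by blast

lemma smooth_part_deriv: "smooth f \<Longrightarrow> smooth (part_deriv i f)"
  unfolding smooth_def using times_cont_diff.simps(2) by blast

lemma smooth_continuous: "smooth f \<Longrightarrow> continuous_on UNIV f"
  unfolding smooth_def using times_cont_diff.simps(1) by blast

section \<open>Calculus of partial derivatives and closure of smooth functions\<close>

lemma part_deriv_add:
  "f differentiable (at x) \<Longrightarrow> g differentiable (at x) \<Longrightarrow>
     part_deriv i (\<lambda>x. f x + g x) x = part_deriv i f x + part_deriv i g x"
  unfolding part_deriv_def
  by (subst frechet_derivative_at[OF has_derivative_add[OF differentiable_frechet differentiable_frechet], symmetric]) auto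

lemma part_deriv_diff:
  "f differentiable (at x) \<Longrightarrow> g differentiable (at x) \<Longrightarrow>
     part_deriv i (\<lambda>x. f x - g x) x = part_deriv i f x - part_deriv i g x"
  unfolding part_deriv_def
  by (subst frechet_derivative_at[OF has_derivative_diff[OF differentiable_frechet differentiable_frechet], symmetric]) auto

lemma part_deriv_mult:
  "f differentiable (at x) \<Longrightarrow> g differentiable (at x) \<Longrightarrow>
     part_deriv i (\<lambda>x. f x * g x) x = f x * part_deriv i g x + part_deriv i f x * g x"
  unfolding part_deriv_def
  by (subst frechet_derivative_at[OF has_derivative_mult[OF differentiable_frechet differentiable_frechet], symmetric]) auto

lemma part_deriv_const: "part_deriv i (\<lambda>x. c) = (\<lambda>x. 0)"
  by (rule ext) (simp add: part_deriv_def)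

lemma part_deriv_sum:
  assumes "finite I" "\<And>j. j \<in> I \<Longrightarrow> f j differentiable (at x)"
  shows "part_deriv i (\<lambda>x. \<Sum>j\<in>I. f j x) x = (\<Sum>j\<in>I. part_deriv i (f j) x)"
  using assms
  by (induction I rule: finite_induct) (simp_all add: part_deriv_const part_deriv_add)

lemma part_deriv_chain:
  assumes "f differentiable (at x)" "(\<phi> has_real_derivative D) (at (f x))"
  shows "part_deriv i (\<lambda>x. \<phi> (f x)) x = D * part_deriv i f x"
proof -
  have "((\<lambda>x. \<phi> (f x)) has_derivative (\<lambda>v. D * frechet_derivative f (at x) v)) (at x)"
    using has_derivative_compose[OF differentiable_frechet[OF assms(1)] assms(2)[unfolded has_field_derivative_def]]
    by (simp add: comp_def)
  from frechet_derivative_at[OF this, symmetric] show ?thesis by (simp add: part_deriv_def)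
qed

lemma times_cont_diff_const: "times_cont_diff k (\<lambda>x. c)"
  by (induction k arbitrary: c) (simp_all add: part_deriv_const)

lemma times_cont_diff_add:
  "times_cont_diff k f \<Longrightarrow> times_cont_diff k g \<Longrightarrow> times_cont_diff k (\<lambda>x. f x + g x)"
proof (induction k arbitrary: f g)
  case (Suc k)
  then have "part_deriv i (\<lambda>x. f x + g x) = (\<lambda>x. part_deriv i f x + part_deriv i g x)" for i
    by (intro ext part_deriv_add) auto
  with Suc show ?case by simp
qed (simp add: continuous_on_add)

lemma times_cont_diff_mult:
  "times_cont_diff k f \<Longrightarrow> times_cont_diff k g \<Longrightarrow> times_cont_diff k (\<lambda>x. f x * g x)"
proof (induction k arbitrary: f g)
  case (Suc k)
  have "part_deriv i (\<lambda>x. f x * g x) = (\<lambda>x. f x * part_deriv i g x + part_deriv i f x * g x)" for i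
    using Suc.prems by (intro ext part_deriv_mult) auto
  moreover have "times_cont_diff k f" "times_cont_diff k g" using Suc.prems times_cont_diff_Suc by auto
  ultimately show ?case using Suc.prems by (auto intro!: times_cont_diff_add Suc.IH)
qed (simp add: continuous_on_mult)

lemma smooth_diff:
  assumes "smooth f" "smooth g" shows "smooth (\<lambda>x. f x - g x)"
proof -
  have "times_cont_diff k (\<lambda>x. f x + (-1) * g x)" for k
    using assms by (intro times_cont_diff_add times_cont_diff_mult times_cont_diff_const) (auto simp: smooth_def)
  then show ?thesis by (simp add: smooth_def)
qed

lemma tanh_has_real_derivative: "((\<lambda>z. tanh (e * z)) has_real_derivative e * (1 - (tanh (e * z))\<^sup>2)) (at z)"
  for e z :: real
  by (auto intro!: derivative_eq_intros)

lemma differentiable_tanh: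
  assumes "f differentiable (at x)" shows "(\<lambda>x. tanh (e * f x :: real)) differentiable (at x)"
proof -
  have "((\<lambda>x. tanh (e * f x)) has_derivative (\<lambda>v. e * (1 - (tanh (e * f x))\<^sup>2) * frechet_derivative f (at x) v)) (at x)"
    using has_derivative_compose[OF differentiable_frechet[OF assms]
        tanh_has_real_derivative[of e "f x", unfolded has_field_derivative_def]]
    by (simp add: comp_def)
  then show ?thesis by (rule differentiableI)
qed

text \<open>The partial derivatives of T = tanh (e f) are (e - e T^2) times those of f. This
  expression is a polynomial in T, so the order of differentiability of T can be raised by
  induction.\<close>

lemma smooth_tanh:
  assumes f: "smooth f" shows "smooth (\<lambda>x. tanh (e * f x))"
proof -
  let ?T = "\<lambda>x. tanh (e * f x)"
  have pd: "part_deriv i ?T = (\<lambda>x. (e + (- e) * (?T x * ?T x)) * part_deriv i f x)" for i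
    using part_deriv_chain[OF smooth_differentiable[OF f] tanh_has_real_derivative]
    by (simp add: fun_eq_iff algebra_simps power2_eq_square)
  have "times_cont_diff k ?T" for k
  proof (induction k)
    case 0
    show ?case using smooth_continuous[OF f] by (auto intro!: continuous_intros simp: less_imp_neq[OF cosh_real_pos, symmetric])
  next
    case (Suc k)
    have "times_cont_diff k (part_deriv i f)" for i using smooth_part_deriv[OF f] by (simp add: smooth_def)
    with Suc have "times_cont_diff k (part_deriv i ?T)" for i
      unfolding pd by (intro times_cont_diff_mult times_cont_diff_add times_cont_diff_const)
    then show ?case using differentiable_tanh[OF smooth_differentiable[OF f]] by simp
  qed
  then show ?thesis by (simp add: smooth_def)
qed

section \<open>Taylor's formula along segments\<close>

lemma frechet_derivative_eq_sum:
  assumes "f differentiable (at z)"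
  shows "frechet_derivative f (at z) v = (\<Sum>i\<in>UNIV. v $ i * part_deriv i f z)"
proof -
  have lin: "linear (frechet_derivative f (at z))"
    by (rule linear_frechet_derivative[OF assms])
  have "frechet_derivative f (at z) v = frechet_derivative f (at z) (\<Sum>i\<in>UNIV. v $ i *\<^sub>R axis i 1)"
    using basis_expansion[of v] by (simp add: scalar_mult_eq_scaleR)
  also have "\<dots> = (\<Sum>i\<in>UNIV. v $ i * part_deriv i f z)"
    by (simp add: linear_sum[OF lin] linear_cmul[OF lin] part_deriv_def)
  finally show ?thesis .
qed

lemma has_real_derivative_along_line:
  assumes "\<And>z. f differentiable (at z)"
  shows "((\<lambda>s. f (y + s *\<^sub>R v)) has_real_derivative (\<Sum>i\<in>UNIV. v $ i * part_deriv i f (y + s *\<^sub>R v))) (at s)"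
proof -
  have 1: "((\<lambda>s. y + s *\<^sub>R v) has_derivative (\<lambda>h. h *\<^sub>R v)) (at s)"
    by (auto intro!: derivative_eq_intros)
  have lin: "linear (frechet_derivative f (at (y + s *\<^sub>R v)))"
    by (rule linear_frechet_derivative[OF assms])
  have "((\<lambda>s. f (y + s *\<^sub>R v)) has_derivative (\<lambda>h. frechet_derivative f (at (y + s *\<^sub>R v)) (h *\<^sub>R v))) (at s)"
    using has_derivative_compose[OF 1 differentiable_frechet[OF assms]] by (simp add: comp_def)
  then have "((\<lambda>s. f (y + s *\<^sub>R v)) has_derivative (\<lambda>h. h * frechet_derivative f (at (y + s *\<^sub>R v)) v)) (at s)"
    by (simp add: linear_cmul[OF lin])
  moreover have "(\<lambda>h. h * c) = (*) c" for c :: real by (simp add: fun_eq_iff)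
  ultimately show ?thesis
    unfolding has_field_derivative_def frechet_derivative_eq_sum[OF assms] by simp
qed

text \<open>The order of differentiation is tied to the indices; where the transposed order turns
  up, an exchange of sums or the symmetry of \<open>a\<close> accounts for it.\<close>

definition hessian :: "(real^'n::finite \<Rightarrow> real) \<Rightarrow> real^'n \<Rightarrow> real^'n^'n" where
  "hessian f y = (\<chi> i j. part_deriv i (part_deriv j f) y)"

lemma grad_continuous: "smooth f \<Longrightarrow> continuous_on UNIV (grad f)"
  unfolding grad_def[abs_def] by (intro continuous_on_vec_lambda smooth_continuous smooth_part_deriv)

lemma hessian_continuous: "smooth f \<Longrightarrow> continuous_on UNIV (hessian f)"
  unfolding hessian_def[abs_def] by (intro continuous_on_vec_lambda smooth_continuous smooth_part_deriv)

text \<open>For |v| \<le> 1, Maclaurin's formula of third order along the segment, which stays in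
  the ball of radius R + 1. For longer \<open>v\<close> every term, including the difference of
  values of the bounded \<open>f\<close>, is at most a constant times |v|^2.\<close>

lemma taylor_lower_bound:
  fixes f :: "real^'n::finite \<Rightarrow> real"
  assumes f: "smooth f" and bnd: "\<And>y. \<bar>f y\<bar> \<le> F"
  shows "\<exists>K\<ge>0. \<forall>y v. norm y \<le> R \<longrightarrow>
      f y + grad f y \<bullet> v + 1/2 * (v \<bullet> (hessian f y *v v)) - K * min (norm v ^ 2) (norm v ^ 3) \<le> f (y + v)"
proof -
  define T where "T y = (\<Sum>k\<in>UNIV. \<Sum>j\<in>UNIV. \<Sum>i\<in>UNIV. \<bar>part_deriv i (part_deriv j (part_deriv k f)) y\<bar>)" for y
  have Tc: "continuous_on UNIV T"
    unfolding T_def[abs_def] by (intro continuous_intros smooth_continuous smooth_part_deriv f)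
  obtain t where t: "0 \<le> t" "\<And>y. norm y \<le> R + 1 \<Longrightarrow> norm (T y) \<le> t" using bounded_on_cball[where R="R + 1", OF Tc] by metis
  obtain l where l: "0 \<le> l" "\<And>y. norm y \<le> R \<Longrightarrow> norm (grad f y) \<le> l" using bounded_on_cball[where R=R, OF grad_continuous[OF f]] by metis
  obtain q where q: "0 \<le> q" "\<And>y. norm y \<le> R \<Longrightarrow> norm (hessian f y) \<le> q" using bounded_on_cball[where R=R, OF hessian_continuous[OF f]] by metis
  have F: "0 \<le> F" using bnd[of 0] by linarith
  \<comment> \<open>\<open>t\<close> pays for the short increments, the other three summands for the
    long ones; their sum is one constant for both cases.\<close>
  define K where "K = t + 2 * F + l + q"
  have "f y + grad f y \<bullet> v + 1/2 * (v \<bullet> (hessian f y *v v)) - K * min (norm v ^ 2) (norm v ^ 3) \<le> f (y + v)"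
    if y: "norm y \<le> R" for y v
  proof (cases "norm v \<le> 1")
    case True
    define d0 where "d0 s = f (y + s *\<^sub>R v)" for s
    define d1 where "d1 s = (\<Sum>k\<in>UNIV. v $ k * part_deriv k f (y + s *\<^sub>R v))" for s
    define d2 where "d2 s = (\<Sum>k\<in>UNIV. v $ k * (\<Sum>j\<in>UNIV. v $ j * part_deriv j (part_deriv k f) (y + s *\<^sub>R v)))" for s
    define d3 where "d3 s = (\<Sum>k\<in>UNIV. v $ k * (\<Sum>j\<in>UNIV. v $ j * (\<Sum>i\<in>UNIV. v $ i * part_deriv i (part_deriv j (part_deriv k f)) (y + s *\<^sub>R v))))" for s
    have D: "((\<lambda>s. u (y + s *\<^sub>R v)) has_real_derivative (\<Sum>i\<in>UNIV. v $ i * part_deriv i u (y + s *\<^sub>R v))) (at s)"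
      if "smooth u" for u s
      by (rule has_real_derivative_along_line[OF smooth_differentiable[OF that]])
    have "(d0 has_real_derivative d1 s) (at s)" for s
      unfolding d0_def d1_def by (rule D[OF f])
    moreover have "(d1 has_real_derivative d2 s) (at s)" for s
      unfolding d1_def d2_def by (intro DERIV_sum DERIV_cmult D smooth_part_deriv f)
    moreover have "(d2 has_real_derivative d3 s) (at s)" for s
      unfolding d2_def d3_def by (intro DERIV_sum DERIV_cmult D smooth_part_deriv f)
    ultimately have D3: "(d0 has_real_derivative d1 s) (at s)" "(d1 has_real_derivative d2 s) (at s)"
      "(d2 has_real_derivative d3 s) (at s)" for s by blast+
    \<comment> \<open>The successive derivatives along the segment, packed as the family indexed by
      order that \<open>Maclaurin\<close> expects.\<close>
    define dd where "dd m = (if m = 0 then d0 else if m = 1 then d1 else if m = 2 then d2 else d3)" for m :: nat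
    have "\<exists>s>0. s < 1 \<and> d0 1 = (\<Sum>m<3. dd m 0 / fact m * 1 ^ m) + dd 3 s / fact 3 * 1 ^ 3"
    proof (rule Maclaurin)
      show "\<forall>m s. m < 3 \<and> 0 \<le> s \<and> s \<le> 1 \<longrightarrow> DERIV (dd m) s :> dd (Suc m) s"
        using D3 by (auto simp: dd_def less_Suc_eq numeral_3_eq_3)
    qed (simp_all add: dd_def)
    then obtain s where s: "0 < s" "s < 1" "d0 1 = d0 0 + d1 0 + d2 0 / 2 + d3 s / 6"
      by (auto simp: dd_def numeral_3_eq_3 numeral_2_eq_2)
    have ns: "norm (y + s *\<^sub>R v) \<le> R + 1"
    proof -
      have "norm (s *\<^sub>R v) \<le> 1" using s True by (simp add: mult_le_one)
      then show ?thesis using norm_triangle_ineq[of y "s *\<^sub>R v"] y by linarith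
    qed
    have vn: "\<bar>v $ i\<bar> \<le> norm v" for i by (rule component_le_norm_cart)
    have "\<bar>d3 s\<bar> \<le> (\<Sum>k\<in>UNIV. norm v * (\<Sum>j\<in>UNIV. norm v * (\<Sum>i\<in>UNIV. norm v * \<bar>part_deriv i (part_deriv j (part_deriv k f)) (y + s *\<^sub>R v)\<bar>)))"
      unfolding d3_def
      by (intro order_trans[OF sum_abs] sum_mono) (auto simp: abs_mult intro!: mult_mono vn order_trans[OF sum_abs] sum_mono sum_nonneg)
    also have "\<dots> = norm v ^ 3 * T (y + s *\<^sub>R v)"
      by (simp add: T_def sum_distrib_left power3_eq_cube mult.assoc)
    also have "\<dots> \<le> norm v ^ 3 * t" using t(2)[OF ns] by (intro mult_left_mono) auto
    finally have d3: "\<bar>d3 s\<bar> \<le> norm v ^ 3 * t" .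
    have m: "min (norm v ^ 2) (norm v ^ 3) = norm v ^ 3"
      using True by (intro min_absorb2 power_decreasing) auto
    have "norm v ^ 3 * t \<le> K * norm v ^ 3"
      using F l q t by (subst mult.commute) (intro mult_right_mono, auto simp: K_def)
    moreover have "d0 0 = f y" "d0 1 = f (y + v)" by (simp_all add: d0_def)
    moreover have "d1 0 = grad f y \<bullet> v" by (simp add: d1_def grad_def inner_vec_def mult.commute)
    moreover have "d2 0 = v \<bullet> (hessian f y *v v)"
      unfolding d2_def hessian_def by (simp add: inner_vec_def matrix_vector_mult_def sum_distrib_left)
        (subst sum.swap, simp add: ac_simps)
    moreover have "0 \<le> norm v ^ 3 * t" using t by simp
    ultimately show ?thesis using s(3) d3 unfolding m by linarith
  next
    case False
    then have v1: "1 \<le> norm v" by simp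
    then have n2: "1 \<le> norm v ^ 2" "norm v \<le> norm v ^ 2"
      by (rule one_le_power) (rule self_le_power[OF v1], simp)
    have m: "min (norm v ^ 2) (norm v ^ 3) = norm v ^ 2"
      using v1 by (intro min_absorb1 power_increasing) auto
    have "\<bar>grad f y \<bullet> v\<bar> \<le> l * norm v ^ 2"
    proof -
      have "\<bar>grad f y \<bullet> v\<bar> \<le> norm (grad f y) * norm v" by (rule Cauchy_Schwarz_ineq2)
      also have "\<dots> \<le> l * norm v ^ 2" using l y n2 by (intro mult_mono) auto
      finally show ?thesis .
    qed
    moreover have "\<bar>v \<bullet> (hessian f y *v v)\<bar> \<le> q * norm v ^ 2"
    proof -
      have "\<bar>v \<bullet> (hessian f y *v v)\<bar> \<le> norm (hessian f y) * (norm v * norm v)" by (rule quadratic_form_le)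
      also have "\<dots> \<le> q * norm v ^ 2" unfolding power2_eq_square using q(2)[OF y] by (intro mult_right_mono) auto
      finally show ?thesis .
    qed
    moreover have "f y - f (y + v) \<le> 2 * F * norm v ^ 2"
    proof -
      have "f y - f (y + v) \<le> 2 * F * 1" using bnd[of y] bnd[of "y + v"] by linarith
      also have "\<dots> \<le> 2 * F * norm v ^ 2" using n2 F by (intro mult_left_mono) auto
      finally show ?thesis .
    qed
    moreover have "K * norm v ^ 2 = t * norm v ^ 2 + 2 * F * norm v ^ 2 + l * norm v ^ 2 + q * norm v ^ 2"
      by (simp add: K_def algebra_simps)
    moreover have "0 \<le> t * norm v ^ 2" "0 \<le> q * norm v ^ 2" using t q by auto
    ultimately show ?thesis unfolding m by linarith
  qed
  moreover have "0 \<le> K" using F l q t by (simp add: K_def)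
  ultimately show ?thesis by blast
qed

section \<open>Square roots of matrices and the generator\<close>

lemma symmetric_dot: "transpose S = S \<Longrightarrow> u \<bullet> (S *v w) = (S *v u) \<bullet> (w :: real^'n::finite)"
  by (metis dot_lmul_matrix transpose_matrix_vector)

lemma inner_transpose: "transpose A \<bullet> transpose B = A \<bullet> (B :: real^'n::finite^'n)"
  unfolding inner_vec_def transpose_def by simp (subst sum.swap, simp)

text \<open>The inner product of matrices is taken row by row, and for a symmetric \<open>T\<close>
  the i-th row of \<open>D ** T\<close> is \<open>T\<close> applied to the i-th row of
  \<open>D\<close>.\<close>

lemma inner_matrix_mult_symmetric:
  fixes D T :: "real^'n::finite^'n"
  assumes "transpose T = T"
  shows "D \<bullet> (D ** T) = (\<Sum>i\<in>UNIV. (D $ i) \<bullet> (T *v (D $ i)))"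
proof -
  have T: "T $ k $ j = T $ j $ k" for j k
  proof -
    have "transpose T $ j $ k = T $ j $ k" using assms by simp
    then show ?thesis by (simp add: transpose_def)
  qed
  have "(D ** T) $ i = T *v (D $ i)" for i
    unfolding vec_eq_iff matrix_matrix_mult_def matrix_vector_mult_def
    by (simp add: T mult.commute)
  then show ?thesis by (simp add: inner_vec_def[of D])
qed

lemma matrix_diff_left: "(A - B) ** C = A ** C - B ** (C :: real^'n::finite^'n)"
  and matrix_diff_right: "C ** (A - B) = C ** A - C ** (B :: real^'n::finite^'n)"
  by (simp_all add: matrix_matrix_mult_def vec_eq_iff left_diff_distrib right_diff_distrib sum_subtractf)

lemma psd_sqrt_norm: "psd_sqrt S A \<Longrightarrow> (norm (S *v \<xi>))\<^sup>2 = \<xi> \<bullet> (A *v \<xi>)"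
  unfolding psd_sqrt_def
  by (metis matrix_vector_mul_assoc power2_norm_eq_inner symmetric_dot)

text \<open>With c = 1 / sqrt \<nu>2, positivity of S at \<xi> - c S \<xi> reads S - 2 c S^2 + c^2
  S^3 \<ge> 0 as forms. Since S^3 \<le> sqrt \<nu>2 S^2, this gives S \<ge> c S^2 = c A, and the
  lower bound of A finishes.\<close>

lemma psd_sqrt_lower:
  assumes S: "psd_sqrt S A" and "0 < \<nu>1"
    and A: "\<And>\<xi>. \<nu>1 * (norm \<xi>)\<^sup>2 \<le> \<xi> \<bullet> (A *v \<xi>)" "\<And>\<xi>. \<xi> \<bullet> (A *v \<xi>) \<le> \<nu>2 * (norm \<xi>)\<^sup>2" and n2: "0 < \<nu>2"
  shows "\<nu>1 / sqrt \<nu>2 * (norm \<xi>)\<^sup>2 \<le> \<xi> \<bullet> (S *v \<xi>)"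
proof -
  let ?c = "1 / sqrt \<nu>2" and ?u = "S *v \<xi>"
  have sym: "transpose S = S" and psd: "\<And>\<xi>. 0 \<le> \<xi> \<bullet> (S *v \<xi>)" using S by (auto simp: psd_sqrt_def)
  have sn: "norm (S *v v) \<le> sqrt \<nu>2 * norm v" for v
  proof (rule power2_le_imp_le)
    show "(norm (S *v v))\<^sup>2 \<le> (sqrt \<nu>2 * norm v)\<^sup>2"
      using psd_sqrt_norm[OF S, of v] A(2)[of v] n2 by (simp add: power_mult_distrib)
  qed (use n2 in simp)
  have "?u \<bullet> (S *v ?u) \<le> norm ?u * norm (S *v ?u)" by (rule norm_cauchy_schwarz)
  also have "\<dots> \<le> norm ?u * (sqrt \<nu>2 * norm ?u)" by (intro mult_left_mono sn) simp
  finally have "?u \<bullet> (S *v ?u) \<le> sqrt \<nu>2 * (norm ?u)\<^sup>2" by (simp add: power2_eq_square ac_simps)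
  then have "?c * ?c * (?u \<bullet> (S *v ?u)) \<le> ?c * ?c * (sqrt \<nu>2 * (norm ?u)\<^sup>2)"
    using n2 by (intro mult_left_mono) auto
  also have "\<dots> = ?c * (norm ?u)\<^sup>2"
  proof -
    have *: "1 / r * (1 / r) * (r * z) = 1 / r * z" if "r \<noteq> 0" for r z :: real using that by simp
    show ?thesis by (rule *) (use n2 in simp)
  qed
  finally have 1: "?c * ?c * (?u \<bullet> (S *v ?u)) \<le> ?c * (norm ?u)\<^sup>2" .
  have "0 \<le> (\<xi> - ?c *\<^sub>R ?u) \<bullet> (S *v (\<xi> - ?c *\<^sub>R ?u))" by (rule psd)
  also have "\<dots> = \<xi> \<bullet> ?u - ?c * (\<xi> \<bullet> (S *v ?u)) - ?c * (?u \<bullet> ?u) + ?c * ?c * (?u \<bullet> (S *v ?u))"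
    by (simp add: matrix_vector_mult_diff_distrib matrix_vector_mult_scaleR inner_diff_left inner_diff_right algebra_simps)
  also have "\<xi> \<bullet> (S *v ?u) = ?u \<bullet> ?u" by (rule symmetric_dot[OF sym])
  finally have "?c * (norm ?u)\<^sup>2 \<le> \<xi> \<bullet> ?u" using 1 by (simp add: power2_norm_eq_inner)
  moreover have "?c * (\<nu>1 * (norm \<xi>)\<^sup>2) \<le> ?c * (norm ?u)\<^sup>2"
    using A(1)[of \<xi>] psd_sqrt_norm[OF S, of \<xi>] n2 by (intro mult_left_mono) auto
  ultimately show ?thesis by simp
qed

text \<open>With D = S - T one has A - B = S D + D T. In the inner product with D each term on the
  right is at least l |D|^2, so the Cauchy-Schwarz inequality yields a Lipschitz bound for the
  square root.\<close>

lemma psd_sqrt_diff: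
  assumes S: "psd_sqrt S A" and T: "psd_sqrt T B"
    and lS: "\<And>\<xi>. l * (norm \<xi>)\<^sup>2 \<le> \<xi> \<bullet> (S *v \<xi>)" and lT: "\<And>\<xi>. l * (norm \<xi>)\<^sup>2 \<le> \<xi> \<bullet> (T *v \<xi>)" and l: "0 < l"
  shows "norm (S - T) \<le> norm (A - B) / (2 * l)"
proof -
  let ?D = "S - T"
  have sS: "transpose S = S" "S ** S = A" and sT: "transpose T = T" "T ** T = B"
    using S T by (auto simp: psd_sqrt_def)
  have sD: "transpose ?D = ?D"
    using sS(1) sT(1) by (simp add: transpose_def vec_eq_iff)
  have low: "l * (norm ?D)\<^sup>2 \<le> ?D \<bullet> (?D ** U)" if "transpose U = U" "\<And>\<xi>. l * (norm \<xi>)\<^sup>2 \<le> \<xi> \<bullet> (U *v \<xi>)" for U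
  proof -
    have "(norm ?D)\<^sup>2 = (\<Sum>i\<in>UNIV. (norm (?D $ i))\<^sup>2)"
      by (simp only: norm_sq_mat norm_sq_vec)
    then have "l * (norm ?D)\<^sup>2 = (\<Sum>i\<in>UNIV. l * (norm (?D $ i))\<^sup>2)" by (simp only: sum_distrib_left)
    also have "\<dots> \<le> (\<Sum>i\<in>UNIV. (?D $ i) \<bullet> (U *v (?D $ i)))" by (intro sum_mono that(2))
    also have "\<dots> = ?D \<bullet> (?D ** U)" by (rule inner_matrix_mult_symmetric[OF that(1), symmetric])
    finally show ?thesis .
  qed
  have "A - B = S ** ?D + ?D ** T"
    unfolding sS(2)[symmetric] sT(2)[symmetric] by (simp add: matrix_diff_left matrix_diff_right)
  then have "?D \<bullet> (A - B) = ?D \<bullet> (S ** ?D) + ?D \<bullet> (?D ** T)" by (simp add: inner_add_right)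
  \<comment> \<open>Transposition preserves the inner product and moves \<open>S\<close> to the
    right, as both matrices are symmetric.\<close>
  also have "?D \<bullet> (S ** ?D) = ?D \<bullet> (?D ** S)"
    using inner_transpose[of ?D "S ** ?D"] sD sS(1) by (simp add: matrix_transpose_mul)
  finally have "2 * l * (norm ?D)\<^sup>2 \<le> ?D \<bullet> (A - B)"
    using low[OF sS(1) lS] low[OF sT(1) lT] by linarith
  also have "\<dots> \<le> norm ?D * norm (A - B)" by (rule norm_cauchy_schwarz)
  finally have "norm ?D * (2 * l * norm ?D) \<le> norm ?D * norm (A - B)" by (simp add: power2_eq_square ac_simps)
  then have "2 * l * norm ?D \<le> norm (A - B)"
    by (cases "norm ?D = 0") (simp_all only: mult_le_cancel_left_pos zero_less_norm_iff, simp_all)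
  then show ?thesis using l by (simp add: pos_le_divide_eq mult.commute)
qed

text \<open>Uniform ellipticity bounds all the roots below by the same \<nu>1 / sqrt \<nu>2, so the
  root inherits continuity from \<open>a\<close> with one Lipschitz constant.\<close>

lemma psd_sqrt_continuous:
  fixes \<sigma> a :: "'b::metric_space \<Rightarrow> real^'n::finite^'n"
  assumes sq: "\<And>y. psd_sqrt (\<sigma> y) (a y)" and a: "continuous_on UNIV a" and n: "0 < \<nu>1" "0 < \<nu>2"
    and A: "\<And>y \<xi>. \<nu>1 * (norm \<xi>)\<^sup>2 \<le> \<xi> \<bullet> (a y *v \<xi>)" "\<And>y \<xi>. \<xi> \<bullet> (a y *v \<xi>) \<le> \<nu>2 * (norm \<xi>)\<^sup>2"
  shows "continuous_on UNIV \<sigma>"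
proof -
  define l where "l = \<nu>1 / sqrt \<nu>2"
  have l: "0 < l" using n by (simp add: l_def)
  have low: "l * (norm \<xi>)\<^sup>2 \<le> \<xi> \<bullet> (\<sigma> y *v \<xi>)" for y \<xi>
    unfolding l_def by (rule psd_sqrt_lower[OF sq[of y] n(1) A(1)[of _ y] A(2)[of _ y] n(2)])
  have d: "norm (\<sigma> y - \<sigma> z) \<le> norm (a y - a z) / (2 * l)" for y z
    by (rule psd_sqrt_diff[OF sq sq low low l])
  show ?thesis
    unfolding continuous_on_iff
  proof (intro ballI allI impI)
    fix y :: 'b and e :: real assume e: "0 < e"
    then have "0 < 2 * l * e" using l by simp
    then obtain r where r: "0 < r" "\<And>z. dist z y < r \<Longrightarrow> dist (a z) (a y) < 2 * l * e"
      using a unfolding continuous_on_iff by (meson UNIV_I)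
    have "dist (\<sigma> z) (\<sigma> y) < e" if "dist z y < r" for z
    proof -
      have "norm (a z - a y) / (2 * l) < e" using r(2)[OF that] l by (simp add: dist_norm pos_divide_less_eq mult.commute)
      with d[of z y] show ?thesis by (simp add: dist_norm)
    qed
    with r(1) show "\<exists>d>0. \<forall>z\<in>UNIV. dist z y < d \<longrightarrow> dist (\<sigma> z) (\<sigma> y) < e" by blast
  qed
qed

text \<open>The squared norm is the sum over the columns S e_i, each of squared length e_i . A
  e_i.\<close>

lemma psd_sqrt_norm_le:
  assumes S: "psd_sqrt S A" and A: "\<And>\<xi>. \<xi> \<bullet> (A *v \<xi>) \<le> \<nu> * (norm \<xi>)\<^sup>2"
  shows "norm (S :: real^'n::finite^'n) \<le> sqrt (real CARD('n) * \<nu>)"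
proof -
  have "(norm S)\<^sup>2 = (\<Sum>i\<in>UNIV. \<Sum>j\<in>UNIV. (S $ j $ i)\<^sup>2)"
    unfolding norm_sq_mat by (rule sum.swap)
  also have "\<dots> = (\<Sum>i\<in>UNIV. (norm (S *v axis i 1))\<^sup>2)"
    by (simp add: norm_sq_vec matrix_vector_mult_basis column_def)
  also have "\<dots> \<le> (\<Sum>i\<in>(UNIV::'n set). \<nu>)"
    unfolding psd_sqrt_norm[OF S] by (intro sum_mono order_trans[OF A]) (simp add: norm_axis_1)
  finally have "(norm S)\<^sup>2 \<le> real CARD('n) * \<nu>" by simp
  then show ?thesis by (rule real_le_rsqrt)
qed

section \<open>Continuity of the coefficients\<close>

lemma smooth_matrix_continuous: "smooth_matrix a \<Longrightarrow> continuous_on UNIV a"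
proof -
  assume "smooth_matrix a"
  then have "continuous_on UNIV (\<lambda>y. \<chi> i j. a y $ i $ j)"
    by (intro continuous_on_vec_lambda smooth_continuous) (simp add: smooth_matrix_def)
  then show ?thesis by simp
qed

lemma smooth_vector_continuous: "smooth_vector b \<Longrightarrow> continuous_on UNIV b"
proof -
  assume "smooth_vector b"
  then have "continuous_on UNIV (\<lambda>y. \<chi> i. b y $ i)"
    by (intro continuous_on_vec_lambda smooth_continuous) (simp add: smooth_vector_def)
  then show ?thesis by simp
qed

lemma ito_drift_continuous:
  assumes "smooth_matrix a" "smooth_vector b"
  shows "continuous_on UNIV (ito_drift a b)"
  unfolding ito_drift_def[abs_def]
  by (intro continuous_on_vec_lambda continuous_intros smooth_continuous smooth_part_deriv)
    (use assms in \<open>auto simp: smooth_vector_def smooth_matrix_def intro: smooth_continuous\<close>)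

lemma matrix_vector_mult_continuous:
  fixes A :: "'b::topological_space \<Rightarrow> real^'n::finite^'n"
  assumes "continuous_on UNIV A" "continuous_on UNIV u" shows "continuous_on UNIV (\<lambda>y. A y *v u y)"
  unfolding matrix_vector_mult_def
  by (intro continuous_on_vec_lambda continuous_intros continuous_on_component assms)

section \<open>The generator acting on differences of functions\<close>

lemma hjb_operator_expand:
  assumes "smooth_matrix a" "smooth W"
  shows "hjb_operator a ahat b W x =
    1/2 * (\<Sum>i\<in>UNIV. \<Sum>j\<in>UNIV. part_deriv i (\<lambda>y. a y $ i $ j) x * part_deriv j W x)
    + 1/2 * (\<Sum>i\<in>UNIV. \<Sum>j\<in>UNIV. a x $ i $ j * hessian W x $ i $ j)
    + b x \<bullet> grad W x + 1/2 * (grad W x \<bullet> (ahat x *v grad W x))"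
proof -
  have a: "(\<lambda>y. a y $ i $ j) differentiable (at x)" for i j
    using assms(1) by (intro smooth_differentiable) (simp add: smooth_matrix_def)
  have W: "part_deriv j W differentiable (at x)" for j
    by (intro smooth_differentiable smooth_part_deriv assms)
  have "part_deriv i (\<lambda>y. \<Sum>j\<in>UNIV. a y $ i $ j * part_deriv j W y) x =
    (\<Sum>j\<in>UNIV. a x $ i $ j * hessian W x $ i $ j + part_deriv i (\<lambda>y. a y $ i $ j) x * part_deriv j W x)" for i
    using a W by (subst part_deriv_sum) (auto simp: part_deriv_mult hessian_def)
  moreover have "(\<Sum>i\<in>UNIV. \<Sum>j\<in>UNIV. ahat x $ i $ j * part_deriv i W x * part_deriv j W x) = grad W x \<bullet> (ahat x *v grad W x)"
    by (simp add: inner_vec_def matrix_vector_mult_def grad_def sum_distrib_left ac_simps)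
  ultimately show ?thesis
    by (simp add: hjb_operator_def sum.distrib algebra_simps)
qed

text \<open>The linear parts subtract without residue. Polarisation of the symmetric form
  \<open>ahat\<close> turns the difference of the two quadratic terms into the feedback drift acting
  on \<Phi>, minus half the form at its gradient.\<close>

lemma hjb_operator_diff:
  assumes a: "smooth_matrix a" "\<forall>y. transpose (a y) = a y"
    and ahat: "transpose (ahat x) = ahat x" and W: "smooth W" "smooth W0"
  defines "\<Phi> \<equiv> \<lambda>y. W y - W0 y"
  shows "(ito_drift a b x + ahat x *v grad W x) \<bullet> grad \<Phi> x + 1/2 * (\<Sum>i\<in>UNIV. \<Sum>j\<in>UNIV. a x $ i $ j * hessian \<Phi> x $ i $ j) =
    hjb_operator a ahat b W x - hjb_operator a ahat b W0 x + 1/2 * (grad \<Phi> x \<bullet> (ahat x *v grad \<Phi> x))"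
proof -
  have pd: "part_deriv j \<Phi> = (\<lambda>y. part_deriv j W y - part_deriv j W0 y)" for j
    unfolding \<Phi>_def by (intro ext part_deriv_diff smooth_differentiable W)
  have g: "grad \<Phi> x = grad W x - grad W0 x" by (simp add: grad_def vec_eq_iff pd)
  have "part_deriv i (part_deriv j \<Phi>) x = part_deriv i (part_deriv j W) x - part_deriv i (part_deriv j W0) x" for i j
    unfolding pd by (intro part_deriv_diff smooth_differentiable smooth_part_deriv W)
  then have h: "hessian \<Phi> x $ i $ j = hessian W x $ i $ j - hessian W0 x $ i $ j" for i j
    by (simp add: hessian_def)
  have sym: "(\<lambda>y. a y $ i $ j) = (\<lambda>y. a y $ j $ i)" for i j
  proof
    fix y have "transpose (a y) $ j $ i = a y $ j $ i" using a(2) by simp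
    then show "a y $ i $ j = a y $ j $ i" by (simp add: transpose_def)
  qed
  \<comment> \<open>The correction in \<open>ito_drift\<close> is the first-order term produced by
    the divergence form. It differentiates along the column index of \<open>a\<close>, the expanded
    operator along the row index; symmetry of \<open>a\<close> identifies the two.\<close>
  have dr: "ito_drift a b x \<bullet> v = b x \<bullet> v + 1/2 * (\<Sum>i\<in>UNIV. \<Sum>j\<in>UNIV. part_deriv i (\<lambda>y. a y $ i $ j) x * v $ j)" for v
  proof -
    have "ito_drift a b x \<bullet> v = b x \<bullet> v + 1/2 * (\<Sum>j\<in>UNIV. \<Sum>i\<in>UNIV. part_deriv i (\<lambda>y. a y $ j $ i) x * v $ j)"
      by (simp add: ito_drift_def inner_vec_def distrib_right sum.distrib sum_distrib_left sum_distrib_right mult.assoc)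
    also have "(\<Sum>j\<in>UNIV. \<Sum>i\<in>UNIV. part_deriv i (\<lambda>y. a y $ j $ i) x * v $ j) =
       (\<Sum>j\<in>UNIV. \<Sum>i\<in>UNIV. part_deriv i (\<lambda>y. a y $ i $ j) x * v $ j)"
      by (intro sum.cong refl) (metis sym)
    also have "\<dots> = (\<Sum>i\<in>UNIV. \<Sum>j\<in>UNIV. part_deriv i (\<lambda>y. a y $ i $ j) x * v $ j)" by (rule sum.swap)
    finally show ?thesis .
  qed
  define p where "p = grad W x"
  define p0 where "p0 = grad W0 x"
  have cr: "p0 \<bullet> (ahat x *v p) = p \<bullet> (ahat x *v p0)"
    using symmetric_dot[OF ahat, of p0 p] by (simp add: inner_commute)
  have quad: "(ahat x *v p) \<bullet> (p - p0) = 1/2 * (p \<bullet> (ahat x *v p)) - 1/2 * (p0 \<bullet> (ahat x *v p0)) + 1/2 * ((p - p0) \<bullet> (ahat x *v (p - p0)))"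
    using cr by (simp add: matrix_vector_mult_diff_distrib inner_diff_left inner_diff_right inner_commute algebra_simps)
  have D: "part_deriv j W x = p $ j" "part_deriv j W0 x = p0 $ j" for j by (simp_all add: p_def p0_def grad_def)
  show ?thesis
    unfolding hjb_operator_expand[OF a(1) W(1)] hjb_operator_expand[OF a(1) W(2)] g p_def[symmetric] p0_def[symmetric] inner_add_left quad dr D h
    by (simp add: inner_diff_right right_diff_distrib sum_subtractf)
qed

lemma trace_conjugate:
  assumes "transpose S = S" "S ** S = A"
  shows "trace (transpose S ** Q ** S) = (\<Sum>i\<in>UNIV. \<Sum>j\<in>UNIV. A $ i $ j * Q $ j $ (i::'n::finite) :: real)"
proof -
  have "trace (transpose S ** Q ** S) = trace (S ** (S ** Q))"
    using trace_mul_sym[of "S ** Q" S] assms by simp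
  also have "\<dots> = trace (A ** Q)" using assms by (simp add: matrix_mul_assoc)
  finally show ?thesis by (simp add: trace_def matrix_matrix_mult_def)
qed

text \<open>The second-order term of \<open>tanh\<close> is absorbed by the quadratic form of \<open>ahat\<close>, at the price of
  a small \<open>e\<close>.\<close>

lemma generator_tanh_ge:
  assumes a: "smooth_matrix a" "\<forall>y. transpose (a y) = a y" and ahat: "\<forall>y. transpose (ahat y) = ahat y"
    and W: "smooth W" "smooth W0" and sq: "psd_sqrt S (a x)"
    and A: "\<And>\<xi>. \<xi> \<bullet> (a x *v \<xi>) \<le> \<nu>2 * (norm \<xi>)\<^sup>2" "\<And>\<xi>. 0 \<le> \<xi> \<bullet> (a x *v \<xi>)"
    and H: "\<And>\<xi>. \<mu>1 * (norm \<xi>)\<^sup>2 \<le> \<xi> \<bullet> (ahat x *v \<xi>)"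
    and e: "0 < e" "2 * e * \<nu>2 \<le> \<mu>1"
  defines "f \<equiv> \<lambda>y. tanh (e * (W y - W0 y))"
  shows "e * (1 - (f x)\<^sup>2) * (hjb_operator a ahat b W x - hjb_operator a ahat b W0 x) \<le>
    grad f x \<bullet> (ito_drift a b x + ahat x *v grad W x) + 1/2 * trace (transpose S ** hessian f x ** S)"
proof -
  define \<Phi> where "\<Phi> y = W y - W0 y" for y
  have \<Phi>: "smooth \<Phi>" unfolding \<Phi>_def[abs_def] by (rule smooth_diff[OF W])
  have f: "f = (\<lambda>y. tanh (e * \<Phi> y))" by (simp add: f_def \<Phi>_def)
  have sf: "smooth f" unfolding f by (rule smooth_tanh[OF \<Phi>])
  \<comment> \<open>The first derivative of tanh (e z) at \<Phi>, written through \<open>f\<close>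
    itself; it becomes the nonnegative weight in front of the whole identity for \<Phi>.\<close>
  define u where "u y = e * (1 - (f y)\<^sup>2)" for y
  have pd: "part_deriv i f = (\<lambda>y. u y * part_deriv i \<Phi> y)" for i
    unfolding f u_def by (intro ext part_deriv_chain smooth_differentiable \<Phi> tanh_has_real_derivative)
  \<comment> \<open>Here the factor - 2 e f appears, the ratio of the second to the first derivative
    of tanh (e z).\<close>
  have pu: "part_deriv i u x = - 2 * e * f x * (u x * part_deriv i \<Phi> x)" for i
  proof -
    have "((\<lambda>z. e * (1 - z\<^sup>2)) has_real_derivative - 2 * e * f x) (at (f x))"
      by (auto intro!: derivative_eq_intros)
    from part_deriv_chain[OF smooth_differentiable[OF sf] this, of i] show ?thesis
      unfolding u_def[abs_def] pd[unfolded u_def[abs_def]] by simp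
  qed
  have du: "u differentiable (at x)"
    unfolding u_def[abs_def] using smooth_differentiable[OF sf] by (auto intro!: derivative_intros)
  have hes: "hessian f x $ i $ j = u x * hessian \<Phi> x $ i $ j - 2 * e * f x * u x * (part_deriv i \<Phi> x * part_deriv j \<Phi> x)" for i j
  proof -
    have "hessian f x $ i $ j = part_deriv i (part_deriv j f) x" by (simp add: hessian_def)
    also have "\<dots> = u x * part_deriv i (part_deriv j \<Phi>) x + part_deriv i u x * part_deriv j \<Phi> x"
      unfolding pd[of j] by (rule part_deriv_mult[OF du smooth_differentiable[OF smooth_part_deriv[OF \<Phi>]]])
    finally show ?thesis by (simp add: pu hessian_def)
  qed
  have g: "grad f x = u x *\<^sub>R grad \<Phi> x" by (simp add: grad_def vec_eq_iff pd)
  have asym: "a x $ i $ j = a x $ j $ i" for i j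
  proof -
    have "transpose (a x) $ j $ i = a x $ j $ i" using a(2) by simp
    then show ?thesis by (simp add: transpose_def)
  qed
  define h2 where "h2 = (\<Sum>i\<in>UNIV. \<Sum>j\<in>UNIV. a x $ i $ j * hessian \<Phi> x $ i $ j)"
  define Ap where "Ap = grad \<Phi> x \<bullet> (a x *v grad \<Phi> x)"
  have "trace (transpose S ** hessian f x ** S) = (\<Sum>i\<in>UNIV. \<Sum>j\<in>UNIV. a x $ i $ j * hessian f x $ j $ i)"
    using sq by (intro trace_conjugate) (auto simp: psd_sqrt_def)
  \<comment> \<open>The trace delivers the Hessian with transposed indices; exchanging the sums and
    using the symmetry of \<open>a\<close> restores the order.\<close>
  also have "\<dots> = (\<Sum>j\<in>UNIV. \<Sum>i\<in>UNIV. a x $ i $ j * hessian f x $ j $ i)" by (rule sum.swap)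
  also have "\<dots> = (\<Sum>j\<in>UNIV. \<Sum>i\<in>UNIV. a x $ j $ i * hessian f x $ j $ i)"
    by (intro sum.cong refl) (metis asym)
  also have "\<dots> = u x * h2 - 2 * e * f x * u x * Ap"
    unfolding hes h2_def Ap_def
    by (simp add: right_diff_distrib sum_subtractf sum_distrib_left inner_vec_def matrix_vector_mult_def grad_def ac_simps)
  finally have tr: "trace (transpose S ** hessian f x ** S) = u x * h2 - 2 * e * f x * u x * Ap" .
  define q where "q = hjb_operator a ahat b W x - hjb_operator a ahat b W0 x"
  define Hp where "Hp = grad \<Phi> x \<bullet> (ahat x *v grad \<Phi> x)"
  have id: "(ito_drift a b x + ahat x *v grad W x) \<bullet> grad \<Phi> x + 1/2 * h2 = q + 1/2 * Hp"
    unfolding h2_def q_def Hp_def \<Phi>_def[abs_def]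
    by (rule hjb_operator_diff) (use a ahat W in auto)
  have f1: "\<bar>f x\<bar> \<le> 1" unfolding f using tanh_real_bounds[of "e * \<Phi> x"] by (simp add: abs_le_iff less_imp_le)
  have u0: "0 \<le> u x" unfolding u_def using e f1 by (simp add: abs_square_le_1)
  \<comment> \<open>The two forms are compared through |grad \<Phi>|^2: \<open>a\<close> is at most
    \<nu>2 and \<open>ahat\<close> at least \<mu>1, so the condition 2 e \<nu>2 \<le> \<mu>1 puts e
    f Ap below Hp / 2.\<close>
  have "e * f x * Ap \<le> e * \<nu>2 * (norm (grad \<Phi> x))\<^sup>2"
  proof -
    have "f x * Ap \<le> 1 * Ap" using f1 A(2)[of "grad \<Phi> x"] unfolding Ap_def by (intro mult_right_mono) auto
    also have "\<dots> \<le> \<nu>2 * (norm (grad \<Phi> x))\<^sup>2" using A(1)[of "grad \<Phi> x"] by (simp add: Ap_def)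
    finally have "e * (f x * Ap) \<le> e * (\<nu>2 * (norm (grad \<Phi> x))\<^sup>2)" using e by (intro mult_left_mono) auto
    then show ?thesis by (simp add: mult.assoc)
  qed
  also have "\<dots> \<le> \<mu>1 / 2 * (norm (grad \<Phi> x))\<^sup>2" using e by (intro mult_right_mono) auto
  also have "\<dots> \<le> 1/2 * Hp" using H[of "grad \<Phi> x"] by (simp add: Hp_def)
  finally have "u x * q \<le> u x * (q + 1/2 * Hp - e * f x * Ap)" using u0 by (intro mult_left_mono) auto
  also have "\<dots> = u x * ((ito_drift a b x + ahat x *v grad W x) \<bullet> grad \<Phi> x + 1/2 * h2) - u x * (e * f x * Ap)"
    unfolding id by (simp add: algebra_simps)
  also have "\<dots> = grad f x \<bullet> (ito_drift a b x + ahat x *v grad W x) + 1/2 * trace (transpose S ** hessian f x ** S)"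
    unfolding tr g by (simp add: inner_commute algebra_simps)
  finally show ?thesis by (simp add: u_def q_def)
qed

section \<open>Invariant measures\<close>

lemma hjb_operator_continuous:
  assumes "smooth_matrix a" "smooth_matrix ahat" "smooth_vector b" "smooth W"
  shows "continuous_on UNIV (hjb_operator a ahat b W)"
proof -
  have "continuous_on UNIV (\<lambda>x. a x $ i $ j)" "continuous_on UNIV (part_deriv i (\<lambda>y. a y $ i $ j))"
    "continuous_on UNIV (part_deriv j W)" for i j
    using assms by (auto simp: smooth_matrix_def intro!: smooth_continuous smooth_part_deriv)
  moreover have "continuous_on UNIV (\<lambda>x. hessian W x $ i $ j)" for i j
    by (intro continuous_on_component hessian_continuous assms)
  moreover have "continuous_on UNIV (\<lambda>x. ahat x *v grad W x)"
    by (intro matrix_vector_mult_continuous smooth_matrix_continuous grad_continuous assms)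
  moreover have "hjb_operator a ahat b W = (\<lambda>x.
    1/2 * (\<Sum>i\<in>UNIV. \<Sum>j\<in>UNIV. part_deriv i (\<lambda>y. a y $ i $ j) x * part_deriv j W x)
    + 1/2 * (\<Sum>i\<in>UNIV. \<Sum>j\<in>UNIV. a x $ i $ j * hessian W x $ i $ j)
    + b x \<bullet> grad W x + 1/2 * (grad W x \<bullet> (ahat x *v grad W x)))"
    by (rule ext) (rule hjb_operator_expand[OF assms(1,4)])
  ultimately show ?thesis
    by (simp only:) (intro continuous_on_add continuous_on_mult continuous_on_const continuous_on_sum
      continuous_on_inner grad_continuous smooth_vector_continuous[OF assms(3)] assms(4))
qed

text \<open>Integration against \<open>\<mu> \<bind> P t\<close> averages the mean at time
  \<open>t\<close> over the starting point. Measurability in the starting point comes from the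
  Markov kernel property, as the solutions are given separately for each start.\<close>

lemma invariant_prob_integral:
  fixes \<mu> :: "(real^'n::finite) measure" and u :: "real^'n \<Rightarrow> real"
  assumes inv: "invariant_prob (transition_function M X) \<mu>" and t: "0 \<le> t"
    and X: "\<And>x. X x t \<in> borel_measurable M"
    and u: "u \<in> borel_measurable borel" "\<And>y. \<bar>u y\<bar> \<le> c"
  shows "(\<lambda>x. \<integral>\<omega>. u (X x t \<omega>) \<partial>M) \<in> borel_measurable borel"
    and "(\<integral>x. (\<integral>\<omega>. u (X x t \<omega>) \<partial>M) \<partial>\<mu>) = (\<integral>y. u y \<partial>\<mu>)"
proof -
  let ?P = "transition_function M X t"
  from inv t have P: "?P \<in> borel \<rightarrow>\<^sub>M prob_algebra borel" and bind: "\<mu> \<bind> ?P = \<mu>"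
    and sets: "sets \<mu> = sets borel" and ps: "prob_space \<mu>"
    by (auto simp: invariant_prob_def)
  interpret \<mu>: prob_space \<mu> by (rule ps)
  have P': "?P \<in> borel \<rightarrow>\<^sub>M subprob_algebra borel" by (rule measurable_prob_algebraD[OF P])
  have eq: "(\<integral>y. u y \<partial>?P x) = (\<integral>\<omega>. u (X x t \<omega>) \<partial>M)" for x
    unfolding transition_function_def by (rule integral_distr[OF X u(1)])
  show "(\<lambda>x. \<integral>\<omega>. u (X x t \<omega>) \<partial>M) \<in> borel_measurable borel"
    using measurable_compose[OF P' integral_measurable_subprob_algebra[OF u(1)]] unfolding eq .
  have "emeasure (?P x) (space (?P x)) \<le> ennreal 1" for x
    using subprob_space.emeasure_space_le_1[OF subprob_space_kernel[OF P']] by simp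
  then have "(\<integral>y. u y \<partial>(\<mu> \<bind> ?P)) = (\<integral>x. (\<integral>y. u y \<partial>?P x) \<partial>\<mu>)"
    using P'[folded measurable_cong_sets[OF sets refl]] u(2)
    by (intro integral_bind[OF u(1), where B=c and B'=1] AE_I2 \<mu>.finite_measure_axioms) simp_all
  then show "(\<integral>x. (\<integral>\<omega>. u (X x t \<omega>) \<partial>M) \<partial>\<mu>) = (\<integral>y. u y \<partial>\<mu>)" unfolding bind eq by simp
qed

text \<open>A reversed Fatou argument: the positive part of \<phi> n - p tends to 0 and is bounded,
  and \<open>H\<close> is the integral of \<phi> n - p, hence below that of its positive part. The
  index 0 is excluded because the average over no grid points has the value 0.\<close>

lemma (in prob_space) mean_nonpos_of_eventually_le:
  fixes p :: "'a \<Rightarrow> real"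
  assumes [measurable]: "\<And>n. \<phi> n \<in> borel_measurable M" "p \<in> borel_measurable M"
    and b: "\<And>n x. \<bar>\<phi> n x\<bar> \<le> c" "\<And>x. \<bar>p x\<bar> \<le> c"
    and ev: "\<And>x e. 0 < e \<Longrightarrow> eventually (\<lambda>n. \<phi> n x \<le> p x + e) sequentially"
    and p: "(\<integral>x. p x \<partial>M) = 0" and \<phi>: "\<And>n. 0 < n \<Longrightarrow> (\<integral>x. \<phi> n x \<partial>M) = H"
  shows "H \<le> 0"
proof -
  have i: "integrable M (\<phi> n)" "integrable M p" for n
    by (rule integrable_const_bound[where B=c]; use b in simp)+
  have m: "integrable M (\<lambda>x. max 0 (\<phi> n x - p x))" for n
    using i by simp
  have "(\<lambda>n. \<integral>x. max 0 (\<phi> n x - p x) \<partial>M) \<longlonglongrightarrow> (\<integral>x. 0 \<partial>M)"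
  proof (rule integral_dominated_convergence[where w="\<lambda>_. 2 * c"])
    have "norm (max 0 (\<phi> n x - p x)) \<le> 2 * c" for n x
      using b(1)[of n x] b(2)[of x] by (simp add: abs_le_iff)
    then show "AE x in M. norm (max 0 (\<phi> n x - p x)) \<le> 2 * c" for n by simp
    show "AE x in M. (\<lambda>n. max 0 (\<phi> n x - p x)) \<longlonglongrightarrow> 0"
    proof (intro AE_I2 order_tendstoI)
      fix x and a :: real assume "0 < a"
      with ev[of "a/2" x] show "eventually (\<lambda>n. max 0 (\<phi> n x - p x) < a) sequentially"
        by (auto elim!: eventually_mono)
    qed (auto intro!: always_eventually less_max_iff_disj[THEN iffD2])
  qed auto
  moreover have "H \<le> (\<integral>x. max 0 (\<phi> n x - p x) \<partial>M)" if "0 < n" for n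
  proof -
    have "H = (\<integral>x. \<phi> n x - p x \<partial>M)" using i p \<phi>[OF that] by simp
    also have "\<dots> \<le> (\<integral>x. max 0 (\<phi> n x - p x) \<partial>M)"
      by (rule integral_mono) (use i m in auto)
    finally show ?thesis .
  qed
  ultimately show ?thesis
    by (intro LIMSEQ_le_const[of _ 0 H]) (auto intro!: exI[of _ 1])
qed

text \<open>\<open>L f\<close> itself may be unbounded and not integrable, which is why a bounded minorant \<open>h\<close> of it
  is used.\<close>

lemma invariant_prob_nonpos:
  fixes \<mu> :: "(real^'n::finite) measure"
  assumes bm: "brownian_motion M F B" and sol: "\<forall>x. sde_solution M F B \<beta> \<sigma> x (X x)"
    and inv: "invariant_prob (transition_function M X) \<mu>"
    and \<sigma>: "continuous_on UNIV \<sigma>" "\<And>y. norm (\<sigma> y) \<le> C" and \<beta>: "continuous_on UNIV \<beta>"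
    and f: "smooth f" "\<And>y. \<bar>f y\<bar> \<le> c\<^sub>f" and h: "continuous_on UNIV h" "\<And>y. \<bar>h y\<bar> \<le> c\<^sub>h"
    and le: "\<And>y. h y \<le> grad f y \<bullet> \<beta> y + 1/2 * trace (transpose (\<sigma> y) ** hessian f y ** \<sigma> y)"
  shows "(\<integral>y. h y \<partial>\<mu>) \<le> 0"
proof -
  have "prob_space M" using bm by (simp add: brownian_motion_def filtered_prob_space_def)
  then have dif: "test_function M F B \<beta> \<sigma> x (X x) C f h (grad f) (hessian f) c\<^sub>f c\<^sub>h" for x
  proof (intro test_function.intro diffusion.intro brownian.intro brownian_axioms.intro
      diffusion_axioms.intro test_function_axioms.intro)
    show "\<exists>K\<ge>0. \<forall>y \<Delta>. norm y \<le> R \<longrightarrow> f y + grad f y \<bullet> \<Delta> + 1/2 * (\<Delta> \<bullet> (hessian f y *v \<Delta>))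
        - K * min (norm \<Delta> ^ 2) (norm \<Delta> ^ 3) \<le> f (y + \<Delta>)" for R
      by (rule taylor_lower_bound[OF f])
  qed (use assms in \<open>auto intro: smooth_continuous grad_continuous hessian_continuous\<close>)
  interpret M: prob_space M by fact
  interpret \<mu>: prob_space \<mu> using inv by (simp add: invariant_prob_def)
  have sets: "sets \<mu> = sets borel" using inv by (simp add: invariant_prob_def)
  have mb: "u \<in> borel_measurable \<mu> \<longleftrightarrow> u \<in> borel_measurable borel" for u :: "real^'n \<Rightarrow> real"
    by (simp add: measurable_cong_sets[OF sets refl])
  have XM: "X x t \<in> borel_measurable M" if "0 \<le> t" for x t
  proof -
    interpret test_function M F B \<beta> \<sigma> x "X x" C f h "grad f" "hessian f" c\<^sub>f c\<^sub>h by (rule dif)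
    show ?thesis by (rule X_measurable[OF that])
  qed
  have fm: "f \<in> borel_measurable borel" and hm: "h \<in> borel_measurable borel"
    using smooth_continuous[OF f(1)] h(1) by (auto intro: borel_measurable_continuous_onI)
  define p where "p x = (\<integral>\<omega>. f (X x 1 \<omega>) \<partial>M) - f x" for x
  define \<phi> where "\<phi> n x = (\<Sum>i<n. \<integral>\<omega>. h (X x (real i / real n) \<omega>) \<partial>M) / real n" for n x
  have avg: "\<bar>\<integral>\<omega>. u (X x t \<omega>) \<partial>M\<bar> \<le> c" if "u \<in> borel_measurable borel" "\<And>y. \<bar>u y\<bar> \<le> c" "0 \<le> t"
    for u :: "real^'n \<Rightarrow> real" and c x t
  proof -
    have "\<bar>\<integral>\<omega>. u (X x t \<omega>) \<partial>M\<bar> \<le> (\<integral>\<omega>. \<bar>u (X x t \<omega>)\<bar> \<partial>M)"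
      using integral_norm_bound[of M "\<lambda>\<omega>. u (X x t \<omega>)"] by simp
    also have "\<dots> \<le> (\<integral>\<omega>. c \<partial>M)"
      using that XM[OF that(3), of x] order_trans[OF abs_ge_zero that(2)]
      by (intro integral_mono') auto
    finally show ?thesis by (simp add: M.prob_space)
  qed
  note inv_f = invariant_prob_integral[OF inv _ XM fm f(2)]
    and inv_h = invariant_prob_integral[OF inv _ XM hm h(2)]
  have c0: "0 \<le> c\<^sub>h" "0 \<le> c\<^sub>f" using h(2)[of undefined] f(2)[of undefined] by linarith+
  have ih: "integrable \<mu> (\<lambda>x. \<integral>\<omega>. h (X x t \<omega>) \<partial>M)" if "0 \<le> t" for t
    by (rule \<mu>.integrable_const_bound[where B=c\<^sub>h]) (use inv_h(1)[OF that that] avg[OF hm h(2) that] mb in auto)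
  show ?thesis
  \<comment> \<open>\<open>\<phi> n x\<close> is the Riemann sum of the means of \<open>h\<close>
    for the start \<open>x\<close>, and \<open>p x\<close> the expected gain of \<open>f\<close> up
    to time 1. By invariance each time i/n contributes the \<mu>-integral of \<open>h\<close>, and
    \<open>p\<close> has \<mu>-mean 0.\<close>
  proof (rule \<mu>.mean_nonpos_of_eventually_le[where \<phi>=\<phi> and p=p and c="c\<^sub>h + 2 * c\<^sub>f"])
    show "\<phi> n \<in> borel_measurable \<mu>" for n
      unfolding mb \<phi>_def using inv_h(1) by (intro borel_measurable_divide borel_measurable_sum) auto
    show "p \<in> borel_measurable \<mu>"
      unfolding mb p_def using inv_f(1)[of 1] fm by auto
    show "\<bar>\<phi> n x\<bar> \<le> c\<^sub>h + 2 * c\<^sub>f" for n x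
    proof -
      have "\<bar>\<Sum>i<n. \<integral>\<omega>. h (X x (real i / real n) \<omega>) \<partial>M\<bar> \<le> (\<Sum>i<n. c\<^sub>h)"
        by (intro order_trans[OF sum_abs] sum_mono avg[OF hm h(2)]) simp
      then have "\<bar>\<phi> n x\<bar> \<le> c\<^sub>h"
        using c0 unfolding \<phi>_def by (cases "n = 0") (auto simp: abs_divide pos_divide_le_eq mult.commute)
      then show ?thesis using c0 by simp
    qed
    show "\<bar>p x\<bar> \<le> c\<^sub>h + 2 * c\<^sub>f" for x
      using avg[OF fm f(2), of 1 x] f(2)[of x] c0 unfolding p_def by (simp add: abs_le_iff)
    show "eventually (\<lambda>n. \<phi> n x \<le> p x + e) sequentially" if "0 < e" for x e
      using test_function.riemann_sum_limit[OF dif that, of x] unfolding \<phi>_def p_def .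
    show "(\<integral>x. p x \<partial>\<mu>) = 0"
    proof -
      have "integrable \<mu> (\<lambda>x. \<integral>\<omega>. f (X x 1 \<omega>) \<partial>M)"
        by (rule \<mu>.integrable_const_bound[where B=c\<^sub>f]) (use inv_f(1)[of 1] avg[OF fm f(2)] mb in auto)
      moreover have "integrable \<mu> f"
        by (rule \<mu>.integrable_const_bound[where B=c\<^sub>f]) (use fm f(2) mb in auto)
      ultimately show ?thesis unfolding p_def using inv_f(2)[of 1] by simp
    qed
    show "(\<integral>x. \<phi> n x \<partial>\<mu>) = (\<integral>y. h y \<partial>\<mu>)" if "0 < n" for n
    proof -
      have "(\<integral>x. \<phi> n x \<partial>\<mu>) = (\<Sum>i<n. \<integral>x. (\<integral>\<omega>. h (X x (real i / real n) \<omega>) \<partial>M) \<partial>\<mu>) / real n"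
        unfolding \<phi>_def using ih by (simp add: Bochner_Integration.integral_sum)
      also have "\<dots> = (\<Sum>i<n. \<integral>y. h y \<partial>\<mu>) / real n"
        by (intro arg_cong2[where f="(/)"] sum.cong refl inv_h(2)) auto
      also have "\<dots> = (\<integral>y. h y \<partial>\<mu>)" using that by simp
      finally show ?thesis .
    qed
  qed
qed

text \<open>After the shift by \<open>k\<close> all truncations are nonnegative. Fatou's lemma then
  bounds the integral of q + k by k, which yields integrability and the sign at once.\<close>

lemma (in prob_space) integral_nonpos_of_truncations:
  fixes q :: "'a \<Rightarrow> real"
  assumes [measurable]: "q \<in> borel_measurable M" and low: "\<And>x. - c \<le> q x"
    and le: "\<And>m::nat. (\<integral>x. min (q x) (real m) \<partial>M) \<le> 0"
  shows "integrable M q" "(\<integral>x. q x \<partial>M) \<le> 0"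
proof -
  define k where "k = max 0 c"
  have k: "0 \<le> k" "\<And>x. 0 \<le> q x + k" 
  proof -
    show "0 \<le> k" by (simp add: k_def)
    have "c \<le> k" by (simp add: k_def)
    then show "0 \<le> q x + k" for x using low[of x] by linarith
  qed
  have im: "integrable M (\<lambda>x. min (q x) (real m))" for m
  proof (rule integrable_const_bound[where B="k + real m"])
    have "\<bar>min (q x) (real m)\<bar> \<le> k + real m" for x using k(1) k(2)[of x] by (auto simp: min_def abs_le_iff)
    then show "AE x in M. norm (min (q x) (real m)) \<le> k + real m" by simp
  qed measurable
  have pt: "liminf (\<lambda>m. ennreal (min (q x) (real m) + k)) = ennreal (q x + k)" for x
  proof (rule lim_imp_Liminf)
    obtain N where N: "q x \<le> real N" using real_arch_simple by blast
    have "eventually (\<lambda>m. ennreal (min (q x) (real m) + k) = ennreal (q x + k)) sequentially"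
      using eventually_ge_at_top[of N]
    proof eventually_elim
      case (elim m)
      then have "q x \<le> real m" using N by simp
      then show ?case by (simp add: min_absorb1)
    qed
    then show "(\<lambda>m. ennreal (min (q x) (real m) + k)) \<longlonglongrightarrow> ennreal (q x + k)" by (rule tendsto_eventually)
  qed simp
  have "(\<integral>\<^sup>+x. ennreal (q x + k) \<partial>M) = (\<integral>\<^sup>+x. liminf (\<lambda>m. ennreal (min (q x) (real m) + k)) \<partial>M)"
    by (simp add: pt)
  also have "\<dots> \<le> liminf (\<lambda>m. \<integral>\<^sup>+x. ennreal (min (q x) (real m) + k) \<partial>M)"
    by (rule nn_integral_liminf) measurable
  also have "\<dots> \<le> liminf (\<lambda>m::nat. ennreal k)"
  proof (intro Liminf_mono always_eventually allI)
    fix m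
    have "0 \<le> min (q x) (real m) + k" for x using k(1) k(2)[of x] by (auto simp: min_def)
    then have "(\<integral>\<^sup>+x. ennreal (min (q x) (real m) + k) \<partial>M) = ennreal (\<integral>x. min (q x) (real m) + k \<partial>M)"
      by (intro nn_integral_eq_integral) (use im in auto)
    also have "\<dots> \<le> ennreal k" using im le[of m] by (intro ennreal_leI) (simp add: prob_space)
    finally show "(\<integral>\<^sup>+x. ennreal (min (q x) (real m) + k) \<partial>M) \<le> ennreal k" .
  qed
  also have "\<dots> = ennreal k" by (simp add: Liminf_const)
  finally have fin: "(\<integral>\<^sup>+x. ennreal (q x + k) \<partial>M) \<le> ennreal k" .
  have i: "integrable M (\<lambda>x. q x + k)"
    by (rule integrableI_bounded) (use fin k in \<open>auto simp: le_less_trans\<close>)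
  then have "integrable M (\<lambda>x. (q x + k) - k)" by (rule Bochner_Integration.integrable_diff) simp
  then show iq: "integrable M q" by simp
  have "(\<integral>x. q x + k \<partial>M) \<le> k" using fin k by (simp add: nn_integral_eq_integral i)
  then show "(\<integral>x. q x \<partial>M) \<le> 0" using iq by (simp add: prob_space)
qed

section \<open>Bound for the integral of \<open>U0\<close> against the invariant measure\<close>

theorem corollary5p2:
  fixes a ahat \<sigma> :: "real^'n::finite \<Rightarrow> real^'n^'n"
    and b :: "real^'n \<Rightarrow> real^'n"
    and V0 W0 U0 V W :: "real^'n \<Rightarrow> real"
    and \<nu>1 \<nu>2 \<mu>1 \<mu>2 \<Lambda> :: real
    and M :: "'w measure" and F :: "real \<Rightarrow> 'w measure"
    and B :: "real \<Rightarrow> 'w \<Rightarrow> real^'n"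
    and X :: "real^'n \<Rightarrow> real \<Rightarrow> 'w \<Rightarrow> real^'n"
    and \<mu> :: "(real^'n) measure"
  assumes "smooth_matrix a" "smooth_matrix ahat" "smooth_vector b"
    and "\<forall>x. transpose (a x) = a x" "\<forall>x. transpose (ahat x) = ahat x"
    and "0 < \<nu>1" "\<nu>1 < \<nu>2" "0 < \<mu>1" "\<mu>1 < \<mu>2"
    and "\<forall>x \<xi>. \<nu>1 * (norm \<xi>)\<^sup>2 \<le> \<xi> \<bullet> (a x *v \<xi>) \<and> \<xi> \<bullet> (a x *v \<xi>) \<le> \<nu>2 * (norm \<xi>)\<^sup>2"
    and "\<forall>x \<xi>. \<mu>1 * (norm \<xi>)\<^sup>2 \<le> \<xi> \<bullet> (ahat x *v \<xi>) \<and> \<xi> \<bullet> (ahat x *v \<xi>) \<le> \<mu>2 * (norm \<xi>)\<^sup>2"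
    and "smooth V0" "smooth W0"
    and "\<forall>x. U0 x = - (hjb_operator a ahat b W0 x + V0 x)"
    and "filterlim U0 at_top at_infinity"
    and "smooth V" "bounded (range V)" "bounded (range (grad V))"
    and "smallest_constant a ahat b (\<lambda>x. V0 x + V x) \<Lambda>"
    and "ergodic_solution a ahat b (\<lambda>x. V0 x + V x) \<Lambda> W" "W 0 = 0"
    and "\<forall>x. psd_sqrt (\<sigma> x) (a x)"
    and "brownian_motion M F B"
    and "\<forall>x. sde_solution M F B (\<lambda>y. ito_drift a b y + ahat y *v grad W y) \<sigma> x (X x)"
    and "invariant_prob (transition_function M X) \<mu>"
  shows "integrable \<mu> U0 \<and> (\<integral>x. U0 x \<partial>\<mu>) \<le> - \<Lambda> + (SUP x. \<bar>V x\<bar>)"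
proof -
  note a = assms(1) and ahat = assms(2) and b = assms(3) and W0 = assms(13) and sq = assms(22)
  have W: "smooth W" and eqW: "\<And>x. hjb_operator a ahat b W x + (V0 x + V x) = \<Lambda>"
    using assms(20) by (auto simp: ergodic_solution_def)
  have \<nu>2: "0 < \<nu>2" using assms(6,7) by simp
  have Al: "\<nu>1 * (norm \<xi>)\<^sup>2 \<le> \<xi> \<bullet> (a x *v \<xi>)" and Au: "\<xi> \<bullet> (a x *v \<xi>) \<le> \<nu>2 * (norm \<xi>)\<^sup>2"
    and Hl: "\<mu>1 * (norm \<xi>)\<^sup>2 \<le> \<xi> \<bullet> (ahat x *v \<xi>)" for x \<xi>
    using assms(10,11) by auto
  have A0: "0 \<le> \<xi> \<bullet> (a x *v \<xi>)" for x \<xi>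
  proof -
    have "0 \<le> \<nu>1 * (norm \<xi>)\<^sup>2" using assms(6) by simp
    then show ?thesis using Al[of \<xi> x] by linarith
  qed
  interpret \<mu>: prob_space \<mu> using assms(25) by (simp add: invariant_prob_def)
  have mb: "u \<in> borel_measurable \<mu>" if "continuous_on UNIV u" for u :: "real^'n \<Rightarrow> real"
    using borel_measurable_continuous_onI[OF that] assms(25)
    by (simp add: invariant_prob_def measurable_cong_sets[of \<mu> borel])
  \<comment> \<open>Written through the operator, \<open>q\<close> is visibly continuous; the
    equation for \<open>W\<close> and the formula for \<open>U0\<close> then give the form from
    which the lower bound is read off.\<close>
  define q where "q x = hjb_operator a ahat b W x - hjb_operator a ahat b W0 x" for x
  have q: "q x = U0 x + \<Lambda> - V x" for x
    using eqW[of x] assms(14) unfolding q_def by (simp add: algebra_simps)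
  have qc: "continuous_on UNIV q"
    unfolding q_def[abs_def] by (intro continuous_on_diff hjb_operator_continuous a ahat b W W0)
  obtain v where v: "\<And>x. \<bar>V x\<bar> \<le> v" using assms(17) by (auto simp: bounded_iff)
  \<comment> \<open>Outside a large ball \<open>U0\<close> is nonnegative and the rest of
    \<open>q\<close> is bounded; on the ball continuity is enough.\<close>
  obtain c where c: "0 \<le> c" "\<And>x. - c \<le> q x"
  proof -
    have "eventually (\<lambda>x. 0 \<le> U0 x) at_infinity"
      using assms(15) by (simp add: filterlim_at_top)
    then obtain r where r: "\<And>x. r \<le> norm x \<Longrightarrow> 0 \<le> U0 x" by (auto simp: eventually_at_infinity)
    obtain k where k: "0 \<le> k" "\<And>x. norm x \<le> r \<Longrightarrow> norm (q x) \<le> k"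
      using bounded_on_cball[where R=r, OF qc] by metis
    have "- (k + \<bar>\<Lambda>\<bar> + \<bar>v\<bar>) \<le> q x" for x
    proof (cases "norm x \<le> r")
      case True
      with k(2)[of x] have "- k \<le> q x" by (simp add: abs_le_iff)
      with k(1) show ?thesis by linarith
    next
      case False
      with r[of x] v[of x] k(1) show ?thesis unfolding q by linarith
    qed
    then show thesis by (intro that[of "k + \<bar>\<Lambda>\<bar> + \<bar>v\<bar>"]) (use k(1) in auto)
  qed
  \<comment> \<open>The largest e with 2 e \<nu>2 \<le> \<mu>1.\<close>
  define e0 where "e0 = \<mu>1 / (2 * \<nu>2)"
  have e0: "0 < e0" "2 * e0 * \<nu>2 = \<mu>1" using \<nu>2 assms(8) by (simp_all add: e0_def)
  define T where "T e y = tanh (e * (W y - W0 y))" for e y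
  have T1: "\<bar>T e y\<bar> \<le> 1" for e y
    using tanh_real_bounds[of "e * (W y - W0 y)"] by (simp add: T_def abs_le_iff less_imp_le)
  have T2: "0 \<le> 1 - (T e y)\<^sup>2" "1 - (T e y)\<^sup>2 \<le> 1" for e y
    using T1[of e y] by (simp_all add: abs_square_le_1)
  have sT: "smooth (T e)" for e
    unfolding T_def[abs_def] by (intro smooth_tanh smooth_diff W W0)
  have min_b: "\<bar>min (q y) (real m)\<bar> \<le> c + real m" for y and m :: nat
    using c(1) c(2)[of y] by (auto simp: min_def abs_le_iff)
  have Tmin_b: "\<bar>(1 - (T e y)\<^sup>2) * min (q y) (real m)\<bar> \<le> c + real m" for e y and m :: nat
  proof -
    have "(1 - (T e y)\<^sup>2) * \<bar>min (q y) (real m)\<bar> \<le> 1 * (c + real m)"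
      by (intro mult_mono T2 min_b) auto
    then show ?thesis using T2(1)[of e y] by (simp add: abs_mult)
  qed
  have cont: "continuous_on UNIV (\<lambda>y. (1 - (T e y)\<^sup>2) * min (q y) (real m))" for e and m :: nat
    by (intro continuous_intros qc smooth_continuous[OF sT])
  \<comment> \<open>\<open>q\<close> is cut at \<open>m\<close> to obtain a bounded minorant; since
    the weight is nonnegative, cutting only lowers the product, so the generator inequality
    persists.\<close>
  have weighted: "(\<integral>y. (1 - (T e y)\<^sup>2) * min (q y) (real m) \<partial>\<mu>) \<le> 0" if e: "0 < e" "e \<le> e0" for e and m :: nat
  proof -
    have "(\<integral>y. e * ((1 - (T e y)\<^sup>2) * min (q y) (real m)) \<partial>\<mu>) \<le> 0"
    proof (rule invariant_prob_nonpos[where f="T e", OF assms(23,24,25)])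
      show "continuous_on UNIV \<sigma>"
        by (rule psd_sqrt_continuous[OF _ smooth_matrix_continuous[OF a] assms(6) \<nu>2 Al Au]) (use sq in simp)
      show "norm (\<sigma> y) \<le> sqrt (real CARD('n) * \<nu>2)" for y
        by (rule psd_sqrt_norm_le[OF sq[rule_format] Au])
      show "continuous_on UNIV (\<lambda>y. ito_drift a b y + ahat y *v grad W y)"
        by (intro continuous_on_add ito_drift_continuous a b matrix_vector_mult_continuous
          smooth_matrix_continuous ahat grad_continuous W)
      show "continuous_on UNIV (\<lambda>y. e * ((1 - (T e y)\<^sup>2) * min (q y) (real m)))"
        by (intro continuous_on_mult continuous_on_const cont)
      show "\<bar>e * ((1 - (T e y)\<^sup>2) * min (q y) (real m))\<bar> \<le> e * (c + real m)" for y
        using mult_left_mono[OF Tmin_b[of e y m], of e] e by (simp add: abs_mult)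
      show "e * ((1 - (T e y)\<^sup>2) * min (q y) (real m)) \<le> grad (T e) y \<bullet> (ito_drift a b y + ahat y *v grad W y)
        + 1/2 * trace (transpose (\<sigma> y) ** hessian (T e) y ** \<sigma> y)" for y
      proof -
        have "e * ((1 - (T e y)\<^sup>2) * min (q y) (real m)) \<le> e * ((1 - (T e y)\<^sup>2) * q y)"
          using T2(1)[of e y] e by (intro mult_left_mono) auto
        also have "\<dots> = e * (1 - (T e y)\<^sup>2) * (hjb_operator a ahat b W y - hjb_operator a ahat b W0 y)"
          by (simp add: q_def)
        also have "\<dots> \<le> grad (T e) y \<bullet> (ito_drift a b y + ahat y *v grad W y)
            + 1/2 * trace (transpose (\<sigma> y) ** hessian (T e) y ** \<sigma> y)"
        proof -
          have "2 * e * \<nu>2 \<le> \<mu>1" using e \<nu>2 unfolding e0(2)[symmetric] by simp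
          then show ?thesis unfolding T_def[abs_def]
            by (intro generator_tanh_ge[OF a assms(4,5) W W0 sq[rule_format] Au A0 Hl] e(1))
        qed
        finally show ?thesis .
      qed
    qed (rule sT, rule T1)
    then show ?thesis using e(1) by (simp add: mult_le_0_iff)
  qed
  \<comment> \<open>Along e0 / (k + 1) the weight tends to 1 at every point, while c + m dominates
    all products.\<close>
  have trunc: "(\<integral>y. min (q y) (real m) \<partial>\<mu>) \<le> 0" for m :: nat
  proof -
    have "(\<lambda>k. \<integral>y. (1 - (T (e0 / real (Suc k)) y)\<^sup>2) * min (q y) (real m) \<partial>\<mu>) \<longlonglongrightarrow> (\<integral>y. min (q y) (real m) \<partial>\<mu>)"
    proof (rule integral_dominated_convergence[where w="\<lambda>_. c + real m"])
      show "AE y in \<mu>. (\<lambda>k. (1 - (T (e0 / real (Suc k)) y)\<^sup>2) * min (q y) (real m)) \<longlonglongrightarrow> min (q y) (real m)"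
      proof (rule AE_I2)
        fix y
        have "(\<lambda>k. e0 / real (Suc k)) \<longlonglongrightarrow> 0" by (rule LIMSEQ_Suc[OF lim_const_over_n])
        then have "(\<lambda>k. (1 - (tanh (e0 / real (Suc k) * (W y - W0 y)))\<^sup>2) * min (q y) (real m))
          \<longlonglongrightarrow> (1 - (tanh (0 * (W y - W0 y)))\<^sup>2) * min (q y) (real m)"
          by (intro tendsto_intros) auto
        then show "(\<lambda>k. (1 - (T (e0 / real (Suc k)) y)\<^sup>2) * min (q y) (real m)) \<longlonglongrightarrow> min (q y) (real m)"
          by (simp add: T_def del: of_nat_Suc)
      qed
      show "AE y in \<mu>. norm ((1 - (T (e0 / real (Suc k)) y)\<^sup>2) * min (q y) (real m)) \<le> c + real m" for k
        using Tmin_b by (simp del: of_nat_Suc)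
      show "(\<lambda>y. min (q y) (real m)) \<in> borel_measurable \<mu>" by (intro mb continuous_intros qc)
    qed (auto intro!: mb cont)
    then show ?thesis
    proof (rule LIMSEQ_le_const2)
      show "\<exists>N. \<forall>k\<ge>N. (\<integral>y. (1 - (T (e0 / real (Suc k)) y)\<^sup>2) * min (q y) (real m) \<partial>\<mu>) \<le> 0"
        using e0(1) by (intro exI allI impI weighted) (auto simp: field_simps)
    qed
  qed
  \<comment> \<open>The cut at \<open>m\<close> is lifted only after the limit in e, whose
    dominating bound depends on \<open>m\<close>.\<close>
  note iq = \<mu>.integral_nonpos_of_truncations[OF mb[OF qc] c(2) trunc]
  have iV: "integrable \<mu> V"
    by (rule \<mu>.integrable_const_bound[where B=v]) (use v mb[OF smooth_continuous[OF assms(16)]] in auto)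
  have "bdd_above (range (\<lambda>x. \<bar>V x\<bar>))" using v by (intro bdd_aboveI[of _ v]) auto
  then have "V x \<le> (SUP x. \<bar>V x\<bar>)" for x
    using cSUP_upper[of x UNIV "\<lambda>x. \<bar>V x\<bar>"] by simp
  then have "(\<integral>x. V x \<partial>\<mu>) \<le> (\<integral>x. (SUP x. \<bar>V x\<bar>) \<partial>\<mu>)" by (intro integral_mono iV) auto
  then have V_le: "(\<integral>x. V x \<partial>\<mu>) \<le> (SUP x. \<bar>V x\<bar>)" by (simp add: \<mu>.prob_space)
  \<comment> \<open>In this form \<open>q\<close> contributes at most 0 to the integral, and
    \<open>V\<close> at most its supremum norm.\<close>
  have U0: "U0 = (\<lambda>x. q x - \<Lambda> + V x)" by (simp add: q fun_eq_iff)
  have "integrable \<mu> U0" unfolding U0 using iq(1) iV by simp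
  moreover have "(\<integral>x. U0 x \<partial>\<mu>) = (\<integral>x. q x \<partial>\<mu>) - \<Lambda> + (\<integral>x. V x \<partial>\<mu>)"
    unfolding U0 using iq(1) iV by (simp add: \<mu>.prob_space)
  ultimately show ?thesis using iq(2) V_le by linarith
qed

end
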